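(* Let $X$ be a reduced origami and let $N$ be the number of squares of $X$. Let $\alpha\in\mathbb{R}$ be irrational, with continued fraction expansion $\alpha=a_0+[a_1,a_2,\dots]$ and convergents $p_n/q_n=a_0+[a_1,\dots,a_n]$. If $$L_{\mathbb{T}^2}(\alpha)>2M_X(\alpha)^2,\qquad\text{where } M_X(\alpha)=\max_{n\in\mathbb{N}}m_X(p_n/q_n),$$ then $$L_X(\alpha)=N\cdot\limsup_{n\to\infty}\frac{[a_n,\dots,a_1]+a_{n+1}+[a_{n+2},a_{n+3},\dots]}{m_X^2(p_n/q_n)}.$$
   Context: A translation surface $X=(S,w)$ is a compact Riemann surface with a nonzero holomorphic 1-form; its conical singularities are the zeros of $w$ (marked points allowed for tori). A saddle connection is a flat geodesic segment joining two conical singularities with none in its interior; $\mathrm{Hol}(X)\subset\mathbb{C}$ is the set of periods $v=\int_\gamma w$ of saddle connections. For $v\in\mathrm{Hol}(X)$ put $\mathrm{Area}(v)=|\Re v|\cdot|\Im v|$ and $a(X)=\liminf_{|\Im v|\to\infty,\,v\in\mathrm{Hol}(X)}\mathrm{Area}(v)/\mathrm{Area}(X)$. An origami (square-tiled surface) is a translation surface which is a translation cover of $\mathbb{R}^2/\mathbb{Z}^2$ ramified only over $0$, with conical singularities lying over $0$; it is reduced if the subgroup of $\mathbb{R}^2$ generated by $\mathrm{Hol}(X)$ is $\mathbb{Z}^2$. For $\alpha\in\mathbb{R}$ set $L_X(\alpha)=1/a(\mathcal{R}_{\arctan\alpha}\cdot X)$, where $\mathcal{R}_\theta=\begin{pmatrix}\cos\theta&-\sin\theta\\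 \sin\theta&\cos\theta\end{pmatrix}$ acts by post-composition with charts. For the standard torus $\mathbb{T}^2=\mathbb{R}^2/\mathbb{Z}^2$ one has $L_{\mathbb{T}^2}(\alpha)=\limsup_{p,q\to\infty}\frac{1}{q|q\alpha-p|}$. For reduced $X$ and a conical singularity $p$, let $\rho:X\to\mathbb{R}^2/\mathbb{Z}^2$, $\rho(\zeta)=\int_p^\zeta w\bmod\mathbb{Z}^2$. The multiplicity $m(\gamma)$ of a saddle connection is the degree of $\rho\circ\gamma$ onto its image closed geodesic (that is, $\int_\gamma w=\pm m(\gamma)(p'+iq')$ with $p',q'$ coprime integers). For $p/q\in\mathbb{Q}$, $m_X(p/q)$ is the minimum of $m(\gamma)$ over saddle connections $\gamma$ of $X$ parallel to $p+iq$. Notation: $[a_1,a_2,\dots]=\cfrac{1}{a_1+\cfrac{1}{a_2+\cdots}}$. *)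

theory Defs
  imports "HOL-Analysis.Analysis" "HOL-Computational_Algebra.Group_Closure"
begin

section \<open>Translation surfaces\<close>

text \<open>A chart is a pair \<open>(U, \<phi>)\<close>; only the values of \<open>\<phi>\<close> on \<open>U\<close> matter. In the chart \<open>c = (U, \<phi>)\<close>
  the 1-form \<open>w\<close> reads \<open>form X c z dz\<close>, for \<open>z\<close> in \<open>\<phi> ` U\<close>.\<close>

record 'a surface =
  surf :: "'a topology"
  charts :: "('a set \<times> ('a \<Rightarrow> complex)) set"
  form :: "'a set \<times> ('a \<Rightarrow> complex) \<Rightarrow> complex \<Rightarrow> complex"
  marked :: "'a set"

definition riemann_surface :: "'a topology \<Rightarrow> ('a set \<times> ('a \<Rightarrow> complex)) set \<Rightarrow> bool" where
  "riemann_surface T A \<longleftrightarrow>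
     connected_space T \<and> Hausdorff_space T \<and> \<Union> (fst ` A) = topspace T \<and>
     (\<forall>(U, \<phi>) \<in> A. openin T U \<and> open (\<phi> ` U) \<and>
        homeomorphic_map (subtopology T U) (top_of_set (\<phi> ` U)) \<phi>) \<and>
     (\<forall>(U, \<phi>) \<in> A. \<forall>(V, \<psi>) \<in> A. (\<psi> \<circ> inv_into U \<phi>) holomorphic_on (\<phi> ` (U \<inter> V)))"

definition holomorphic_form :: "'a surface \<Rightarrow> bool" where
  "holomorphic_form X \<longleftrightarrow>
     (\<forall>(U, \<phi>) \<in> charts X. form X (U, \<phi>) holomorphic_on (\<phi> ` U)) \<and>
     (\<forall>(U, \<phi>) \<in> charts X. \<forall>(V, \<psi>) \<in> charts X. \<forall>x \<in> U \<inter> V.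
        form X (U, \<phi>) (\<phi> x) = form X (V, \<psi>) (\<psi> x) * deriv (\<psi> \<circ> inv_into U \<phi>) (\<phi> x))"

definition zeros :: "'a surface \<Rightarrow> 'a set" where
  "zeros X = {x. \<exists>(U, \<phi>) \<in> charts X. x \<in> U \<and> form X (U, \<phi>) (\<phi> x) = 0}"

text \<open>Marked points are allowed only when \<open>w\<close> has no zeros, that is, for tori.\<close>

definition translation_surface :: "'a surface \<Rightarrow> bool" where
  "translation_surface X \<longleftrightarrow>
     riemann_surface (surf X) (charts X) \<and> compact_space (surf X) \<and>
     holomorphic_form X \<and> (\<exists>x \<in> topspace (surf X). x \<notin> zeros X) \<and>
     finite (marked X) \<and> marked X \<subseteq> topspace (surf X) \<and> (marked X \<noteq> {} \<longrightarrow> zeros X = {})"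

definition singularities :: "'a surface \<Rightarrow> 'a set" where
  "singularities X = zeros X \<union> marked X"

text \<open>\<open>dF = w\<close> on the open set \<open>W\<close>.\<close>

definition primitive_on :: "'a surface \<Rightarrow> 'a set \<Rightarrow> ('a \<Rightarrow> complex) \<Rightarrow> bool" where
  "primitive_on X W F \<longleftrightarrow> openin (surf X) W \<and>
     (\<forall>(U, \<phi>) \<in> charts X. \<forall>x \<in> U \<inter> W.
        ((F \<circ> inv_into U \<phi>) has_field_derivative form X (U, \<phi>) (\<phi> x)) (at (\<phi> x)))"

text \<open>\<open>g t\<close> is the integral of \<open>w\<close> along the restriction of the continuous path \<open>\<gamma>\<close> to \<open>{0..t}\<close>;
  as \<open>w\<close> is closed, this is obtained by continuing local primitives along \<open>\<gamma>\<close>.\<close>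

definition integral_along :: "'a surface \<Rightarrow> (real \<Rightarrow> 'a) \<Rightarrow> (real \<Rightarrow> complex) \<Rightarrow> bool" where
  "integral_along X \<gamma> g \<longleftrightarrow> g 0 = 0 \<and>
     (\<forall>t \<in> {0..1}. \<exists>W F e. primitive_on X W F \<and> e > 0 \<and>
        (\<forall>s \<in> {0..1}. \<bar>s - t\<bar> < e \<longrightarrow> \<gamma> s \<in> W \<and> F (\<gamma> s) - F (\<gamma> t) = g s - g t))"

text \<open>A saddle connection \<open>\<gamma>\<close> with period \<open>v\<close>. In flat coordinates it is a segment
  traversed with constant velocity \<open>v\<close>, so its integral up to time \<open>t\<close> is \<open>t v\<close>.\<close>

definition saddle_connection :: "'a surface \<Rightarrow> (real \<Rightarrow> 'a) \<Rightarrow> complex \<Rightarrow> bool" where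
  "saddle_connection X \<gamma> v \<longleftrightarrow> v \<noteq> 0 \<and> pathin (surf X) \<gamma> \<and>
     \<gamma> 0 \<in> singularities X \<and> \<gamma> 1 \<in> singularities X \<and>
     (\<forall>t \<in> {0<..<1}. \<gamma> t \<notin> singularities X) \<and>
     integral_along X \<gamma> (\<lambda>t. complex_of_real t * v)"

definition Hol :: "'a surface \<Rightarrow> complex set" where
  "Hol X = {v. \<exists>\<gamma>. saddle_connection X \<gamma> v}"

text \<open>Flat area: the supremum of the total Lebesgue measure of finite families of pairwise
  disjoint open sets, each embedded in the plane by a primitive of \<open>w\<close>.\<close>

definition surface_area :: "'a surface \<Rightarrow> ennreal" where
  "surface_area X =
     (SUP D \<in> {D :: ('a set \<times> ('a \<Rightarrow> complex)) set. finite D \<and>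
                 (\<forall>(U, F) \<in> D. primitive_on X U F \<and> inj_on F U) \<and>
                 pairwise (\<lambda>(U, _) (V, _). disjnt U V) D}.
        \<Sum>(U, F) \<in> D. emeasure lborel (F ` U))"

definition vec_area :: "complex \<Rightarrow> real" where
  "vec_area v = \<bar>Re v\<bar> * \<bar>Im v\<bar>"

definition area_liminf :: "'a surface \<Rightarrow> ereal" where
  "area_liminf X =
     Liminf (inf (filtercomap (\<lambda>v. \<bar>Im v\<bar>) at_top) (principal (Hol X)))
       (\<lambda>v. ereal (vec_area v / enn2real (surface_area X)))"

text \<open>Post-composing the flat charts (the local primitives of \<open>w\<close>) with the rotation by \<open>\<theta>\<close>
  leaves the complex structure unchanged and replaces \<open>w\<close> by \<open>cis \<theta> * w\<close>.\<close>

definition rotate_surface :: "real \<Rightarrow> 'a surface \<Rightarrow> 'a surface" where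
  "rotate_surface \<theta> X = X\<lparr>form := (\<lambda>c z. cis \<theta> * form X c z)\<rparr>"

text \<open>Here \<open>1 / 0 = \<infinity>\<close>.\<close>

definition lagrange :: "'a surface \<Rightarrow> real \<Rightarrow> ereal" where
  "lagrange X \<alpha> = 1 / area_liminf (rotate_surface (arctan \<alpha>) X)"


section \<open>The standard torus and origamis\<close>

definition gaussian_ints :: "complex set" where
  "gaussian_ints = {Complex (of_int a) (of_int b) | a b. True}"

definition torus_proj :: "complex \<Rightarrow> complex set" where
  "torus_proj z = {z + l | l. l \<in> gaussian_ints}"

text \<open>The quotient of the plane by the Gaussian integers, with the quotient topology, the form
  \<open>dz\<close>, and the origin as marked point.\<close>

definition standard_torus :: "complex set surface" where
  "standard_torus =
     \<lparr>surf = topology (\<lambda>U. U \<subseteq> range torus_proj \<and> open (torus_proj -` U)),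
      charts = {(torus_proj ` W, inv_into W torus_proj) | W. open W \<and> inj_on torus_proj W},
      form = (\<lambda>_ _. 1),
      marked = {torus_proj 0}\<rparr>"

text \<open>A surjective continuous map that pulls back the form of \<open>Y\<close> to the form of \<open>X\<close> (hence is
  holomorphic), and that is a covering map away from \<open>B\<close>.\<close>

definition translation_cover ::
  "'a surface \<Rightarrow> 'b surface \<Rightarrow> 'b set \<Rightarrow> ('a \<Rightarrow> 'b) \<Rightarrow> bool" where
  "translation_cover X Y B \<rho> \<longleftrightarrow>
     continuous_map (surf X) (surf Y) \<rho> \<and> \<rho> ` topspace (surf X) = topspace (surf Y) \<and>
     (\<forall>V F. primitive_on Y V F \<longrightarrow> primitive_on X {x \<in> topspace (surf X). \<rho> x \<in> V} (F \<circ> \<rho>)) \<and>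
     (\<forall>y \<in> topspace (surf Y) - B. \<exists>V \<U>. openin (surf Y) V \<and> y \<in> V \<and> V \<inter> B = {} \<and>
        \<Union> \<U> = {x \<in> topspace (surf X). \<rho> x \<in> V} \<and> pairwise disjnt \<U> \<and>
        (\<forall>U \<in> \<U>. openin (surf X) U \<and>
           homeomorphic_map (subtopology (surf X) U) (subtopology (surf Y) V) \<rho>))"

text \<open>An origami together with its covering map. For a nonempty set of singularities the
  covering map is determined by \<open>X\<close>: it is \<open>\<zeta> \<mapsto> \<integral> w\<close> from a singularity to \<open>\<zeta>\<close>, modulo the
  Gaussian integers.\<close>

definition origami :: "'a surface \<Rightarrow> ('a \<Rightarrow> complex set) \<Rightarrow> bool" where
  "origami X \<rho> \<longleftrightarrow> translation_surface X \<and>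
     translation_cover X standard_torus {torus_proj 0} \<rho> \<and>
     \<rho> ` singularities X \<subseteq> {torus_proj 0}"

definition reduced_surface :: "'a surface \<Rightarrow> bool" where
  "reduced_surface X \<longleftrightarrow> group_closure (Hol X) = gaussian_ints"

text \<open>The (open) squares are the components of the preimage of the open unit square.\<close>

definition num_squares :: "'a surface \<Rightarrow> ('a \<Rightarrow> complex set) \<Rightarrow> nat" where
  "num_squares X \<rho> =
     card (connected_components_of (subtopology (surf X)
       {x \<in> topspace (surf X). \<rho> x \<in> torus_proj ` {z. 0 < Re z \<and> Re z < 1 \<and> 0 < Im z \<and> Im z < 1}}))"


section \<open>Multiplicities\<close>

text \<open>The multiplicity of a saddle connection depends only on its period \<open>v\<close>; the sign is absorbed
  in the coprime pair \<open>p\<close>, \<open>q\<close>.\<close>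

definition saddle_mult :: "complex \<Rightarrow> nat" where
  "saddle_mult v = (THE m. m > 0 \<and>
     (\<exists>p q :: int. coprime p q \<and> v = of_nat m * Complex (of_int p) (of_int q)))"

definition parallel :: "complex \<Rightarrow> complex \<Rightarrow> bool" where
  "parallel v u \<longleftrightarrow> (\<exists>t :: real. t \<noteq> 0 \<and> v = complex_of_real t * u)"

definition min_mult :: "'a surface \<Rightarrow> rat \<Rightarrow> nat" where
  "min_mult X r = (case quotient_of r of (p, q) \<Rightarrow>
     (LEAST m. \<exists>\<gamma> v. saddle_connection X \<gamma> v \<and> parallel v (Complex (of_int p) (of_int q)) \<and>
        saddle_mult v = m))"


section \<open>Continued fractions\<close>

text \<open>\<open>cfrac [x1, \<dots>, xn] = 1 / (x1 + 1 / (x2 + \<dots>))\<close>\<close>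

fun cfrac :: "'a :: field list \<Rightarrow> 'a" where
  "cfrac [] = 0"
| "cfrac (x # xs) = 1 / (x + cfrac xs)"

text \<open>\<open>cfrac_inf b = [b 0, b 1, b 2, \<dots>]\<close>; the limit exists when all \<open>b k\<close> are positive.\<close>

definition cfrac_inf :: "(nat \<Rightarrow> int) \<Rightarrow> real" where
  "cfrac_inf b = lim (\<lambda>n. cfrac (map (\<lambda>k. of_int (b k)) [0..<n]))"

definition cfrac_expansion :: "real \<Rightarrow> (nat \<Rightarrow> int) \<Rightarrow> bool" where
  "cfrac_expansion \<alpha> a \<longleftrightarrow>
     (\<forall>n \<ge> 1. a n \<ge> 1) \<and> \<alpha> = of_int (a 0) + cfrac_inf (\<lambda>k. a (k + 1))"

definition cfrac_conv :: "(nat \<Rightarrow> int) \<Rightarrow> nat \<Rightarrow> rat" where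
  "cfrac_conv a n = of_int (a 0) + cfrac (map (\<lambda>k. of_int (a k)) [1..<n + 1])"

text \<open>The multiplicities of an origami are bounded, so the maximum below is over a finite set.\<close>

definition max_mult :: "'a surface \<Rightarrow> (nat \<Rightarrow> int) \<Rightarrow> nat" where
  "max_mult X a = Max (range (\<lambda>n. min_mult X (cfrac_conv a n)))"

end

theory Submission
  imports Defs "HOL-Complex_Analysis.Conformal_Mappings"
begin

text \<open>Rotating by \<open>arctan \<alpha>\<close> turns the period \<open>m (p + i q)\<close>, with \<open>p\<close> and \<open>q\<close> coprime, into a vector of area
  \<open>m\<^sup>2 q \<bar>q \<alpha> - p\<bar>\<close> up to an error that vanishes when the vector is far away with bounded area. As \<open>X\<close> is
  reduced, all periods are Gaussian integers. By Legendre's theorem a far period of area below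
  \<open>1 / 2\<close> has the direction of a convergent \<open>p\<^sub>n / q\<^sub>n\<close>, and then \<open>m\<close> is at least the multiplicity of that
  direction; the hypothesis on the torus makes the limit inferior less than \<open>1 / 2\<close>, so that only such
  periods matter. Conversely the minimal multiplicity is realised in each direction. For this one needs
  a saddle connection in every rational direction, of multiplicity bounded independently of the
  direction, and this comes from lifting segments through the covering of the torus. The formula
  \<open>1 / (q\<^sub>n \<bar>q\<^sub>n \<alpha> - p\<^sub>n\<bar>) = [a\<^sub>n, \<dots>, a\<^sub>1] + a\<^sub>n\<^sub>+\<^sub>1 + [a\<^sub>n\<^sub>+\<^sub>2, \<dots>]\<close> and the fact that the area of \<open>X\<close> is its
  number of squares finish the proof.\<close>

section \<open>Continued fractions\<close>

text \<open>The covering hypothesis is silent over the lattice point, exactly where all segments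
  begin and end. Lifts come from it only over open segments, which avoid the lattice because their
  direction is primitive; the ends are recovered by complex analysis. In a chart
  \<open>\<rho>\<close> is a holomorphic function modulo the lattice. Its zeros are isolated, so by
  compactness the fibre over the lattice point is finite and open lifts have limits there; the open
  mapping theorem shows that a segment leaves every point of that fibre in every primitive
  direction. The multiplicity bound must serve all convergents at once: a chain of lifts is no
  longer than the fibre over the midpoint of the segment, and modulo the lattice at most four
  midpoints occur. The torus covers itself by the identity, so its area and its periods are handled
  by the same lemmas, with all multiplicities equal to 1. The constant 2 in the hypothesis is that
  of Legendre's theorem: if \<open>(mult n)\<^sup>2 / height n\<close> were eventually at least
  \<open>1 / 2\<close>, then \<open>1 / height n\<close> would be at least
  \<open>1 / (2 * M\<^sup>2)\<close>, with \<open>M\<close> the largest multiplicity, against the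
  hypothesis.\<close>

lemma cfrac_map_Suc:
  "cfrac (map f [0..<Suc n]) = 1 / (f 0 + cfrac (map (\<lambda>k. f (Suc k)) [0..<n]))"
  by (simp add: upt_conv_Cons map_Suc_upt[symmetric] comp_def del: upt_Suc)

lemma cfrac_pos_bounds:
  fixes b :: "nat \<Rightarrow> int"
  assumes "\<And>k. b k \<ge> 1"
  shows "0 \<le> cfrac (map (\<lambda>k. real_of_int (b k)) [0..<n])"
    and "cfrac (map (\<lambda>k. real_of_int (b k)) [0..<n]) \<le> 1"
proof -
  have "0 \<le> cfrac (map (\<lambda>k. real_of_int (b k)) [0..<n]) \<and> cfrac (map (\<lambda>k. real_of_int (b k)) [0..<n]) \<le> 1"
    using assms
  proof (induction n arbitrary: b)
    case (Suc n)
    have *: "0 \<le> cfrac (map (\<lambda>k. real_of_int (b (Suc k))) [0..<n])" using Suc.IH[of "\<lambda>k. b (Suc k)"] Suc.prems by auto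
    have "real_of_int (b 0) \<ge> 1" using Suc.prems[of 0] by linarith
    with * show ?case unfolding cfrac_map_Suc by (auto simp: divide_simps)
  qed simp
  then show "0 \<le> cfrac (map (\<lambda>k. real_of_int (b k)) [0..<n])"
    and "cfrac (map (\<lambda>k. real_of_int (b k)) [0..<n]) \<le> 1" by auto
qed

text \<open>One level of the fraction need not contract: for \<open>b 0 = 1\<close> and a tail near
  0 the map \<open>x \<mapsto> 1 / (b 0 + x)\<close> has slope near -1. Two levels give
  \<open>(d + x) / (c * (d + x) + 1)\<close>, whose denominators are at least 2, hence the factor
  \<open>1 / 4\<close>.\<close>

lemma cfrac_contract:
  fixes b :: "nat \<Rightarrow> int"
  assumes "\<And>k. b k \<ge> 1"
  shows "\<bar>cfrac (map (\<lambda>k. real_of_int (b k)) [0..<2 * k + m]) - cfrac (map (\<lambda>k. real_of_int (b k)) [0..<2 * k + m'])\<bar>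
      \<le> (1 / 4) ^ k"
  using assms
proof (induction k arbitrary: b)
  case 0
  show ?case using cfrac_pos_bounds[of b m] cfrac_pos_bounds[of b m'] 0 by auto
next
  case (Suc k)
  let ?F = "\<lambda>n. cfrac (map (\<lambda>k. real_of_int (b (Suc (Suc k)))) [0..<n])"
  define x y where "x = ?F (2 * k + m)" and "y = ?F (2 * k + m')"
  have 1: "b 0 \<ge> 1" "b 1 \<ge> 1" using Suc.prems by auto
  define c d where "c = real_of_int (b 0)" and "d = real_of_int (b 1)"
  have cd: "c \<ge> 1" "d \<ge> 1" using 1 by (auto simp: c_def d_def)
  have xy: "x \<ge> 0" "y \<ge> 0" unfolding x_def y_def using cfrac_pos_bounds(1)[of "\<lambda>k. b (Suc (Suc k))"] Suc.prems by auto
  have IH: "\<bar>x - y\<bar> \<le> (1/4)^k" unfolding x_def y_def using Suc.IH[of "\<lambda>k. b (Suc (Suc k))"] Suc.prems by auto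
  have F: "cfrac (map (\<lambda>k. real_of_int (b k)) [0..<2 * Suc k + j]) = (d + z) / (c * (d + z) + 1)"
    if "z = ?F (2 * k + j)" "z \<ge> 0" for z j
  proof -
    have "2 * Suc k + j = Suc (Suc (2 * k + j))" by simp
    then show ?thesis
      apply (simp only: cfrac_map_Suc that(1)[symmetric])
      using cd that(2) mult_nonneg_nonneg[of c z] by (simp add: c_def[symmetric] d_def[symmetric, simplified] add_pos_nonneg divide_simps) (simp add: algebra_simps)?
  qed
  have pos: "c * (d + x) + 1 \<ge> 2" "c * (d + y) + 1 \<ge> 2"
    using mult_mono[of 1 c 1 "d + x"] mult_mono[of 1 c 1 "d + y"] cd xy by auto
  have "(d + x) / (c * (d + x) + 1) - (d + y) / (c * (d + y) + 1) = (x - y) / ((c * (d + x) + 1) * (c * (d + y) + 1))"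
    using pos by (simp add: divide_simps) (simp add: algebra_simps)
  also have "\<bar>\<dots>\<bar> = \<bar>x - y\<bar> / ((c * (d + x) + 1) * (c * (d + y) + 1))"
    using pos by (simp add: abs_mult abs_of_pos)
  also have "\<dots> \<le> \<bar>x - y\<bar> / (2 * 2)"
    using pos by (intro divide_left_mono mult_mono mult_pos_pos) auto
  also have "\<dots> \<le> (1 / 4) ^ Suc k" using IH by simp
  finally show ?case unfolding F[OF x_def xy(1)] F[OF y_def xy(2)] .
qed

text \<open>\<open>cfrac_inf\<close> is a bare \<open>lim\<close> and carries information only when
  the limit exists; the contraction makes the truncations Cauchy.\<close>

lemma cfrac_inf_tendsto:
  fixes b :: "nat \<Rightarrow> int"
  assumes "\<And>k. b k \<ge> 1"
  shows "(\<lambda>n. cfrac (map (\<lambda>k. real_of_int (b k)) [0..<n])) \<longlonglongrightarrow> cfrac_inf b"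
proof -
  have "Cauchy (\<lambda>n. cfrac (map (\<lambda>k. real_of_int (b k)) [0..<n]))"
  proof (rule metric_CauchyI)
    fix e :: real assume "e > 0"
    then obtain k where k: "(1 / 4) ^ k < e" using real_arch_pow_inv[of e "1/4"] by auto
    have "dist (cfrac (map (\<lambda>k. real_of_int (b k)) [0..<m])) (cfrac (map (\<lambda>k. real_of_int (b k)) [0..<n])) < e"
      if "m \<ge> 2 * k" "n \<ge> 2 * k" for m n
      using cfrac_contract[of b k "m - 2 * k" "n - 2 * k"] assms that k by (simp add: dist_real_def)
    then show "\<exists>M. \<forall>m\<ge>M. \<forall>n\<ge>M. dist (cfrac (map (\<lambda>k. real_of_int (b k)) [0..<m]))
        (cfrac (map (\<lambda>k. real_of_int (b k)) [0..<n])) < e" by blast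
  qed
  then have "convergent (\<lambda>n. cfrac (map (\<lambda>k. real_of_int (b k)) [0..<n]))"
    by (simp add: Cauchy_convergent_iff)
  then show ?thesis unfolding cfrac_inf_def by (simp add: convergent_LIMSEQ_iff)
qed

lemma cfrac_inf_rec:
  fixes b :: "nat \<Rightarrow> int"
  assumes "\<And>k. b k \<ge> 1"
  shows "cfrac_inf b = 1 / (real_of_int (b 0) + cfrac_inf (\<lambda>k. b (Suc k)))"
    and "cfrac_inf b \<ge> 0"
proof -
  have nn: "cfrac_inf b \<ge> 0" if "\<And>k. b k \<ge> 1" for b :: "nat \<Rightarrow> int"
    using cfrac_inf_tendsto[of b, OF that] cfrac_pos_bounds(1)[of b, OF that]
    by (intro tendsto_lowerbound[where F = sequentially]) auto
  show "cfrac_inf b \<ge> 0" using nn assms by blast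
  have "b 0 \<ge> 1" using assms by blast
  then have "real_of_int (b 0) \<ge> 1" by simp
  then have "real_of_int (b 0) + cfrac_inf (\<lambda>k. b (Suc k)) \<noteq> 0" using nn[of "\<lambda>k. b (Suc k)"] assms by (metis add_nonneg_eq_0_iff not_one_le_zero order_trans zero_le_one)
  then have "(\<lambda>n. 1 / (real_of_int (b 0) + cfrac (map (\<lambda>k. real_of_int (b (Suc k))) [0..<n])))
      \<longlonglongrightarrow> 1 / (real_of_int (b 0) + cfrac_inf (\<lambda>k. b (Suc k)))"
    using assms by (intro tendsto_intros cfrac_inf_tendsto) auto
  moreover have "(\<lambda>n. 1 / (real_of_int (b 0) + cfrac (map (\<lambda>k. real_of_int (b (Suc k))) [0..<n]))) \<longlonglongrightarrow> cfrac_inf b"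
    using LIMSEQ_Suc[OF cfrac_inf_tendsto[of b]] assms unfolding cfrac_map_Suc by auto
  ultimately show "cfrac_inf b = 1 / (real_of_int (b 0) + cfrac_inf (\<lambda>k. b (Suc k)))"
    using LIMSEQ_unique by blast
qed

text \<open>The indices are shifted by one: the convergents are \<open>cnum a (Suc n) / cden a (Suc n)\<close>.\<close>

fun cnum :: "(nat \<Rightarrow> int) \<Rightarrow> nat \<Rightarrow> int" where
  "cnum a 0 = 1"
| "cnum a (Suc 0) = a 0"
| "cnum a (Suc (Suc n)) = a (Suc n) * cnum a (Suc n) + cnum a n"

fun cden :: "(nat \<Rightarrow> int) \<Rightarrow> nat \<Rightarrow> int" where
  "cden a 0 = 0"
| "cden a (Suc 0) = 1"
| "cden a (Suc (Suc n)) = a (Suc n) * cden a (Suc n) + cden a n"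

lemma cnum_cden_det: "cnum a (Suc n) * cden a n - cnum a n * cden a (Suc n) = (-1) ^ Suc n"
  by (induction n) (auto simp: algebra_simps)

lemma coprime_cnum_cden: "coprime (cnum a n) (cden a n)"
proof (rule coprimeI)
  fix c assume "c dvd cnum a n" "c dvd cden a n"
  then have "c dvd (-1) ^ Suc n" unfolding cnum_cden_det[of a n, symmetric] by simp
  moreover have "(-1) ^ Suc n dvd (1 :: int)" by (cases "even n") auto
  ultimately show "is_unit c" by (meson dvd_trans)
qed

section \<open>Convergents, approximation errors and Legendre's theorem\<close>

locale irrational_cfrac =
  fixes \<alpha> :: real and a :: "nat \<Rightarrow> int"
  assumes irrational: "\<alpha> \<notin> \<rat>" and expansion: "cfrac_expansion \<alpha> a"
begin

lemma a_pos: "n \<ge> 1 \<Longrightarrow> a n \<ge> 1"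
  using expansion by (auto simp: cfrac_expansion_def)

text \<open>The remainder \<open>[a (n + 1), a (n + 2), \<dots>]\<close>; its inverse is the
  complete quotient of index \<open>n + 1\<close>.\<close>

definition tail :: "nat \<Rightarrow> real" where
  "tail n = cfrac_inf (\<lambda>k. a (n + 1 + k))"

lemma tail_rec: "tail n = 1 / (a (n + 1) + tail (n + 1))"
  using cfrac_inf_rec(1)[of "\<lambda>k. a (n + 1 + k)"] a_pos by (simp add: tail_def)

lemma tail_nonneg: "tail n \<ge> 0"
  using cfrac_inf_rec(2)[of "\<lambda>k. a (n + 1 + k)"] a_pos by (simp add: tail_def)

lemma tail_pos: "tail n > 0"
  using tail_rec[of n] tail_nonneg[of "n + 1"] a_pos[of "n + 1"]
  by (metis add.commute add_pos_nonneg divide_pos_pos le_add1 of_int_0_less_iff zero_less_one int_one_le_iff_zero_less)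

lemma inverse_tail: "1 / tail n = a (n + 1) + tail (n + 1)"
  by (subst tail_rec) simp

lemma cden_pos: "cden a (Suc n) \<ge> 1"
proof -
  have "cden a n \<ge> 0 \<and> cden a (Suc n) \<ge> 1"
  proof (induction n)
    case (Suc n)
    have "a (Suc n) * cden a (Suc n) \<ge> 1 * 1" using a_pos[of "Suc n"] Suc by (intro mult_mono) auto
    then show ?case using Suc by auto
  qed auto
  then show ?thesis by simp
qed

lemma cden_nonneg: "cden a n \<ge> 0"
  using cden_pos[of "n - 1"] by (cases n) auto

lemma cden_growth: "cden a (Suc (Suc n)) \<ge> cden a (Suc n) + cden a n"
  using mult_mono[of 1 "a (Suc n)" "cden a (Suc n)" "cden a (Suc n)"] a_pos[of "Suc n"] cden_nonneg[of "Suc n"]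
  by simp

text \<open>Linear growth suffices for all later uses: few convergents have a small denominator, the
  errors tend to 0, and the convergent vectors go to infinity. The increment \<open>cden a n\<close>
  is positive only for \<open>n > 0\<close>, which is why \<open>n = 1\<close> is a case of its
  own.\<close>

lemma cden_ge: "cden a (Suc n) \<ge> int n"
proof (induction n rule: less_induct)
  case (less n)
  show ?case
  proof (cases n)
    case (Suc m)
    show ?thesis
    proof (cases m)
      case 0 then show ?thesis using Suc cden_pos[of n] by simp
    next
      case (Suc k)
      then show ?thesis using \<open>n = Suc m\<close> less[of m] cden_growth[of m] cden_pos[of k] by (simp del: cden.simps)
    qed
  qed simp
qed

text \<open>The signed error \<open>q \<alpha> - p\<close> at the shifted index:
  \<open>theta 0 = -1\<close>, and \<open>theta (Suc n)\<close> belongs to the n-th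
  convergent.\<close>

definition theta :: "nat \<Rightarrow> real" where
  "theta n = cden a n * \<alpha> - cnum a n"

text \<open>The errors satisfy the recurrence of the convergents, and \<open>inverse_tail\<close> is
  precisely what keeps the ratio equal to \<open>- tail n\<close>. As tails are positive, errors
  never vanish and alternate in sign.\<close>

lemma theta_Suc: "theta (Suc n) = - tail n * theta n"
proof (induction n)
  case 0
  have "\<alpha> = a 0 + tail 0" using expansion by (simp add: cfrac_expansion_def tail_def)
  then have "tail 0 = \<alpha> - a 0" by simp
  then show ?case by (simp add: theta_def)
next
  case (Suc n)
  have "theta (Suc (Suc n)) = a (Suc n) * theta (Suc n) + theta n" by (simp add: theta_def algebra_simps)
  also have "theta n = - theta (Suc n) * (1 / tail n)" using Suc tail_pos[of n] by simp
  also have "a (Suc n) * theta (Suc n) + \<dots> = - tail (Suc n) * theta (Suc n)"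
    unfolding inverse_tail by (simp add: algebra_simps)
  finally show ?case .
qed

lemma theta_nonzero: "theta n \<noteq> 0"
proof (induction n)
  case (Suc n)
  then show ?case using tail_pos[of n] by (simp add: theta_Suc)
qed (simp add: theta_def)

lemma theta_opposite: "theta n * theta (Suc n) < 0"
  using theta_nonzero[of n] tail_pos[of n] unfolding theta_Suc
  by (metis mult.commute mult_minus_left neg_less_0_iff_less mult.assoc mult_pos_pos not_real_square_gt_zero zero_less_mult_iff)

text \<open>The determinant identity says that \<open>?q * theta n - ?r * theta (Suc n)\<close> is 1
  up to sign. Replacing \<open>theta n\<close> by \<open>- theta (Suc n) / tail n\<close> leaves
  \<open>\<bar>theta (Suc n)\<bar> * (?q / tail n + ?r) = 1\<close>, and \<open>1 / tail n\<close>
  splits into the next partial quotient and the next tail.\<close>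

lemma abs_theta: "1 / (cden a (Suc n) * \<bar>theta (Suc n)\<bar>) = cden a n / cden a (Suc n) + a (Suc n) + tail (Suc n)"
proof -
  let ?q = "real_of_int (cden a (Suc n))" and ?r = "real_of_int (cden a n)"
  have q: "?q > 0" using cden_pos[of n] by simp
  have "real_of_int (cnum a (Suc n) * cden a n - cnum a n * cden a (Suc n)) = (-1) ^ Suc n"
    unfolding cnum_cden_det by simp
  then have "?q * theta n - ?r * theta (Suc n) = (-1) ^ Suc n" by (simp add: theta_def algebra_simps)
  moreover have "theta n = - theta (Suc n) * (1 / tail n)" using tail_pos[of n] by (simp add: theta_Suc)
  ultimately have "- theta (Suc n) * (?q / tail n + ?r) = (-1) ^ Suc n" by (simp add: algebra_simps)
  then have "\<bar>theta (Suc n)\<bar> * \<bar>?q / tail n + ?r\<bar> = 1" by (metis abs_minus_cancel abs_mult power_abs abs_one power_one)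
  moreover have "?q / tail n + ?r > 0" using q tail_pos[of n] cden_nonneg[of n] by (simp add: add_pos_nonneg)
  ultimately have "\<bar>theta (Suc n)\<bar> = 1 / (?q / tail n + ?r)" by (simp add: divide_simps)
  then have "1 / (?q * \<bar>theta (Suc n)\<bar>) = (?q * (1 / tail n) + ?r) / ?q" by simp
  also have "\<dots> = ?r / ?q + (1 / tail n)" using q by (simp add: divide_simps)
  finally show ?thesis by (simp add: inverse_tail)
qed

text \<open>Read as a recursion for the ratio of consecutive denominators, the recurrence of
  \<open>cden\<close> puts the newest partial quotient outermost, whence the reversed order.\<close>

lemma cfrac_rev: "cfrac (map (\<lambda>k. real_of_int (a k)) (rev [1..<n + 1])) = cden a n / cden a (Suc n)"
proof (induction n)
  case (Suc n)
  have "rev [1..<Suc n + 1] = Suc n # rev [1..<n + 1]" by simp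
  then have "cfrac (map (\<lambda>k. real_of_int (a k)) (rev [1..<Suc n + 1]))
      = 1 / (a (Suc n) + cden a n / cden a (Suc n))" by (simp only: list.map cfrac.simps Suc)
  also have "\<dots> = cden a (Suc n) / cden a (Suc (Suc n))"
    using cden_pos[of n] cden_pos[of "Suc n"] by (simp add: field_simps)
  finally show ?case .
qed simp

text \<open>The numerator in the theorem; by \<open>height_eq\<close> it is
  \<open>1 / (q * \<bar>q * \<alpha> - p\<bar>)\<close> for the n-th convergent.\<close>

definition height :: "nat \<Rightarrow> real" where
  "height n = cfrac (map (\<lambda>k. real_of_int (a k)) (rev [1..<n + 1])) + real_of_int (a (n + 1))
         + cfrac_inf (\<lambda>k. a (n + 2 + k))"

lemma height_eq: "1 / height n = cden a (Suc n) * \<bar>theta (Suc n)\<bar>"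
proof -
  have "height n = 1 / (cden a (Suc n) * \<bar>theta (Suc n)\<bar>)"
    unfolding abs_theta height_def cfrac_rev tail_def by simp
  then show ?thesis by simp
qed

lemma height_pos: "height n > 0"
proof -
  have "1 / height n > 0" unfolding height_eq using cden_pos[of n] theta_nonzero[of "Suc n"] by simp
  then show ?thesis by simp
qed

lemma theta_tendsto_0: "(\<lambda>n. theta (Suc n)) \<longlonglongrightarrow> 0"
proof (rule Lim_null_comparison[where g = "\<lambda>n. 1 / real n"])
  have "norm (theta (Suc n)) \<le> 1 / real n" if "n > 0" for n
  proof -
    have "height n \<ge> 1"
    proof -
      have "real_of_int (cden a n) / real_of_int (cden a (Suc n)) \<ge> 0" using cden_nonneg by simp
      moreover have "real_of_int (a (n + 1)) \<ge> 1" using a_pos[of "n + 1"] by simp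
      moreover have "cfrac_inf (\<lambda>k. a (n + 2 + k)) \<ge> 0" using tail_nonneg[of "n + 1"] by (simp add: tail_def)
      ultimately show ?thesis unfolding height_def cfrac_rev by linarith
    qed
    then have *: "cden a (Suc n) * \<bar>theta (Suc n)\<bar> \<le> 1" unfolding height_eq[symmetric] by simp
    have "real n \<le> cden a (Suc n)" using cden_ge[of n] by linarith
    then have "real n * \<bar>theta (Suc n)\<bar> \<le> 1" using * by (meson abs_ge_zero mult_right_mono order_trans)
    then show ?thesis using that by (simp add: field_simps)
  qed
  then show "\<forall>\<^sub>F n in sequentially. norm (theta (Suc n)) \<le> 1 / real n"
    by (auto simp: eventually_sequentially intro!: exI[of _ 1])
  show "(\<lambda>n. 1 / real n) \<longlonglongrightarrow> 0" by (rule lim_1_over_n)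
qed

text \<open>The law of best approximation. Consecutive convergents form a basis of the integer
  lattice, so \<open>(p, q)\<close> is an integer combination of \<open>(P, Q)\<close> and
  \<open>(P', Q')\<close> with coefficients \<open>x\<close> and \<open>y\<close>. The range of
  \<open>q\<close> forces \<open>x \<noteq> 0\<close> and \<open>x * y \<le> 0\<close>; as the
  errors alternate in sign, the two contributions to \<open>q * \<alpha> - p\<close> cannot
  cancel.\<close>

lemma abs_theta_le:
  fixes p q :: int
  assumes q: "0 < q" "q < cden a (Suc (Suc n))"
  shows "\<bar>theta (Suc n)\<bar> \<le> \<bar>q * \<alpha> - p\<bar>"
proof -
  define P Q P' Q' where "P = cnum a (Suc n)" and "Q = cden a (Suc n)" and "P' = cnum a (Suc (Suc n))" and "Q' = cden a (Suc (Suc n))"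
  \<comment> \<open>The determinant squares to 1, so multiplying by it inverts the matrix and
    Cramer's rule stays in the integers.\<close>
  define s where "s = P' * Q - P * Q'"
  have s: "s * s = 1" unfolding s_def P_def Q_def P'_def Q'_def cnum_cden_det by (simp flip: power_add)
  define x y where "x = s * (P' * q - Q' * p)" and "y = s * (Q * p - P * q)"
  have p_eq: "p = x * P + y * P'"
  proof -
    have "x * P + y * P' = s * s * p" unfolding x_def y_def by (subst (3) s_def) (simp add: algebra_simps)
    then show ?thesis using s by simp
  qed
  have q_eq: "q = x * Q + y * Q'"
  proof -
    have "x * Q + y * Q' = s * s * q" unfolding x_def y_def by (subst (3) s_def) (simp add: algebra_simps)
    then show ?thesis using s by simp
  qed
  have QQ: "Q \<ge> 1" "Q' \<ge> 1" unfolding Q_def Q'_def by (rule cden_pos)+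
  have eq: "q * \<alpha> - p = x * theta (Suc n) + y * theta (Suc (Suc n))"
    unfolding p_eq q_eq theta_def P_def Q_def P'_def Q'_def by (simp add: algebra_simps)
  have x0: "x \<noteq> 0"
  proof
    assume "x = 0"
    then have "q = y * Q'" using q_eq by simp
    moreover from this have "y \<ge> 1" using q QQ by (smt (verit) mult_nonpos_nonneg)
    ultimately have "q \<ge> Q'" using QQ by simp
    then show False using q by (simp add: Q'_def)
  qed
  have "x * y \<le> 0"
  proof (rule ccontr)
    assume "\<not> x * y \<le> 0"
    then consider "x \<ge> 1" "y \<ge> 1" | "x \<le> -1" "y \<le> -1" by (smt (verit) mult_nonneg_nonpos mult_nonpos_nonneg)
    then show False
    proof cases
      case 1
      then have "x * Q \<ge> 1 * 1" "y * Q' \<ge> 1 * Q'" using QQ by (auto intro!: mult_mono simp del: mult_1 mult_1_right)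
      then show False using q_eq q unfolding Q'_def by linarith
    next
      case 2
      then have "x * Q \<le> 0" "y * Q' \<le> 0" using QQ by (auto intro!: mult_nonpos_nonneg)
      then show False using q_eq q by linarith
    qed
  qed
  then have "(x * theta (Suc n)) * (y * theta (Suc (Suc n))) \<ge> 0"
    using theta_opposite[of "Suc n"]
    by (smt (verit, ccfv_SIG) mult.assoc mult.left_commute mult_nonpos_nonpos of_int_le_0_iff of_int_mult)
  then have "\<bar>q * \<alpha> - p\<bar> = \<bar>x * theta (Suc n)\<bar> + \<bar>y * theta (Suc (Suc n))\<bar>"
    unfolding eq by (smt (verit) zero_le_mult_iff mult_eq_0_iff)
  also have "\<dots> \<ge> \<bar>x * theta (Suc n)\<bar>" by simp
  also have "\<bar>x * theta (Suc n)\<bar> \<ge> 1 * \<bar>theta (Suc n)\<bar>"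
    unfolding abs_mult using x0 by (intro mult_right_mono) auto
  finally show ?thesis by simp
qed

text \<open>Compare with the last convergent \<open>P / Q\<close> whose denominator is at most
  \<open>q\<close>. By best approximation \<open>\<bar>p * Q - q * P\<bar>\<close> is at most
  \<open>2 * q * \<bar>q * \<alpha> - p\<bar> < 1\<close>; being an integer it vanishes, and
  coprimality identifies the two fractions.\<close>

lemma legendre:
  fixes p q :: int
  assumes cop: "coprime p q" and q: "0 < q" and small: "q * \<bar>q * \<alpha> - p\<bar> < 1 / 2"
  obtains n where "p = cnum a (Suc n)" "q = cden a (Suc n)"
proof -
  define S where "S = {n. cden a (Suc n) \<le> q}"
  have "S \<subseteq> {..nat q}" unfolding S_def using cden_ge by (smt (verit, best) atMost_iff mem_Collect_eq nat_le_iff nat_mono subsetI order_trans nat_int)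
  then have fin: "finite S" using finite_subset by blast
  have "0 \<in> S" using q by (simp add: S_def)
  \<comment> \<open>The denominators of the convergents 0 and 1 may both be 1. The largest index
    picks the later one, so that the next denominator exceeds \<open>q\<close>, as best
    approximation requires.\<close>
  define n where "n = Max S"
  have n: "cden a (Suc n) \<le> q" "q < cden a (Suc (Suc n))"
  proof -
    have "n \<in> S" unfolding n_def using fin \<open>0 \<in> S\<close> Max_in by blast
    then show "cden a (Suc n) \<le> q" by (simp add: S_def)
    have "Suc n \<notin> S" using fin Max_ge[of S "Suc n"] unfolding n_def[symmetric] by auto
    then show "q < cden a (Suc (Suc n))" by (simp add: S_def)
  qed
  define P Q where "P = cnum a (Suc n)" and "Q = cden a (Suc n)"
  have Q: "1 \<le> Q" unfolding Q_def using cden_pos by auto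
  have best: "\<bar>theta (Suc n)\<bar> \<le> \<bar>q * \<alpha> - p\<bar>" using abs_theta_le[OF q n(2)] .
  have "p * Q - q * P = 0"
  proof (rule ccontr)
    assume "p * Q - q * P \<noteq> 0"
    then have "1 \<le> \<bar>p * Q - q * P\<bar>" by linarith
    then have "1 \<le> \<bar>real_of_int (p * Q - q * P)\<bar>" by linarith
    also have "real_of_int (p * Q - q * P) = q * theta (Suc n) - Q * (q * \<alpha> - p)"
      by (simp add: theta_def P_def Q_def algebra_simps)
    also have "\<bar>\<dots>\<bar> \<le> q * \<bar>theta (Suc n)\<bar> + Q * \<bar>q * \<alpha> - p\<bar>"
      using q Q by (intro order_trans[OF abs_triangle_ineq4]) (simp add: abs_mult)
    also have "\<dots> \<le> q * \<bar>q * \<alpha> - p\<bar> + q * \<bar>q * \<alpha> - p\<bar>"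
      using best q n(1) unfolding Q_def by (intro add_mono mult_left_mono mult_right_mono) auto
    also have "\<dots> < 1" using small by simp
    finally show False by simp
  qed
  then have eq: "p * Q = q * P" by simp
  have cop': "coprime P Q" unfolding P_def Q_def by (rule coprime_cnum_cden)
  have "q dvd Q" using eq cop by (metis coprime_commute coprime_dvd_mult_right_iff dvd_triv_left)
  moreover have "Q dvd q" using eq cop' by (metis coprime_commute coprime_dvd_mult_left_iff dvd_triv_right)
  ultimately have "q = Q" using q Q zdvd_antisym_nonneg by auto
  then have "p = P" using eq q by (metis mult.commute mult_cancel_right less_irrefl)
  with \<open>q = Q\<close> show ?thesis using that unfolding P_def Q_def by blast
qed

section \<open>Convergents as reduced fractions\<close>

lemma cfrac_foldr: "cfrac xs = foldr (\<lambda>x t. 1 / (x + t)) xs 0"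
  by (induction xs) auto

text \<open>\<open>cfrac\<close> unfolds at the head of the list, whereas the recurrences of
  \<open>cnum\<close> and \<open>cden\<close> extend it at the end. The free remainder
  \<open>t\<close> reconciles them: the fraction is a Moebius transformation of \<open>t\<close>,
  and the induction step absorbs the new last entry into \<open>t\<close>.\<close>

lemma cfrac_conv_foldr:
  fixes t :: rat
  assumes "t \<ge> 0"
  shows "of_int (a 0) + foldr (\<lambda>x t. 1 / (x + t)) (map (\<lambda>k. of_int (a k)) [1..<n + 1]) t
    = (of_int (cnum a (Suc n)) + t * of_int (cnum a n)) / (of_int (cden a (Suc n)) + t * of_int (cden a n))"
  using assms
proof (induction n arbitrary: t)
  case (Suc n)
  let ?s = "1 / (of_int (a (Suc n)) + t)"
  have an: "(1 :: rat) \<le> of_int (a (Suc n))" using a_pos[of "Suc n"] by simp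
  have s: "of_int (a (Suc n)) + t > 0" using an Suc.prems by linarith
  have eq: "[1..<Suc n + 1] = [1..<n + 1] @ [Suc n]" by simp
  have "of_int (a 0) + foldr (\<lambda>x t. 1 / (x + t)) (map (\<lambda>k. of_int (a k)) [1..<Suc n + 1]) t
     = of_int (a 0) + foldr (\<lambda>x t. 1 / (x + t)) (map (\<lambda>k. of_int (a k)) [1..<n + 1]) ?s"
    unfolding eq map_append foldr_append by simp
  also have "\<dots> = (of_int (cnum a (Suc n)) + ?s * of_int (cnum a n)) / (of_int (cden a (Suc n)) + ?s * of_int (cden a n))"
    using s by (intro Suc.IH) simp
  also have "\<dots> = ((of_int (cnum a (Suc n)) + ?s * of_int (cnum a n)) * (of_int (a (Suc n)) + t)) / ((of_int (cden a (Suc n)) + ?s * of_int (cden a n)) * (of_int (a (Suc n)) + t))"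
    using s by simp
  also have "(of_int (cnum a (Suc n)) + ?s * of_int (cnum a n)) * (of_int (a (Suc n)) + t) = of_int (cnum a (Suc (Suc n))) + t * of_int (cnum a (Suc n))"
    using s by (simp add: distrib_right) (simp add: algebra_simps)
  also have "(of_int (cden a (Suc n)) + ?s * of_int (cden a n)) * (of_int (a (Suc n)) + t) = of_int (cden a (Suc (Suc n))) + t * of_int (cden a (Suc n))"
    using s by (simp add: distrib_right) (simp add: algebra_simps)
  finally show ?case .
qed simp

text \<open>\<open>quotient_of\<close> returns the reduced fraction with positive denominator, and
  the convergents already have this form. So \<open>min_mult\<close> at a convergent refers to the
  direction of \<open>cnum a (Suc n)\<close> and \<open>cden a (Suc n)\<close>.\<close>

lemma quotient_of_cfrac_conv: "quotient_of (cfrac_conv a n) = (cnum a (Suc n), cden a (Suc n))"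
proof -
  have "cfrac_conv a n = of_int (cnum a (Suc n)) / of_int (cden a (Suc n))"
    using cfrac_conv_foldr[of 0 n] unfolding cfrac_conv_def cfrac_foldr by simp
  then have "cfrac_conv a n = Fract (cnum a (Suc n)) (cden a (Suc n))" by (simp add: Fract_of_int_quotient)
  then show ?thesis using cden_pos[of n] coprime_cnum_cden[of a "Suc n"]
    by (simp add: quotient_of_Fract normalize_def)
qed

end

section \<open>The standard torus\<close>

lemma gaussian_ints_iff: "z \<in> gaussian_ints \<longleftrightarrow> Re z \<in> \<int> \<and> Im z \<in> \<int>"
  unfolding gaussian_ints_def by (auto elim!: Ints_cases simp: complex_eq_iff)

lemma gaussian_ints_closed_ops:
  "0 \<in> gaussian_ints"
  "z \<in> gaussian_ints \<Longrightarrow> - z \<in> gaussian_ints"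
  "z \<in> gaussian_ints \<Longrightarrow> w \<in> gaussian_ints \<Longrightarrow> z + w \<in> gaussian_ints"
  "z \<in> gaussian_ints \<Longrightarrow> w \<in> gaussian_ints \<Longrightarrow> z - w \<in> gaussian_ints"
  "z \<in> gaussian_ints \<Longrightarrow> of_nat n * z \<in> gaussian_ints"
  by (auto simp: gaussian_ints_iff)

lemma gaussian_ints_norm_ge_1:
  assumes "z \<in> gaussian_ints" "z \<noteq> 0"
  shows "norm z \<ge> 1"
proof -
  have "\<bar>x\<bar> \<ge> 1" if "x \<in> \<int>" "x \<noteq> 0" for x :: real using that by (auto elim!: Ints_cases)
  then have "\<bar>Re z\<bar> \<ge> 1 \<or> \<bar>Im z\<bar> \<ge> 1" using assms by (auto simp: gaussian_ints_iff complex_eq_iff)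
  then show ?thesis using abs_Re_le_cmod[of z] abs_Im_le_cmod[of z] by linarith
qed

lemma closed_gaussian_ints: "closed gaussian_ints"
proof (rule discrete_imp_closed[of 1])
  show "\<forall>x\<in>gaussian_ints. \<forall>y\<in>gaussian_ints. dist y x < 1 \<longrightarrow> y = x"
    using gaussian_ints_norm_ge_1 gaussian_ints_closed_ops(4) by (metis dist_norm linorder_not_le right_minus_eq)
qed simp

lemma torus_proj_eq_iff: "torus_proj z = torus_proj w \<longleftrightarrow> z - w \<in> gaussian_ints"
proof
  assume "torus_proj z = torus_proj w"
  then have "z \<in> torus_proj w" unfolding torus_proj_def using gaussian_ints_closed_ops(1) by force
  then show "z - w \<in> gaussian_ints" unfolding torus_proj_def by auto
next
  assume *: "z - w \<in> gaussian_ints"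
  show "torus_proj z = torus_proj w"
  proof (intro equalityI subsetI)
    fix x assume "x \<in> torus_proj z"
    then obtain l where l: "x = z + l" "l \<in> gaussian_ints" by (auto simp: torus_proj_def)
    have "x = w + ((z - w) + l)" "(z - w) + l \<in> gaussian_ints" using l * gaussian_ints_closed_ops(3) by auto
    then show "x \<in> torus_proj w" unfolding torus_proj_def by blast
  next
    fix x assume "x \<in> torus_proj w"
    then obtain l where l: "x = w + l" "l \<in> gaussian_ints" by (auto simp: torus_proj_def)
    have "x = z + (l - (z - w))" "l - (z - w) \<in> gaussian_ints" using l * gaussian_ints_closed_ops(4) by auto
    then show "x \<in> torus_proj z" unfolding torus_proj_def by blast
  qed
qed

lemma torus_proj_eq_0_iff: "torus_proj z = torus_proj 0 \<longleftrightarrow> z \<in> gaussian_ints"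
  by (simp add: torus_proj_eq_iff)

section \<open>Topology of the torus\<close>

abbreviation torus_top :: "complex set topology" where
  "torus_top \<equiv> surf standard_torus"

lemma openin_torus: "openin torus_top U \<longleftrightarrow> U \<subseteq> range torus_proj \<and> open (torus_proj -` U)"
proof -
  have "istopology (\<lambda>U. U \<subseteq> range torus_proj \<and> open (torus_proj -` U))"
    unfolding istopology_def by (auto simp: vimage_Union)
  then show ?thesis by (simp add: standard_torus_def topology_inverse')
qed

lemma topspace_torus: "topspace torus_top = range torus_proj"
proof
  show "topspace torus_top \<subseteq> range torus_proj" using openin_topspace[of torus_top] unfolding openin_torus by blast
  have "openin torus_top (range torus_proj)" unfolding openin_torus by (simp add: vimage_def)
  then show "range torus_proj \<subseteq> topspace torus_top" by (rule openin_subset)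
qed

lemma continuous_torus_proj: "continuous_map euclidean torus_top torus_proj"
  unfolding continuous_map_def topspace_torus
  by (auto simp: openin_torus vimage_def)

lemma continuous_torus_proj_comp:
  assumes "continuous_on S g"
  shows "continuous_map (top_of_set S) torus_top (\<lambda>z. torus_proj (g z))"
proof -
  have "continuous_map (top_of_set S) torus_top (torus_proj \<circ> g)"
    using assms by (intro continuous_map_compose[OF _ continuous_torus_proj]) auto
  then show ?thesis by (simp add: comp_def)
qed

lemma open_torus_proj: assumes "open W" shows "openin torus_top (torus_proj ` W)"
proof -
  have "torus_proj -` (torus_proj ` W) = (\<Union>l\<in>gaussian_ints. (+) l ` W)"
  proof (intro equalityI subsetI)
    fix x assume "x \<in> torus_proj -` (torus_proj ` W)"
    then obtain w where "w \<in> W" "x - w \<in> gaussian_ints" by (auto simp: torus_proj_eq_iff)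
    then show "x \<in> (\<Union>l\<in>gaussian_ints. (+) l ` W)" by (intro UN_I[of "x - w"] image_eqI[of _ _ w]) auto
  next
    fix x assume "x \<in> (\<Union>l\<in>gaussian_ints. (+) l ` W)"
    then obtain l w where "x = l + w" "l \<in> gaussian_ints" "w \<in> W" by auto
    then have "torus_proj x = torus_proj w" by (simp add: torus_proj_eq_iff)
    then show "x \<in> torus_proj -` (torus_proj ` W)" using \<open>w \<in> W\<close> by auto
  qed
  moreover have "open (\<Union>l\<in>gaussian_ints. (+) l ` W)" using assms by (intro open_UN ballI open_translation)
  ultimately show ?thesis unfolding openin_torus by auto
qed

lemma inj_on_torus_proj:
  assumes "\<And>x y. x \<in> W \<Longrightarrow> y \<in> W \<Longrightarrow> norm (x - y) < 1"
  shows "inj_on torus_proj W"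
  by (rule inj_onI) (metis assms torus_proj_eq_iff gaussian_ints_norm_ge_1 linorder_not_le right_minus_eq)

text \<open>Two points of the ball are less than 1 apart, and 1 is the least norm of a nonzero
  Gaussian integer. This is the origin of the radius \<open>1 / 2\<close> of all local inverses of
  \<open>torus_proj\<close> below.\<close>

lemma inj_on_torus_proj_ball: "inj_on torus_proj (ball z (1 / 2))"
proof (rule inj_on_torus_proj)
  fix x y assume "x \<in> ball z (1 / 2)" "y \<in> ball z (1 / 2)"
  then have "dist x y < 1" using dist_triangle_less_add[of x z "1/2" y "1/2"] by (simp add: dist_commute)
  then show "norm (x - y) < 1" by (simp add: dist_norm)
qed

lemma homeomorphic_map_torus_proj:
  assumes "open W" "inj_on torus_proj W"
  shows "homeomorphic_map (top_of_set W) (subtopology torus_top (torus_proj ` W)) torus_proj"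
proof (rule bijective_open_imp_homeomorphic_map)
  show "continuous_map (top_of_set W) (subtopology torus_top (torus_proj ` W)) torus_proj"
    using continuous_torus_proj by (auto simp: continuous_map_in_subtopology intro: continuous_map_from_subtopology)
  show "open_map (top_of_set W) (subtopology torus_top (torus_proj ` W)) torus_proj"
    unfolding open_map_def
  proof (intro allI impI)
    fix V assume V: "openin (top_of_set W) V"
    then have "open V" "V \<subseteq> W" using assms(1) by (auto simp: openin_open_eq)
    then show "openin (subtopology torus_top (torus_proj ` W)) (torus_proj ` V)"
      using open_torus_proj by (auto simp: openin_subtopology intro!: exI[of _ "torus_proj ` V"])
  qed
  show "torus_proj ` topspace (top_of_set W) = topspace (subtopology torus_top (torus_proj ` W))"
    by (auto simp: topspace_torus)
  show "inj_on torus_proj (topspace (top_of_set W))" using assms by simp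
qed

lemma homeomorphic_map_inv_torus_proj:
  assumes "open W" "inj_on torus_proj W"
  shows "homeomorphic_map (subtopology torus_top (torus_proj ` W)) (top_of_set W) (inv_into W torus_proj)"
proof -
  obtain g where g: "homeomorphic_maps (top_of_set W) (subtopology torus_top (torus_proj ` W)) torus_proj g"
    using homeomorphic_map_torus_proj[OF assms] homeomorphic_map_maps by blast
  then have "homeomorphic_map (subtopology torus_top (torus_proj ` W)) (top_of_set W) g"
    using homeomorphic_maps_map by blast
  moreover have "g y = inv_into W torus_proj y" if y: "y \<in> topspace (subtopology torus_top (torus_proj ` W))" for y
  proof -
    obtain w where "w \<in> W" "y = torus_proj w" using y by auto
    then show ?thesis using g assms(2) unfolding homeomorphic_maps_def by (auto simp: inv_into_f_f)
  qed
  ultimately show ?thesis using homeomorphic_map_eq by blast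
qed

lemma Hausdorff_torus: "Hausdorff_space torus_top"
  unfolding Hausdorff_space_def
proof (intro allI impI)
  fix X Y assume *: "X \<in> topspace torus_top \<and> Y \<in> topspace torus_top \<and> X \<noteq> Y"
  then obtain x y where xy: "X = torus_proj x" "Y = torus_proj y" by (auto simp: topspace_torus)
  then have "x - y \<in> - gaussian_ints" using * by (auto simp: torus_proj_eq_iff)
  then obtain e where e: "e > 0" "ball (x - y) e \<subseteq> - gaussian_ints"
    using closed_gaussian_ints by (metis open_Compl open_contains_ball)
  have "disjnt (torus_proj ` ball x (e / 2)) (torus_proj ` ball y (e / 2))"
  proof (rule ccontr)
    assume "\<not> ?thesis"
    then obtain a b where ab: "a \<in> ball x (e / 2)" "b \<in> ball y (e / 2)" "torus_proj a = torus_proj b"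
      by (auto simp: disjnt_def)
    have "norm ((x - y) - (a - b)) = norm ((x - a) - (y - b))" by (simp add: algebra_simps)
    also have "\<dots> \<le> norm (x - a) + norm (y - b)" by (rule norm_triangle_ineq4)
    also have "\<dots> < e" using ab by (simp add: dist_norm)
    finally have "a - b \<in> ball (x - y) e" by (simp add: dist_norm)
    then show False using e ab(3) by (auto simp: torus_proj_eq_iff)
  qed
  then show "\<exists>U V. openin torus_top U \<and> openin torus_top V \<and> X \<in> U \<and> Y \<in> V \<and> disjnt U V"
    using e xy by (intro exI[of _ "torus_proj ` ball x (e / 2)"] exI[of _ "torus_proj ` ball y (e / 2)"])
      (auto intro: open_torus_proj)
qed

lemma torus_proj_cbox: "torus_proj ` cbox 0 (Complex 1 1) = range torus_proj"
proof (intro equalityI subsetI)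
  fix X assume "X \<in> range torus_proj"
  then obtain z where z: "X = torus_proj z" by auto
  define w where "w = Complex (frac (Re z)) (frac (Im z))"
  have "w \<in> cbox 0 (Complex 1 1)" by (auto simp: w_def in_cbox_complex_iff less_imp_le[OF frac_lt_1])
  moreover have "torus_proj w = X" unfolding z torus_proj_eq_iff by (simp add: w_def gaussian_ints_iff frac_def)
  ultimately show "X \<in> torus_proj ` cbox 0 (Complex 1 1)" by blast
qed auto

lemma compact_torus: "compact_space torus_top"
proof -
  have "compactin torus_top (torus_proj ` cbox 0 (Complex 1 1))"
    by (rule image_compactin[OF _ continuous_torus_proj]) simp
  then show ?thesis by (simp add: torus_proj_cbox compact_space_def topspace_torus)
qed

lemma connected_torus: "connected_space torus_top"
proof -
  have "connectedin torus_top (torus_proj ` UNIV)"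
    by (rule connectedin_continuous_map_image[OF continuous_torus_proj]) (simp add: connected_UNIV)
  then show ?thesis by (simp add: connectedin_topspace[symmetric] topspace_torus)
qed

section \<open>Primitives and periods on the torus\<close>

lemma charts_torus: "charts standard_torus = {(torus_proj ` W, inv_into W torus_proj) | W. open W \<and> inj_on torus_proj W}"
  by (simp add: standard_torus_def)

text \<open>In the chart given by a local inverse of \<open>torus_proj\<close>, the function
  \<open>F\<close> reads as its lift to the plane and the form is 1; so the condition on all charts
  becomes one on the lift.\<close>

lemma primitive_on_torus_iff:
  "primitive_on standard_torus W F \<longleftrightarrow> openin torus_top W \<and>
     (\<forall>z. torus_proj z \<in> W \<longrightarrow> ((\<lambda>z. F (torus_proj z)) has_field_derivative 1) (at z))"
proof -
  have key: "((F \<circ> inv_into (torus_proj ` V) (inv_into V torus_proj)) has_field_derivative 1) (at z) \<longleftrightarrow>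
     ((\<lambda>z. F (torus_proj z)) has_field_derivative 1) (at z)"
    if "open V" "inj_on torus_proj V" "z \<in> V" for V z
  proof (rule DERIV_cong_ev)
    have "inv_into (torus_proj ` V) (inv_into V torus_proj) w = torus_proj w" if "w \<in> V" for w
    proof -
      have "inj_on (inv_into V torus_proj) (torus_proj ` V)" by (rule inj_on_inv_into) simp
      moreover have "w = inv_into V torus_proj (torus_proj w)" using that \<open>inj_on torus_proj V\<close> by simp
      ultimately show ?thesis using that by (metis imageI inv_into_f_f)
    qed
    then show "\<forall>\<^sub>F x in nhds z. (F \<circ> inv_into (torus_proj ` V) (inv_into V torus_proj)) x = F (torus_proj x)"
      using that by (auto simp: eventually_nhds intro!: exI[of _ V])
  qed auto
  show ?thesis
  proof
    assume L: "primitive_on standard_torus W F"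
    have "((\<lambda>z. F (torus_proj z)) has_field_derivative 1) (at z)" if "torus_proj z \<in> W" for z
    proof -
      let ?V = "ball z (1 / 2)"
      have "(torus_proj ` ?V, inv_into ?V torus_proj) \<in> charts standard_torus"
        using inj_on_torus_proj_ball unfolding charts_torus by blast
      moreover have "torus_proj z \<in> torus_proj ` ?V \<inter> W" using that by auto
      ultimately have "((F \<circ> inv_into (torus_proj ` ?V) (inv_into ?V torus_proj)) has_field_derivative
          form standard_torus (torus_proj ` ?V, inv_into ?V torus_proj) (inv_into ?V torus_proj (torus_proj z)))
          (at (inv_into ?V torus_proj (torus_proj z)))"
        using L unfolding primitive_on_def by blast
      then show ?thesis using key[of ?V z] inj_on_torus_proj_ball by (simp add: standard_torus_def)
    qed
    then show "openin torus_top W \<and> (\<forall>z. torus_proj z \<in> W \<longrightarrow> ((\<lambda>z. F (torus_proj z)) has_field_derivative 1) (at z))"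
      using L unfolding primitive_on_def by blast
  next
    assume R: "openin torus_top W \<and> (\<forall>z. torus_proj z \<in> W \<longrightarrow> ((\<lambda>z. F (torus_proj z)) has_field_derivative 1) (at z))"
    show "primitive_on standard_torus W F"
      unfolding primitive_on_def
    proof (intro conjI, use R in blast, safe)
      fix U \<phi> x assume "(U, \<phi>) \<in> charts standard_torus" and x: "x \<in> U" "x \<in> W"
      then obtain V where V: "open V" "inj_on torus_proj V" "U = torus_proj ` V" "\<phi> = inv_into V torus_proj"
        by (auto simp: charts_torus)
      obtain z where z: "z \<in> V" "x = torus_proj z" using V x by auto
      show "(F \<circ> inv_into U \<phi> has_field_derivative form standard_torus (U, \<phi>) (\<phi> x)) (at (\<phi> x))"
        using key[OF V(1,2) z(1)] R x(2) z V by (simp add: standard_torus_def)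
    qed
  qed
qed

text \<open>Any lift \<open>z\<close> of a point of the set differs from a point of \<open>W\<close>
  by a lattice vector \<open>l\<close>, and near \<open>z\<close> the local inverse is
  \<open>x \<mapsto> x - l\<close>.\<close>

lemma primitive_on_inv_torus_proj:
  assumes "open W" "inj_on torus_proj W"
  shows "primitive_on standard_torus (torus_proj ` W) (inv_into W torus_proj)"
  unfolding primitive_on_torus_iff
proof (intro conjI allI impI open_torus_proj assms)
  fix z assume "torus_proj z \<in> torus_proj ` W"
  then obtain w where w: "w \<in> W" "torus_proj z = torus_proj w" by auto
  define l where "l = z - w"
  have l: "l \<in> gaussian_ints" using w by (simp add: l_def torus_proj_eq_iff)
  have "((\<lambda>x. x - l) has_field_derivative 1) (at z)" by (auto intro!: derivative_eq_intros)
  moreover have "\<forall>\<^sub>F x in nhds z. inv_into W torus_proj (torus_proj x) = x - l"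
    unfolding eventually_nhds
  proof (intro exI conjI ballI)
    show "open ((+) l ` W)" using assms by (intro open_translation)
    show "z \<in> (+) l ` W" using w by (intro image_eqI[of _ _ w]) (auto simp: l_def)
    fix x assume "x \<in> (+) l ` W"
    then have "x - l \<in> W" "torus_proj x = torus_proj (x - l)" using l by (auto simp: torus_proj_eq_iff)
    then show "inv_into W torus_proj (torus_proj x) = x - l" using assms(2) by simp
  qed
  ultimately show "((\<lambda>z. inv_into W torus_proj (torus_proj z)) has_field_derivative 1) (at z)"
    by (subst DERIV_cong_ev[OF refl _ refl]) auto
qed

lemma singularities_torus: "singularities standard_torus = {torus_proj 0}"
  by (auto simp: singularities_def zeros_def standard_torus_def)

text \<open>The times at which \<open>\<gamma> t\<close> is the projection of \<open>t * v\<close>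
  form a clopen subset of the unit interval: closed because the torus is Hausdorff, open because a
  primitive lifts to the identity up to a constant. Hence \<open>\<gamma> 1\<close>, the marked
  point, is the projection of \<open>v\<close>.\<close>

lemma Hol_torus_subset: "Hol standard_torus \<subseteq> gaussian_ints - {0}"
proof
  fix v assume "v \<in> Hol standard_torus"
  then obtain \<gamma> where "saddle_connection standard_torus \<gamma> v" by (auto simp: Hol_def)
  then have v0: "v \<noteq> 0" and path: "pathin torus_top \<gamma>" and g01: "\<gamma> 0 = torus_proj 0" "\<gamma> 1 = torus_proj 0"
    and int: "integral_along standard_torus \<gamma> (\<lambda>t. complex_of_real t * v)"
    by (auto simp: saddle_connection_def singularities_torus)
  let ?I = "top_of_set {0..1::real}"
  let ?S = "{t \<in> topspace ?I. \<gamma> t = torus_proj (of_real t * v)}"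
  have cont: "continuous_map ?I torus_top \<gamma>" using path by (simp add: pathin_def)
  have "closedin ?I ?S"
    by (rule closedin_continuous_maps_eq[OF Hausdorff_torus cont])
      (intro continuous_torus_proj_comp continuous_intros)
  moreover have "openin ?I ?S"
  proof (subst openin_subopen, intro ballI)
    fix t0 assume t0: "t0 \<in> ?S"
    let ?z0 = "of_real t0 * v"
    obtain W F e where W: "primitive_on standard_torus W F" and e: "e > 0"
      and F: "\<And>s. s \<in> {0..1} \<Longrightarrow> \<bar>s - t0\<bar> < e \<Longrightarrow> \<gamma> s \<in> W \<and> F (\<gamma> s) - F (\<gamma> t0) = of_real s * v - of_real t0 * v"
      using int t0 unfolding integral_along_def by (metis (no_types, lifting) mem_Collect_eq topspace_euclidean_subtopology)
    have der: "\<And>z. torus_proj z \<in> W \<Longrightarrow> ((\<lambda>z. F (torus_proj z)) has_field_derivative 1) (at z)"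
      and Wo: "openin torus_top W" using W by (auto simp: primitive_on_torus_iff)
    have "torus_proj ?z0 \<in> W" using F[of t0] t0 e by auto
    then obtain r where r: "r > 0" "ball ?z0 r \<subseteq> torus_proj -` W"
      using Wo unfolding openin_torus by (metis open_contains_ball vimageI)
    have Fz: "F (torus_proj z) - F (torus_proj ?z0) = z - ?z0" if "z \<in> ball ?z0 r" for z
    proof -
      have "((\<lambda>z. F (torus_proj z) - z) has_field_derivative 0) (at x within ball ?z0 r)" if "x \<in> ball ?z0 r" for x
      proof -
        have "((\<lambda>z. F (torus_proj z)) has_field_derivative 1) (at x)" using der r that by auto
        then have "((\<lambda>z. F (torus_proj z) - z) has_field_derivative 1 - 1) (at x)" by (intro derivative_intros)
        then show ?thesis by (simp add: has_field_derivative_at_within)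
      qed
      then obtain c where "\<And>x. x \<in> ball ?z0 r \<Longrightarrow> F (torus_proj x) - x = c"
        using has_field_derivative_zero_constant[of "ball ?z0 r" "\<lambda>z. F (torus_proj z) - z"] by auto
      then have "F (torus_proj z) - z = F (torus_proj ?z0) - ?z0" using that r(1) by simp
      then show ?thesis by (simp add: algebra_simps)
    qed
    let ?T = "{t \<in> topspace ?I. \<gamma> t \<in> torus_proj ` ball ?z0 r} \<inter> ({0..1} \<inter> ball t0 e)"
    have "openin ?I ?T"
      using openin_continuous_map_preimage[OF cont open_torus_proj[OF open_ball]]
      by (intro openin_Int openin_open_Int) auto
    moreover have "t0 \<in> ?T" using t0 r e by auto
    moreover have "?T \<subseteq> ?S"
    proof
      fix s assume s: "s \<in> ?T"
      then obtain z where z: "z \<in> ball ?z0 r" "\<gamma> s = torus_proj z" by auto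
      have "F (\<gamma> s) - F (\<gamma> t0) = of_real s * v - ?z0" using F[of s] s by (auto simp: dist_real_def abs_minus_commute)
      then have "z = of_real s * v" using Fz[OF z(1)] z(2) t0 by simp
      then show "s \<in> ?S" using s z by auto
    qed
    ultimately show "\<exists>T. openin ?I T \<and> t0 \<in> T \<and> T \<subseteq> ?S" by blast
  qed
  moreover have "connected_space ?I" by (simp add: connected_space_subconnected[symmetric])
  ultimately have "?S = {} \<or> ?S = topspace ?I" by (meson connected_space_clopen_in)
  moreover have "0 \<in> ?S" using g01 by simp
  moreover have "(1 :: real) \<in> topspace ?I" by simp
  ultimately have "1 \<in> ?S" by blast
  then have "\<gamma> 1 = torus_proj (of_real 1 * v)" by blast
  then have "torus_proj v = torus_proj 0" using g01 by simp
  then show "v \<in> gaussian_ints - {0}" using v0 by (simp add: torus_proj_eq_0_iff)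
qed

text \<open>Away from the marked point the torus is a single sheet over itself. This makes it an
  instance of the general results on covers, from which its area is obtained.\<close>

lemma translation_cover_torus_id: "translation_cover standard_torus standard_torus {torus_proj 0} (\<lambda>x. x)"
proof -
  let ?V = "topspace torus_top - {torus_proj 0}"
  have V: "openin torus_top ?V"
    using Hausdorff_torus by (intro openin_diff closedin_Hausdorff_singleton openin_topspace) (auto simp: topspace_torus)
  have "homeomorphic_map (subtopology torus_top ?V) (subtopology torus_top ?V) (\<lambda>x. x)"
    using homeomorphic_map_id by (metis id_apply homeomorphic_map_eq)
  then have "\<exists>V \<U>. openin torus_top V \<and> y \<in> V \<and> V \<inter> {torus_proj 0} = {} \<and>
        \<Union> \<U> = {x \<in> topspace torus_top. x \<in> V} \<and> pairwise disjnt \<U> \<and>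
        (\<forall>U \<in> \<U>. openin torus_top U \<and> homeomorphic_map (subtopology torus_top U) (subtopology torus_top V) (\<lambda>x. x))"
    if "y \<in> ?V" for y
    using that V by (intro exI[of _ ?V] exI[of _ "{?V}"]) auto
  moreover have "primitive_on standard_torus {x \<in> topspace torus_top. x \<in> V} (F \<circ> (\<lambda>x. x))"
    if "primitive_on standard_torus V F" for V F
  proof -
    have "V \<subseteq> topspace torus_top" using that openin_subset unfolding primitive_on_def by blast
    then have "{x \<in> topspace torus_top. x \<in> V} = V" by auto
    then show ?thesis using that by (simp add: comp_def)
  qed
  ultimately show ?thesis unfolding translation_cover_def by auto
qed

section \<open>Lifting through a branched cover\<close>

text \<open>Over \<open>Z\<close> the map \<open>p\<close> is only known to be continuous, so every
  lifting statement concerns maps that avoid \<open>Z\<close>.\<close>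

locale branched_cover =
  fixes E :: "'a topology" and B :: "'b topology" and p :: "'a \<Rightarrow> 'b" and Z :: "'b set"
  assumes Hausdorff: "Hausdorff_space E"
    and continuous: "continuous_map E B p"
    and evenly_covered: "\<And>y. y \<in> topspace B - Z \<Longrightarrow> \<exists>V \<U>. openin B V \<and> y \<in> V \<and> V \<inter> Z = {} \<and>
        \<Union> \<U> = {x \<in> topspace E. p x \<in> V} \<and> pairwise disjnt \<U> \<and>
        (\<forall>U \<in> \<U>. openin E U \<and> homeomorphic_map (subtopology E U) (subtopology B V) p)"
begin

definition is_lift :: "(complex \<Rightarrow> 'b) \<Rightarrow> complex set \<Rightarrow> (complex \<Rightarrow> 'a) \<Rightarrow> bool" where
  "is_lift g K s \<longleftrightarrow> continuous_map (top_of_set K) E s \<and> (\<forall>z\<in>K. p (s z) = g z)"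

text \<open>The lift may be prescribed at any point of \<open>K\<close>, not just at a base point;
  this allows lifts over two pieces to be matched wherever the pieces meet.\<close>

definition liftable :: "(complex \<Rightarrow> 'b) \<Rightarrow> complex set \<Rightarrow> bool" where
  "liftable g K \<longleftrightarrow> (\<forall>z\<in>K. \<forall>x\<in>topspace E. p x = g z \<longrightarrow> (\<exists>s. is_lift g K s \<and> s z = x))"

lemma is_lift_subset: "is_lift g K s \<Longrightarrow> L \<subseteq> K \<Longrightarrow> is_lift g L s"
  unfolding is_lift_def using continuous_map_from_subtopology_mono by blast

lemma is_lift_in: "is_lift g K s \<Longrightarrow> z \<in> K \<Longrightarrow> s z \<in> topspace E"
  unfolding is_lift_def continuous_map_def by auto

lemma local_sheet:
  assumes "x \<in> topspace E" "p x \<notin> Z"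
  obtains V U h where "openin B V" "p x \<in> V" "V \<inter> Z = {}" "openin E U" "x \<in> U"
    "homeomorphic_maps (subtopology E U) (subtopology B V) p h" "inj_on p U"
proof -
  have "p x \<in> topspace B - Z" using assms continuous by (auto simp: continuous_map_def)
  from evenly_covered[OF this] obtain V \<U> where V: "openin B V" "p x \<in> V" "V \<inter> Z = {}" "\<Union> \<U> = {x \<in> topspace E. p x \<in> V}"
    "\<And>U. U \<in> \<U> \<Longrightarrow> openin E U \<and> homeomorphic_map (subtopology E U) (subtopology B V) p"
    by (elim exE conjE) (rule that, auto)
  have "x \<in> \<Union> \<U>" unfolding V(4) using assms V(2) by blast
  then obtain U where U: "U \<in> \<U>" "x \<in> U" by blast
  then obtain h where h: "homeomorphic_maps (subtopology E U) (subtopology B V) p h"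
    using V(5) homeomorphic_map_maps by blast
  have "U \<subseteq> topspace E" using V(5) U openin_subset by blast
  then have "inj_on p U" using homeomorphic_imp_injective_map V(5)[OF U(1)] by (metis inf.absorb_iff2 topspace_subtopology)
  then show ?thesis using that V U h by blast
qed

text \<open>The coincidence set is closed because \<open>E\<close> is Hausdorff and open because
  \<open>p\<close> is injective on each sheet.\<close>

lemma lift_unique:
  assumes K: "connected K" and s: "is_lift g K s" and t: "is_lift g K t"
    and g: "\<And>z. z \<in> K \<Longrightarrow> g z \<notin> Z" and z: "z \<in> K" "s z = t z" and w: "w \<in> K"
  shows "s w = t w"
proof -
  let ?X = "top_of_set K"
  let ?S = "{z \<in> topspace ?X. s z = t z}"
  have cs: "continuous_map ?X E s" and ct: "continuous_map ?X E t" using s t by (auto simp: is_lift_def)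
  have "closedin ?X ?S" by (rule closedin_continuous_maps_eq[OF Hausdorff cs ct])
  moreover have "openin ?X ?S"
  proof (subst openin_subopen, intro ballI)
    fix u assume u: "u \<in> ?S"
    have "s u \<in> topspace E" "p (s u) \<notin> Z" using s u g is_lift_in[OF s] by (force simp: is_lift_def)+
    then obtain U where U: "openin E U" "s u \<in> U" "inj_on p U" by (rule local_sheet)
    let ?T = "{z \<in> topspace ?X. s z \<in> U} \<inter> {z \<in> topspace ?X. t z \<in> U}"
    have "openin ?X ?T" using openin_continuous_map_preimage[OF cs U(1)] openin_continuous_map_preimage[OF ct U(1)] by auto
    moreover have "u \<in> ?T" using u U by auto
    moreover have "?T \<subseteq> ?S" using s t U(3) by (auto simp: is_lift_def inj_on_def)
    ultimately show "\<exists>T. openin ?X T \<and> u \<in> T \<and> T \<subseteq> ?S" by blast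
  qed
  moreover have "connected_space ?X" using K connectedin_def by (metis connectedin_iff_connected)
  ultimately have "?S = {} \<or> ?S = topspace ?X" by (meson connected_space_clopen_in)
  then show ?thesis using z w by auto
qed

text \<open>Over one evenly covered set a lift is \<open>h \<circ> g\<close>, with \<open>h\<close>
  the inverse of a single sheet; hence \<open>K\<close> may be any subset of the small ball,
  connected or not.\<close>

lemma liftable_local:
  assumes g: "continuous_map (top_of_set D) B g" "\<And>z. z \<in> D \<Longrightarrow> g z \<notin> Z" and z0: "z0 \<in> D"
  obtains e where "e > 0" "\<And>K. K \<subseteq> D \<inter> ball z0 e \<Longrightarrow> liftable g K"
proof -
  have "g z0 \<in> topspace B - Z" using g z0 by (auto simp: continuous_map_def)
  from evenly_covered[OF this] obtain V \<U> where V: "openin B V" "g z0 \<in> V" "V \<inter> Z = {}" "\<Union> \<U> = {x \<in> topspace E. p x \<in> V}"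
    "\<And>U. U \<in> \<U> \<Longrightarrow> openin E U \<and> homeomorphic_map (subtopology E U) (subtopology B V) p"
    by (elim exE conjE) (rule that, auto)
  have "openin (top_of_set D) {z \<in> topspace (top_of_set D). g z \<in> V}"
    using openin_continuous_map_preimage[OF g(1) V(1)] .
  then obtain e where e: "e > 0" "ball z0 e \<inter> D \<subseteq> {z \<in> topspace (top_of_set D). g z \<in> V}"
    using z0 V(2) unfolding openin_contains_ball by auto
  have "liftable g K" if K: "K \<subseteq> D \<inter> ball z0 e" for K
    unfolding liftable_def
  proof (intro ballI impI)
    fix z x assume z: "z \<in> K" "x \<in> topspace E" "p x = g z"
    have KV: "\<And>w. w \<in> K \<Longrightarrow> g w \<in> V" using K e by auto
    have "x \<in> \<Union> \<U>" unfolding V(4) using z KV[OF z(1)] by simp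
    then obtain U where U: "U \<in> \<U>" "x \<in> U" by blast
    obtain h where h: "homeomorphic_maps (subtopology E U) (subtopology B V) p h"
      using V(5) U homeomorphic_map_maps by blast
    have "continuous_map (top_of_set K) (subtopology B V) g"
      using KV K g(1)
      by (auto simp: continuous_map_in_subtopology intro: continuous_map_from_subtopology_mono)
    moreover have "continuous_map (subtopology B V) E h"
      using h by (auto simp: homeomorphic_maps_def continuous_map_in_subtopology)
    ultimately have "continuous_map (top_of_set K) E (h \<circ> g)" by (rule continuous_map_compose)
    moreover have "p (h (g w)) = g w" if "w \<in> K" for w
      using h KV[OF that] openin_subset[OF V(1)] by (auto simp: homeomorphic_maps_def)
    moreover have "h (g z) = x" using h U z by (auto simp: homeomorphic_maps_def simp flip: z(3))
    ultimately show "\<exists>s. is_lift g K s \<and> s z = x" unfolding is_lift_def by (intro exI[of _ "h \<circ> g"]) auto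
  qed
  then show ?thesis using that e by blast
qed

text \<open>The second lift is chosen to match the first at one common point; connectedness of the
  overlap spreads the agreement, and closedness of the pieces permits pasting.\<close>

lemma liftable_Un:
  assumes "liftable g K" "liftable g L" "closed K" "closed L" "connected (K \<inter> L)" "K \<inter> L \<noteq> {}"
    and g: "\<And>z. z \<in> K \<union> L \<Longrightarrow> g z \<notin> Z"
  shows "liftable g (K \<union> L)"
proof -
  have main: "\<exists>s. is_lift g (K \<union> L) s \<and> s z = x"
    if KL: "liftable g K" "liftable g L" "closed K" "closed L" "connected (K \<inter> L)" "K \<inter> L \<noteq> {}"
      and g: "\<And>z. z \<in> K \<union> L \<Longrightarrow> g z \<notin> Z" and z: "z \<in> K" "x \<in> topspace E" "p x = g z" for z x K L
  proof -
    obtain s where s: "is_lift g K s" "s z = x" using KL z unfolding liftable_def by blast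
    obtain w where w: "w \<in> K" "w \<in> L" using KL by auto
    obtain t where t: "is_lift g L t" "t w = s w"
      using KL(2) w s is_lift_in[OF s(1) w(1)] unfolding liftable_def is_lift_def by blast
    have eq: "s u = t u" if "u \<in> K" "u \<in> L" for u
      using lift_unique[OF KL(5), of g s t w u] is_lift_subset[OF s(1)] is_lift_subset[OF t(1)] w t(2) that g by auto
    let ?X = "top_of_set (K \<union> L)"
    obtain r where r: "continuous_map ?X E r"
      "\<And>x i. i \<in> {True, False} \<Longrightarrow> x \<in> topspace ?X \<inter> (if i then K else L) \<Longrightarrow> r x = (if i then s else t) x"
    proof (rule pasting_lemma_exists_closed[where I = "{True, False}" and X = ?X and T = "\<lambda>i. if i then K else L" and Y = E and f = "\<lambda>i. if i then s else t"])
      fix i :: bool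
      show "closedin ?X (if i then K else L)" using KL by (auto intro: closed_subset)
      have "subtopology ?X K = top_of_set K" "subtopology ?X L = top_of_set L"
        by (auto simp: subtopology_subtopology intro: arg_cong[of _ _ top_of_set])
      then show "continuous_map (subtopology ?X (if i then K else L)) E (if i then s else t)"
        using s t by (auto simp: is_lift_def)
    qed (use eq in auto)
    have "r u = s u" if "u \<in> K" for u using r(2)[of True] that by auto
    moreover have "r u = t u" if "u \<in> L" for u using r(2)[of False] that by auto
    ultimately have "is_lift g (K \<union> L) r \<and> r z = x" using r(1) s t z by (auto simp: is_lift_def)
    then show ?thesis by blast
  qed
  show ?thesis unfolding liftable_def
  proof (intro ballI impI)
    fix z x assume *: "z \<in> K \<union> L" "x \<in> topspace E" "p x = g z"
    show "\<exists>s. is_lift g (K \<union> L) s \<and> s z = x"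
    proof (cases "z \<in> K")
      case True then show ?thesis using main[of K L z x] assms * by auto
    next
      case False then show ?thesis using main[of L K z x] assms * by (auto simp: Un_commute Int_commute)
    qed
  qed
qed

text \<open>Bisection of the rectangle, first of thin strips and then of the rectangle into strips.\<close>

lemma liftable_rectangle:
  assumes AB: "A \<le> A'" "C \<le> C'"
    and g: "continuous_map (top_of_set (cbox (Complex A C) (Complex A' C'))) B g"
      "\<And>z. z \<in> cbox (Complex A C) (Complex A' C') \<Longrightarrow> g z \<notin> Z"
  shows "liftable g (cbox (Complex A C) (Complex A' C'))"
proof -
  let ?R = "\<lambda>a b c d. cbox (Complex a c) (Complex b d)"
  have un1: "liftable g (?R a a' c c')" if "liftable g (?R a b c c')" "liftable g (?R b a' c c')"
    "A \<le> a" "a \<le> b" "b \<le> a'" "a' \<le> A'" "C \<le> c" "c \<le> c'" "c' \<le> C'" for a b a' c c'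
  proof -
    have "?R a a' c c' = ?R a b c c' \<union> ?R b a' c c'" using that by (auto simp: in_cbox_complex_iff)
    moreover have "?R a b c c' \<inter> ?R b a' c c' = ?R b b c c'" using that by (auto simp: in_cbox_complex_iff)
    moreover have "connected (?R b b c c')" by (intro convex_connected convex_box)
    moreover have "Complex b c \<in> ?R b b c c'" using that by (auto simp: in_cbox_complex_iff)
    moreover have "g z \<notin> Z" if "z \<in> ?R a a' c c'" for z
      using that \<open>A \<le> a\<close> \<open>a' \<le> A'\<close> \<open>C \<le> c\<close> \<open>c' \<le> C'\<close> by (intro g(2)) (auto simp: in_cbox_complex_iff)
    ultimately show ?thesis using that(1,2) liftable_Un[of g "?R a b c c'" "?R b a' c c'"] by (metis closed_cbox empty_iff)
  qed
  have un2: "liftable g (?R a a' c c')" if "liftable g (?R a a' c b)" "liftable g (?R a a' b c')"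
    "C \<le> c" "c \<le> b" "b \<le> c'" "c' \<le> C'" "A \<le> a" "a \<le> a'" "a' \<le> A'" for a b a' c c'
  proof -
    have "?R a a' c c' = ?R a a' c b \<union> ?R a a' b c'" using that by (auto simp: in_cbox_complex_iff)
    moreover have "?R a a' c b \<inter> ?R a a' b c' = ?R a a' b b" using that by (auto simp: in_cbox_complex_iff)
    moreover have "connected (?R a a' b b)" by (intro convex_connected convex_box)
    moreover have "Complex a b \<in> ?R a a' b b" using that by (auto simp: in_cbox_complex_iff)
    moreover have "g z \<notin> Z" if "z \<in> ?R a a' c c'" for z
      using that \<open>A \<le> a\<close> \<open>a' \<le> A'\<close> \<open>C \<le> c\<close> \<open>c' \<le> C'\<close> by (intro g(2)) (auto simp: in_cbox_complex_iff)
    ultimately show ?thesis using that(1,2) liftable_Un[of g "?R a a' c b" "?R a a' b c'"] by (metis closed_cbox empty_iff)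
  qed
  \<comment> \<open>The thickness \<open>d\<close> may depend on the height \<open>y\<close> but
    must serve the full width; gluing two horizontal pieces takes the smaller of their
    thicknesses.\<close>
  have strip: "\<exists>d>0. \<forall>c c'. C \<le> c \<and> c \<le> y \<and> y \<le> c' \<and> c' \<le> C' \<and> c' - c < d \<longrightarrow> liftable g (?R A A' c c')"
    if y: "C \<le> y" "y \<le> C'" for y
  proof -
    let ?P = "\<lambda>a b. A \<le> a \<and> a \<le> b \<and> b \<le> A' \<longrightarrow>
      (\<exists>d>0. \<forall>c c'. C \<le> c \<and> c \<le> y \<and> y \<le> c' \<and> c' \<le> C' \<and> c' - c < d \<longrightarrow> liftable g (?R a b c c'))"
    have "?P A A'"
    proof (rule Bolzano[where P = ?P, OF AB(1)])
      fix a b c assume *: "?P a b" "?P b c" "a \<le> b" "b \<le> c"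
      show "?P a c"
      proof
        assume ac: "A \<le> a \<and> a \<le> c \<and> c \<le> A'"
        obtain d where d: "d > 0" "\<And>x x'. C \<le> x \<and> x \<le> y \<and> y \<le> x' \<and> x' \<le> C' \<and> x' - x < d \<Longrightarrow> liftable g (?R a b x x')"
          using * ac by (meson order_trans)
        obtain d' where d': "d' > 0" "\<And>x x'. C \<le> x \<and> x \<le> y \<and> y \<le> x' \<and> x' \<le> C' \<and> x' - x < d' \<Longrightarrow> liftable g (?R b c x x')"
          using * ac by (meson order_trans)
        have "liftable g (?R a c x x')" if "C \<le> x \<and> x \<le> y \<and> y \<le> x' \<and> x' \<le> C' \<and> x' - x < min d d'" for x x'
          using un1[of a x b x' c] d(2)[of x x'] d'(2)[of x x'] that * ac by simp
        then show "\<exists>d>0. \<forall>x x'. C \<le> x \<and> x \<le> y \<and> y \<le> x' \<and> x' \<le> C' \<and> x' - x < d \<longrightarrow> liftable g (?R a c x x')"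
          using d(1) d'(1) by (intro exI[of _ "min d d'"]) auto
      qed
    next
      fix x assume x: "A \<le> x" "x \<le> A'"
      have "Complex x y \<in> ?R A A' C C'" using x y by (auto simp: in_cbox_complex_iff)
      then obtain e where e: "e > 0" "\<And>K. K \<subseteq> ?R A A' C C' \<inter> ball (Complex x y) e \<Longrightarrow> liftable g K"
        using liftable_local[OF g] by blast
      have "liftable g (?R a b c c')" if "a \<le> x \<and> x \<le> b \<and> b - a < e / 2" "A \<le> a" "b \<le> A'"
        "C \<le> c \<and> c \<le> y \<and> y \<le> c' \<and> c' \<le> C' \<and> c' - c < e / 2" for a b c c'
      proof (rule e(2), rule subsetI)
        fix z assume z: "z \<in> ?R a b c c'"
        then have "\<bar>Re (Complex x y - z)\<bar> < e / 2" "\<bar>Im (Complex x y - z)\<bar> < e / 2"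
          using that by (simp_all add: in_cbox_complex_iff abs_real_def)
        then have "norm (Complex x y - z) < e" using cmod_le[of "Complex x y - z"] by linarith
        then show "z \<in> ?R A A' C C' \<inter> ball (Complex x y) e" using z that by (auto simp: in_cbox_complex_iff dist_norm)
      qed
      then show "\<exists>d>0. \<forall>a b. a \<le> x \<and> x \<le> b \<and> b - a < d \<longrightarrow> ?P a b"
        using e(1) by (intro exI[of _ "e / 2"]) (auto intro!: exI[of _ "e / 2"])
    qed
    then show ?thesis using AB by blast
  qed
  let ?P = "\<lambda>c c'. C \<le> c \<and> c \<le> c' \<and> c' \<le> C' \<longrightarrow> liftable g (?R A A' c c')"
  have "?P C C'"
  proof (rule Bolzano[where P = ?P, OF AB(2)])
    fix a b c assume *: "?P a b" "?P b c" "a \<le> b" "b \<le> c"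
    then show "?P a c" using un2[of A a A' b c] AB by auto
  next
    fix y assume "C \<le> y" "y \<le> C'"
    then show "\<exists>d>0. \<forall>a b. a \<le> y \<and> y \<le> b \<and> b - a < d \<longrightarrow> ?P a b" using strip[of y] by meson
  qed
  then show ?thesis using AB by blast
qed

abbreviation unit_square :: "complex set" where
  "unit_square \<equiv> box 0 (Complex 1 1)"

text \<open>The closed squares \<open>?K d\<close> exhaust the open one. Their lifts with value
  \<open>x\<close> at \<open>z\<close> agree by uniqueness, and the open boxes \<open>?B d\<close>
  inside them allow pasting infinitely many.\<close>

lemma liftable_unit_square:
  assumes g: "continuous_map (top_of_set unit_square) B g" "\<And>z. z \<in> unit_square \<Longrightarrow> g z \<notin> Z"
  shows "liftable g unit_square"
  unfolding liftable_def
proof (intro ballI impI)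
  fix z x assume z: "z \<in> unit_square" "x \<in> topspace E" "p x = g z"
  \<comment> \<open>Half the distance from \<open>w\<close> to the sides of the square, so that
    \<open>w\<close> lies in the open box \<open>?B d\<close> for every
    \<open>d \<le> m w\<close>.\<close>
  define m where "m w = min (min (Re w) (1 - Re w)) (min (Im w) (1 - Im w)) / 2" for w
  let ?K = "\<lambda>d. cbox (Complex d d) (Complex (1 - d) (1 - d))"
  let ?B = "\<lambda>d. box (Complex d d) (Complex (1 - d) (1 - d))"
  have m_pos: "m w > 0" if "w \<in> unit_square" for w using that by (auto simp: m_def in_box_complex_iff)
  have m_in: "w \<in> ?B d" if "d \<le> m w" "w \<in> unit_square" for w d
    using that by (auto simp: m_def in_box_complex_iff min_def split: if_splits)
  have sub: "?B d \<subseteq> ?K d" for d by (rule box_subset_cbox)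
  have m_lt: "d < 1 / 2" if "d \<le> m z" for d using that z(1) by (auto simp: m_def in_box_complex_iff min_def split: if_splits)
  \<comment> \<open>The bound \<open>m z\<close> keeps the base point \<open>z\<close> in every
    \<open>?K d\<close>.\<close>
  let ?I = "{d. 0 < d \<and> d \<le> m z}"
  have Ksub: "?K d \<subseteq> unit_square" if "0 < d" for d using that by (auto simp: in_box_complex_iff in_cbox_complex_iff)
  have "\<exists>s. is_lift g (?K d) s \<and> s z = x" if "d \<in> ?I" for d
  proof -
    have "liftable g (?K d)"
    proof (rule liftable_rectangle)
      show "continuous_map (top_of_set (?K d)) B g" using g(1) Ksub[of d] that
        by (auto intro: continuous_map_from_subtopology_mono)
      show "\<And>z. z \<in> ?K d \<Longrightarrow> g z \<notin> Z" using Ksub[of d] that g(2) by auto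
    qed (use m_lt[of d] that in auto)
    moreover have "z \<in> ?K d" using m_in[of d z] that z sub by auto
    ultimately show ?thesis using z unfolding liftable_def by blast
  qed
  note ex = this
  define S where "S d = (SOME s. is_lift g (?K d) s \<and> s z = x)" for d
  have S: "is_lift g (?K d) (S d)" "S d z = x" if "d \<in> ?I" for d
    using someI_ex[OF ex[OF that]] unfolding S_def by blast+
  have mono: "S d w = S d' w" if "d \<in> ?I" "d' \<in> ?I" "d' \<le> d" "w \<in> ?K d" for d d' w
  proof (rule lift_unique[of "?K d" g])
    have "?K d \<subseteq> ?K d'" using that by (auto simp: in_cbox_complex_iff)
    then show "is_lift g (?K d) (S d')" using S(1)[OF that(2)] is_lift_subset by blast
    show "connected (?K d)" by (intro convex_connected convex_box)
    show "z \<in> ?K d" using m_in[of d z] that z sub by auto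
    show "\<And>z. z \<in> ?K d \<Longrightarrow> g z \<notin> Z" using Ksub[of d] that g(2) by auto
  qed (use S that in auto)
  let ?X = "top_of_set unit_square"
  obtain r where r: "continuous_map ?X E r" "\<And>w d. d \<in> ?I \<Longrightarrow> w \<in> topspace ?X \<inter> ?B d \<Longrightarrow> r w = S d w"
  proof (rule pasting_lemma_exists[where X = ?X and I = ?I and T = ?B and Y = E and f = S])
    have "\<exists>d\<in>?I. w \<in> ?B d" if "w \<in> unit_square" for w
      using m_in[of "min (m w) (m z)" w] that m_pos[OF that] m_pos[OF z(1)] by (intro bexI[of _ "min (m w) (m z)"]) auto
    then show "topspace ?X \<subseteq> (\<Union>d\<in>?I. ?B d)" by auto
    fix d assume d: "d \<in> ?I"
    have "?B d \<subseteq> unit_square" using Ksub[of d] sub[of d] d by blast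
    then show "openin ?X (?B d)" by (intro open_subset) auto
    have "subtopology ?X (?B d) = top_of_set (?B d)"
      using \<open>?B d \<subseteq> unit_square\<close> by (simp add: subtopology_subtopology inf.absorb2)
    then show "continuous_map (subtopology ?X (?B d)) E (S d)"
      using is_lift_subset[OF S(1)[OF d] sub] by (simp add: is_lift_def)
  next
    fix d d' w assume *: "d \<in> ?I" "d' \<in> ?I" "w \<in> topspace ?X \<inter> ?B d \<inter> ?B d'"
    then have "w \<in> ?K d" "w \<in> ?K d'" using sub by auto
    then show "S d w = S d' w" using mono[of d d' w] mono[of d' d w] * by (cases "d' \<le> d") auto
  qed auto
  have "p (r w) = g w" if "w \<in> unit_square" for w
  proof -
    let ?d = "min (m w) (m z)"
    have d: "?d \<in> ?I" "w \<in> ?B ?d" using m_in[of ?d w] m_pos[OF that] m_pos[OF z(1)] that by auto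
    then have "r w = S ?d w" using r(2) that by auto
    then show ?thesis using S(1)[OF d(1)] d(2) sub[of ?d] unfolding is_lift_def by auto
  qed
  moreover have "r z = x"
    using r(2)[of "m z" z] S(2)[of "m z"] m_in[of "m z" z] z m_pos[OF z(1)] by auto
  ultimately show "\<exists>s. is_lift g unit_square s \<and> s z = x" using r(1) unfolding is_lift_def by blast
qed

end

section \<open>Flat surfaces covering the torus\<close>

lemma finite_if_locally_finite:
  assumes "compact_space X" "closedin X S"
    and loc: "\<And>x. x \<in> S \<Longrightarrow> \<exists>U. openin X U \<and> x \<in> U \<and> finite (S \<inter> U)"
  shows "finite S"
proof -
  obtain U where U: "\<And>x. x \<in> S \<Longrightarrow> openin X (U x) \<and> x \<in> U x \<and> finite (S \<inter> U x)" using loc by metis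
  have "compactin X S" using assms closedin_compact_space by blast
  then obtain \<F> where F: "finite \<F>" "\<F> \<subseteq> U ` S" "S \<subseteq> \<Union> \<F>"
    unfolding compactin_def using U by (metis (no_types, lifting) UN_iff imageE subsetI)
  have "S = (\<Union>V\<in>\<F>. S \<inter> V)" using F(3) by auto
  moreover have "finite (\<Union>V\<in>\<F>. S \<inter> V)" using F U by (intro finite_UN_I) auto
  ultimately show ?thesis by simp
qed

text \<open>What the origami and the standard torus have in common, so that lifting and area are
  treated once for both. Zeros of the form can lie only over the lattice point.\<close>

locale flat_cover =
  fixes X :: "'a surface" and \<rho> :: "'a \<Rightarrow> complex set"
  assumes Hausdorff_surf: "Hausdorff_space (surf X)"
    and compact_surf: "compact_space (surf X)"
    and connected_surf: "connected_space (surf X)"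
    and charts_cover: "\<Union> (fst ` charts X) = topspace (surf X)"
    and chart: "\<And>U \<phi>. (U, \<phi>) \<in> charts X \<Longrightarrow> openin (surf X) U \<and> open (\<phi> ` U) \<and>
        homeomorphic_map (subtopology (surf X) U) (top_of_set (\<phi> ` U)) \<phi>"
    and cover: "translation_cover X standard_torus {torus_proj 0} \<rho>"
    and form_nonzero: "\<And>U \<phi> x. (U, \<phi>) \<in> charts X \<Longrightarrow> x \<in> U \<Longrightarrow> \<rho> x \<noteq> torus_proj 0 \<Longrightarrow> form X (U, \<phi>) (\<phi> x) \<noteq> 0"
begin

sublocale branched_cover "surf X" torus_top \<rho> "{torus_proj 0}"
proof
  show "Hausdorff_space (surf X)" by (rule Hausdorff_surf)
  show "continuous_map (surf X) torus_top \<rho>" using cover by (simp add: translation_cover_def)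
  show "\<exists>V \<U>. openin torus_top V \<and> y \<in> V \<and> V \<inter> {torus_proj 0} = {} \<and>
        \<Union> \<U> = {x \<in> topspace (surf X). \<rho> x \<in> V} \<and> pairwise disjnt \<U> \<and>
        (\<forall>U \<in> \<U>. openin (surf X) U \<and> homeomorphic_map (subtopology (surf X) U) (subtopology torus_top V) \<rho>)"
    if "y \<in> topspace torus_top - {torus_proj 0}" for y
    using cover that unfolding translation_cover_def by blast
qed

lemma surj: "\<rho> ` topspace (surf X) = range torus_proj"
  using cover by (simp add: translation_cover_def topspace_torus)

lemma primitive_pullback:
  "primitive_on standard_torus V F \<Longrightarrow> primitive_on X {x \<in> topspace (surf X). \<rho> x \<in> V} (F \<circ> \<rho>)"
  using cover by (simp add: translation_cover_def)

section \<open>Fibres and local coordinates\<close>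

definition fibre :: "complex \<Rightarrow> 'a set" where
  "fibre z = {x \<in> topspace (surf X). \<rho> x = torus_proj z}"

lemma closedin_fibre: "closedin (surf X) (fibre z)"
proof -
  have "closedin torus_top {torus_proj z}"
    by (intro closedin_Hausdorff_singleton[OF Hausdorff_torus]) (simp add: topspace_torus)
  then have "closedin (surf X) {x \<in> topspace (surf X). \<rho> x \<in> {torus_proj z}}"
    using continuous by (rule closedin_continuous_map_preimage[rotated])
  then show ?thesis by (simp add: fibre_def)
qed

lemma openin_ball_preimage: "openin (surf X) {x \<in> topspace (surf X). \<rho> x \<in> torus_proj ` ball z r}"
  using continuous by (rule openin_continuous_map_preimage) (simp add: open_torus_proj)

lemma finite_fibre_generic:
  assumes "z \<notin> gaussian_ints"
  shows "finite (fibre z)"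
proof (rule finite_if_locally_finite[OF compact_surf closedin_fibre])
  fix x assume x: "x \<in> fibre z"
  then have "x \<in> topspace (surf X)" "\<rho> x \<notin> {torus_proj 0}" using assms by (auto simp: fibre_def torus_proj_eq_0_iff)
  then obtain U where U: "openin (surf X) U" "x \<in> U" "inj_on \<rho> U" by (rule local_sheet)
  have "fibre z \<inter> U \<subseteq> {x}" using U(3) x U(2) by (auto simp: fibre_def inj_on_def)
  then show "\<exists>U. openin (surf X) U \<and> x \<in> U \<and> finite (fibre z \<inter> U)" using U finite_subset by blast
qed

text \<open>Composing \<open>\<rho>\<close> with the local inverse of \<open>torus_proj\<close> near
  \<open>z\<close> gives, in a chart, a holomorphic \<open>G\<close> whose derivative is the form.
  Since \<open>translation_cover\<close> pulls back primitives over the whole torus, this works over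
  the lattice point as well, where no sheets are available.\<close>

lemma local_coordinate:
  assumes x: "x \<in> fibre z" and V: "openin (surf X) V" "x \<in> V"
  obtains U \<phi> r G where "(U, \<phi>) \<in> charts X" "x \<in> U" "r > 0" "ball (\<phi> x) r \<subseteq> \<phi> ` U"
    "openin (surf X) (inv_into U \<phi> ` ball (\<phi> x) r)" "inv_into U \<phi> ` ball (\<phi> x) r \<subseteq> V" "inv_into U \<phi> (\<phi> x) = x"
    "\<forall>w\<in>ball (\<phi> x) r. (G has_field_derivative form X (U, \<phi>) w) (at w)"
    "\<forall>w\<in>ball (\<phi> x) r. \<rho> (inv_into U \<phi> w) = torus_proj (G w)"
    "\<forall>w\<in>ball (\<phi> x) r. G w \<in> ball z (1 / 2)"
    "G (\<phi> x) = z"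
proof -
  have xt: "x \<in> topspace (surf X)" "\<rho> x = torus_proj z" using x by (auto simp: fibre_def)
  then obtain U \<phi> where U: "(U, \<phi>) \<in> charts X" "x \<in> U" using charts_cover by fastforce
  note c = chart[OF U(1)]
  have UT: "U \<subseteq> topspace (surf X)" using c openin_subset by blast
  have hm: "homeomorphic_map (subtopology (surf X) U) (top_of_set (\<phi> ` U)) \<phi>" using c by blast
  then have inj: "inj_on \<phi> U" using homeomorphic_imp_injective_map UT by (metis inf.absorb_iff2 topspace_subtopology)
  obtain h where h: "homeomorphic_maps (subtopology (surf X) U) (top_of_set (\<phi> ` U)) \<phi> h"
    using hm homeomorphic_map_maps by blast
  then have hmap: "homeomorphic_map (top_of_set (\<phi> ` U)) (subtopology (surf X) U) h" using homeomorphic_maps_map by blast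
  have hinv: "h w = inv_into U \<phi> w" if "w \<in> \<phi> ` U" for w
    using h that inj UT by (auto simp: homeomorphic_maps_def)
  let ?W = "{y \<in> topspace (surf X). \<rho> y \<in> torus_proj ` ball z (1 / 2)}"
  define F where "F = inv_into (ball z (1 / 2)) torus_proj"
  have prim: "primitive_on X ?W (F \<circ> \<rho>)"
    unfolding F_def by (intro primitive_pullback primitive_on_inv_torus_proj inj_on_torus_proj_ball) simp
  define O' where "O' = U \<inter> V \<inter> ?W"
  have "openin (surf X) O'" unfolding O'_def using c V(1) openin_ball_preimage by (intro openin_Int) auto
  then have "openin (subtopology (surf X) U) O'" unfolding openin_subtopology by (intro exI[of _ O']) (auto simp: O'_def)
  then have "openin (top_of_set (\<phi> ` U)) (\<phi> ` O')" using hm homeomorphic_map_openness_eq by blast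
  then have "open (\<phi> ` O')" using c by (auto simp: openin_open_eq)
  moreover have xO: "x \<in> O'" using U V xt by (auto simp: O'_def)
  ultimately obtain r where r: "r > 0" "ball (\<phi> x) r \<subseteq> \<phi> ` O'" by (meson imageI open_contains_ball)
  have sub: "ball (\<phi> x) r \<subseteq> \<phi> ` U" using r by (auto simp: O'_def)
  have inO: "inv_into U \<phi> w \<in> O'" if w: "w \<in> ball (\<phi> x) r" for w
  proof -
    obtain y where "y \<in> O'" "w = \<phi> y" using w r by blast
    then show ?thesis using inj by (auto simp: O'_def)
  qed
  have coord: "(F \<circ> \<rho> \<circ> inv_into U \<phi> has_field_derivative form X (U, \<phi>) w) (at w) \<and>
      \<rho> (inv_into U \<phi> w) = torus_proj ((F \<circ> \<rho> \<circ> inv_into U \<phi>) w) \<and> (F \<circ> \<rho> \<circ> inv_into U \<phi>) w \<in> ball z (1 / 2)"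
    if w: "w \<in> ball (\<phi> x) r" for w
  proof -
    have \<phi>w: "\<phi> (inv_into U \<phi> w) = w" using w sub by (meson f_inv_into_f subsetD)
    have c1: "(F \<circ> \<rho> \<circ> inv_into U \<phi> has_field_derivative form X (U, \<phi>) w) (at w)"
      using prim inO[OF w] U(1) \<phi>w unfolding primitive_on_def O'_def by (metis (no_types, lifting) Int_iff case_prodD)
    have in_img: "\<rho> (inv_into U \<phi> w) \<in> torus_proj ` ball z (1 / 2)" using inO[OF w] by (auto simp: O'_def)
    have c2: "\<rho> (inv_into U \<phi> w) = torus_proj ((F \<circ> \<rho> \<circ> inv_into U \<phi>) w)"
      using f_inv_into_f[OF in_img] by (simp add: F_def)
    have c3: "(F \<circ> \<rho> \<circ> inv_into U \<phi>) w \<in> ball z (1 / 2)"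
      using inv_into_into[OF in_img] by (simp add: F_def)
    show ?thesis using c1 c2 c3 by blast
  qed
  show ?thesis
  proof (rule that[OF U r(1) sub])
    have "openin (top_of_set (\<phi> ` U)) (ball (\<phi> x) r)" using sub by (intro open_subset) auto
    then have "openin (subtopology (surf X) U) (h ` ball (\<phi> x) r)"
      using hmap homeomorphic_map_openness_eq by blast
    moreover have "h ` ball (\<phi> x) r = inv_into U \<phi> ` ball (\<phi> x) r" using hinv sub by (intro image_cong) auto
    ultimately show "openin (surf X) (inv_into U \<phi> ` ball (\<phi> x) r)" using c openin_trans_full by metis
    show "inv_into U \<phi> ` ball (\<phi> x) r \<subseteq> V" using inO by (auto simp: O'_def)
    show "inv_into U \<phi> (\<phi> x) = x" using inj U by simp
  next
    show "\<forall>w\<in>ball (\<phi> x) r. (F \<circ> \<rho> \<circ> inv_into U \<phi> has_field_derivative form X (U, \<phi>) w) (at w)"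
      "\<forall>w\<in>ball (\<phi> x) r. \<rho> (inv_into U \<phi> w) = torus_proj ((F \<circ> \<rho> \<circ> inv_into U \<phi>) w)"
      "\<forall>w\<in>ball (\<phi> x) r. (F \<circ> \<rho> \<circ> inv_into U \<phi>) w \<in> ball z (1 / 2)" using coord by blast+
    show "(F \<circ> \<rho> \<circ> inv_into U \<phi>) (\<phi> x) = z"
      using inj U xt inj_on_torus_proj_ball[of z] by (simp add: F_def)
  qed
qed

text \<open>Near \<open>x\<close> the fibre is the zero set of the holomorphic function
  \<open>G\<close>, which either vanishes identically on the ball or has an isolated zero at its
  centre.\<close>

lemma fibre_0_dichotomy:
  assumes x: "x \<in> fibre 0"
  obtains V where "openin (surf X) V" "x \<in> V" "V \<subseteq> fibre 0"
    | V where "openin (surf X) V" "x \<in> V" "V \<inter> fibre 0 = {x}"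
proof -
  have "openin (surf X) (topspace (surf X))" "x \<in> topspace (surf X)" using x by (auto simp: fibre_def)
  then obtain U \<phi> r G where U: "(U, \<phi>) \<in> charts X" "x \<in> U" "r > 0" "ball (\<phi> x) r \<subseteq> \<phi> ` U"
    "openin (surf X) (inv_into U \<phi> ` ball (\<phi> x) r)" "inv_into U \<phi> ` ball (\<phi> x) r \<subseteq> topspace (surf X)" "inv_into U \<phi> (\<phi> x) = x" and
    G: "\<forall>w\<in>ball (\<phi> x) r. (G has_field_derivative form X (U, \<phi>) w) (at w)"
    "\<forall>w\<in>ball (\<phi> x) r. \<rho> (inv_into U \<phi> w) = torus_proj (G w)"
    "\<forall>w\<in>ball (\<phi> x) r. G w \<in> ball 0 (1 / 2)" "G (\<phi> x) = 0"
    by (rule local_coordinate[OF x])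
  note G = G[rule_format]
  let ?B = "ball (\<phi> x) r"
  have hol: "G holomorphic_on ?B" unfolding holomorphic_on_open[OF open_ball] using G(1) by blast
  have zero: "inv_into U \<phi> w \<in> fibre 0 \<longleftrightarrow> G w = 0" if "w \<in> ?B" for w
  proof -
    have "inv_into U \<phi> w \<in> topspace (surf X)" using U(5) that openin_subset by blast
    moreover have "torus_proj (G w) = torus_proj 0 \<longleftrightarrow> G w = 0"
      using inj_on_torus_proj_ball[of 0] G(3)[OF that] by (auto simp: inj_on_def)
    ultimately show ?thesis using G(2)[OF that] by (simp add: fibre_def)
  qed
  show ?thesis
  proof (cases "\<forall>w\<in>?B. G w = 0")
    case True
    then have "inv_into U \<phi> ` ?B \<subseteq> fibre 0" using zero by blast
    moreover have "x \<in> inv_into U \<phi> ` ?B" using U by (metis centre_in_ball imageI)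
    ultimately show ?thesis using that(1) U(5) by blast
  next
    case False
    then obtain \<beta> where \<beta>: "\<beta> \<in> ?B" "G \<beta> \<noteq> 0" by blast
    obtain e where e: "0 < e" "ball (\<phi> x) e \<subseteq> ?B" "\<And>z. z \<in> ball (\<phi> x) e - {\<phi> x} \<Longrightarrow> G z \<noteq> 0"
      using isolated_zeros[OF hol open_ball connected_ball _ G(4) \<beta>] U(3) by auto
    have "openin (surf X) (inv_into U \<phi> ` ball (\<phi> x) e)"
    proof -
      have "homeomorphic_map (subtopology (surf X) U) (top_of_set (\<phi> ` U)) \<phi>" "openin (surf X) U" using chart[OF U(1)] by auto
      moreover have "openin (surf X) {y \<in> topspace (subtopology (surf X) U). \<phi> y \<in> ball (\<phi> x) e}"
      proof -
        have "continuous_map (subtopology (surf X) U) euclidean \<phi>"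
          using calculation(1) by (meson continuous_map_into_fulltopology homeomorphic_imp_continuous_map)
        then have "openin (subtopology (surf X) U) {y \<in> topspace (subtopology (surf X) U). \<phi> y \<in> ball (\<phi> x) e}"
          by (rule openin_continuous_map_preimage) simp
        then show ?thesis using calculation(2) openin_trans_full by blast
      qed
      moreover have "{y \<in> topspace (subtopology (surf X) U). \<phi> y \<in> ball (\<phi> x) e} = inv_into U \<phi> ` ball (\<phi> x) e"
      proof -
        have inj: "inj_on \<phi> U"
          using calculation(1,2) homeomorphic_imp_injective_map openin_subset by (metis inf.absorb_iff2 topspace_subtopology)
        have "ball (\<phi> x) e \<subseteq> \<phi> ` U" using e U by blast
        then have "\<phi> (inv_into U \<phi> w) = w" "inv_into U \<phi> w \<in> U" if "w \<in> ball (\<phi> x) e" for w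
          using that by (meson f_inv_into_f inv_into_into subsetD)+
        then show ?thesis using inj openin_subset[OF calculation(2)] by (auto simp: image_iff) (metis inv_into_f_f mem_ball)
      qed
      ultimately show ?thesis by simp
    qed
    moreover have "x \<in> inv_into U \<phi> ` ball (\<phi> x) e" using U e by (metis centre_in_ball imageI)
    moreover have "inv_into U \<phi> ` ball (\<phi> x) e \<inter> fibre 0 = {x}"
    proof -
      have "w = \<phi> x" if "w \<in> ball (\<phi> x) e" "inv_into U \<phi> w \<in> fibre 0" for w
        using zero[of w] e that by blast
      then have "y = x" if "y \<in> inv_into U \<phi> ` ball (\<phi> x) e \<inter> fibre 0" for y using that U(7) by blast
      then show ?thesis using x \<open>x \<in> inv_into U \<phi> ` ball (\<phi> x) e\<close> by blast
    qed
    ultimately show ?thesis using that(2) by blast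
  qed
qed

text \<open>An identity principle on the connected surface: by the dichotomy the interior
  \<open>I\<close> of the fibre is also closed. It cannot be everything, as \<open>\<rho>\<close> is
  onto the torus, so it is empty.\<close>

lemma fibre_0_isolated:
  assumes x: "x \<in> fibre 0"
  obtains V where "openin (surf X) V" "x \<in> V" "V \<inter> fibre 0 = {x}"
proof -
  define I where "I = \<Union> {V. openin (surf X) V \<and> V \<subseteq> fibre 0}"
  have I: "openin (surf X) I" "I \<subseteq> fibre 0" unfolding I_def by auto
  have max: "V \<subseteq> I" if "openin (surf X) V" "V \<subseteq> fibre 0" for V using that by (auto simp: I_def)
  have "openin (surf X) (topspace (surf X) - I)"
  proof (subst openin_subopen, intro ballI)
    fix y assume y: "y \<in> topspace (surf X) - I"
    show "\<exists>T. openin (surf X) T \<and> y \<in> T \<and> T \<subseteq> topspace (surf X) - I"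
    proof (cases "y \<in> fibre 0")
      case True
      then show ?thesis
      proof (cases rule: fibre_0_dichotomy)
        case (1 V) then show ?thesis using max y by blast
      next
        case (2 V)
        have "v \<notin> I" if "v \<in> V" for v
        proof
          assume "v \<in> I"
          then have "v \<in> V \<inter> fibre 0" using I(2) that by blast
          then have "v = y" using 2(3) by simp
          then show False using y \<open>v \<in> I\<close> by simp
        qed
        then have "V \<subseteq> topspace (surf X) - I" using openin_subset[OF 2(1)] by blast
        then show ?thesis using 2 by blast
      qed
    next
      case False
      then show ?thesis using y I closedin_fibre[of 0] by (intro exI[of _ "topspace (surf X) - fibre 0"]) auto
    qed
  qed
  then have "closedin (surf X) I" using I openin_subset by (auto simp: closedin_def)
  then have "I = {} \<or> I = topspace (surf X)" using connected_surf I(1) connected_space_clopen_in by blast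
  moreover have "I \<noteq> topspace (surf X)"
  proof
    assume "I = topspace (surf X)"
    then have "\<rho> ` topspace (surf X) \<subseteq> {torus_proj 0}" using I(2) by (auto simp: fibre_def)
    then have "torus_proj (1 / 2) = torus_proj 0" using surj by auto
    then have "Re (1 / 2) \<in> \<int>" unfolding torus_proj_eq_0_iff gaussian_ints_iff by blast
    then obtain k :: int where "1 / 2 = real_of_int k" by (auto elim!: Ints_cases)
    then have "real_of_int (2 * k) = real_of_int 1" by simp
    then show False unfolding of_int_eq_iff by presburger
  qed
  ultimately have "I = {}" by blast
  with x show ?thesis
  proof (cases rule: fibre_0_dichotomy)
    case (1 V) then show ?thesis using max \<open>I = {}\<close> by blast
  qed (rule that)
qed

lemma finite_fibre: "finite (fibre z)"
proof (cases "z \<in> gaussian_ints")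
  case True
  then have "fibre z = fibre 0" by (simp add: fibre_def torus_proj_eq_0_iff[THEN iffD2])
  moreover have "finite (fibre 0)"
  proof (rule finite_if_locally_finite[OF compact_surf closedin_fibre])
    fix x assume "x \<in> fibre 0"
    then obtain V where "openin (surf X) V" "x \<in> V" "V \<inter> fibre 0 = {x}" by (rule fibre_0_isolated)
    then show "\<exists>U. openin (surf X) U \<and> x \<in> U \<and> finite (fibre 0 \<inter> U)" by (intro exI[of _ V]) (simp add: inf_commute)
  qed
  ultimately show ?thesis by simp
qed (rule finite_fibre_generic)

text \<open>The open mapping theorem for \<open>G\<close> stands in for the covering property, which
  says nothing at \<open>x\<close>. \<open>G\<close> is not constant because the fibre is
  isolated.\<close>

lemma open_at_fibre_0:
  assumes x: "x \<in> fibre 0" and V: "openin (surf X) V" "x \<in> V"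
  obtains r where "r > 0" "torus_proj ` ball 0 r \<subseteq> \<rho> ` V"
proof -
  obtain V' where V': "openin (surf X) V'" "x \<in> V'" "V' \<inter> fibre 0 = {x}" using fibre_0_isolated[OF x] .
  have "openin (surf X) (V \<inter> V')" "x \<in> V \<inter> V'" using V V' by auto
  then obtain U \<phi> r G where U: "(U, \<phi>) \<in> charts X" "x \<in> U" "r > 0" "ball (\<phi> x) r \<subseteq> \<phi> ` U"
    "openin (surf X) (inv_into U \<phi> ` ball (\<phi> x) r)" "inv_into U \<phi> ` ball (\<phi> x) r \<subseteq> V \<inter> V'" "inv_into U \<phi> (\<phi> x) = x" and
    G: "\<forall>w\<in>ball (\<phi> x) r. (G has_field_derivative form X (U, \<phi>) w) (at w)"
    "\<forall>w\<in>ball (\<phi> x) r. \<rho> (inv_into U \<phi> w) = torus_proj (G w)"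
    "\<forall>w\<in>ball (\<phi> x) r. G w \<in> ball 0 (1 / 2)" "G (\<phi> x) = 0"
    by (rule local_coordinate[OF x])
  note G = G[rule_format]
  let ?B = "ball (\<phi> x) r"
  have hol: "G holomorphic_on ?B" unfolding holomorphic_on_open[OF open_ball] using G(1) by blast
  have "\<not> G constant_on ?B"
  proof
    assume "G constant_on ?B"
    then have const: "G w = 0" if "w \<in> ?B" for w using that G(4) U(3) by (metis centre_in_ball constant_on_def)
    define w where "w = \<phi> x + of_real (r / 2)"
    have w: "w \<in> ?B" "w \<noteq> \<phi> x" using U(3) by (auto simp: w_def dist_norm)
    have "inv_into U \<phi> w \<in> V" using U(6) w by blast
    then have "inv_into U \<phi> w \<in> fibre 0"
      using G(2)[OF w(1)] const[OF w(1)] U(6) w openin_subset[OF V(1)] by (auto simp: fibre_def)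
    then have "inv_into U \<phi> w = x" using V'(3) U(6) w by blast
    then have "w = \<phi> x" using U(4) w(1) by (metis f_inv_into_f subsetD)
    then show False using w by simp
  qed
  then have "open (G ` ?B)" by (rule open_mapping_thm[OF hol open_ball connected_ball open_ball order_refl])
  moreover have "0 \<in> G ` ?B" using G(4) U(3) by (metis centre_in_ball imageI)
  ultimately obtain e where e: "e > 0" "ball 0 e \<subseteq> G ` ?B" by (meson open_contains_ball)
  have "torus_proj ` ball 0 e \<subseteq> \<rho> ` V"
  proof
    fix y assume "y \<in> torus_proj ` ball 0 e"
    then obtain w where "w \<in> ?B" "y = torus_proj (G w)" using e(2) by blast
    then show "y \<in> \<rho> ` V" using G(2)[of w] U(6) by (metis (no_types, opaque_lifting) Int_iff imageI subsetD)
  qed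
  then show ?thesis using that e by blast
qed

text \<open>The derivative of \<open>G\<close> at this point is the value of the form, hence
  nonzero. This prevents two segments from leaving a regular point in the same direction.\<close>

lemma inj_at_regular:
  assumes x: "x \<in> fibre 0" "x \<notin> zeros X"
  obtains V where "openin (surf X) V" "x \<in> V" "inj_on \<rho> V"
proof -
  have "openin (surf X) (topspace (surf X))" "x \<in> topspace (surf X)" using x by (auto simp: fibre_def)
  then obtain U \<phi> r G where U: "(U, \<phi>) \<in> charts X" "x \<in> U" "r > 0" "ball (\<phi> x) r \<subseteq> \<phi> ` U"
    "openin (surf X) (inv_into U \<phi> ` ball (\<phi> x) r)" "inv_into U \<phi> ` ball (\<phi> x) r \<subseteq> topspace (surf X)" "inv_into U \<phi> (\<phi> x) = x" and
    G: "\<forall>w\<in>ball (\<phi> x) r. (G has_field_derivative form X (U, \<phi>) w) (at w)"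
    "\<forall>w\<in>ball (\<phi> x) r. \<rho> (inv_into U \<phi> w) = torus_proj (G w)"
    "\<forall>w\<in>ball (\<phi> x) r. G w \<in> ball 0 (1 / 2)" "G (\<phi> x) = 0"
    by (rule local_coordinate[OF x(1)])
  note G = G[rule_format]
  have hol: "G holomorphic_on ball (\<phi> x) r" unfolding holomorphic_on_open[OF open_ball] using G(1) by blast
  have "form X (U, \<phi>) (\<phi> x) \<noteq> 0" using x(2) U by (auto simp: zeros_def)
  then have "deriv G (\<phi> x) \<noteq> 0" using G(1) U(3) by (metis DERIV_imp_deriv centre_in_ball)
  then obtain e where e: "e > 0" "inj_on G (ball (\<phi> x) e)"
    using has_complex_derivative_locally_injective[OF hol, of "\<phi> x"] U(3) by auto
  let ?d = "min e r"
  have inj: "inj_on \<phi> U" using chart[OF U(1)] homeomorphic_imp_injective_map openin_subset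
    by (metis inf.absorb_iff2 topspace_subtopology)
  let ?V = "{y \<in> topspace (subtopology (surf X) U). \<phi> y \<in> ball (\<phi> x) ?d}"
  have "continuous_map (subtopology (surf X) U) euclidean \<phi>"
    using chart[OF U(1)] by (meson continuous_map_into_fulltopology homeomorphic_imp_continuous_map)
  then have "openin (subtopology (surf X) U) ?V" by (rule openin_continuous_map_preimage) simp
  then have "openin (surf X) ?V" using chart[OF U(1)] openin_trans_full by blast
  moreover have "x \<in> ?V" using U e x by (auto simp: fibre_def)
  moreover have "inj_on \<rho> ?V"
  proof (rule inj_onI)
    fix y y' assume y: "y \<in> ?V" "y' \<in> ?V" "\<rho> y = \<rho> y'"
    then have "\<rho> y = torus_proj (G (\<phi> y))" "\<rho> y' = torus_proj (G (\<phi> y'))"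
      using G(2)[of "\<phi> y"] G(2)[of "\<phi> y'"] inj by auto
    then have "G (\<phi> y) = G (\<phi> y')"
      using y G(3)[of "\<phi> y"] G(3)[of "\<phi> y'"] inj_on_torus_proj_ball[of 0] by (auto simp: inj_on_def)
    then have "\<phi> y = \<phi> y'" using e(2) y by (auto simp: inj_on_def)
    then show "y = y'" using inj y by (auto simp: inj_on_def)
  qed
  ultimately show ?thesis using that by blast
qed

text \<open>A continuous map from a compact to a Hausdorff space is closed, so the image of the
  complement of \<open>V\<close> is closed, and it misses the lattice point.\<close>

lemma fibre_0_proper:
  assumes V: "openin (surf X) V" "fibre 0 \<subseteq> V"
  obtains r where "r > 0" "\<And>y. y \<in> topspace (surf X) \<Longrightarrow> \<rho> y \<in> torus_proj ` ball 0 r \<Longrightarrow> y \<in> V"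
proof -
  have "closed_map (surf X) torus_top \<rho>"
    using continuous_imp_closed_map[OF continuous compact_surf Hausdorff_torus] .
  then have cl: "closedin torus_top (\<rho> ` (topspace (surf X) - V))" using V(1) by (auto simp: closed_map_def)
  then have "openin torus_top (topspace torus_top - \<rho> ` (topspace (surf X) - V))" by blast
  moreover have "torus_proj 0 \<in> topspace torus_top - \<rho> ` (topspace (surf X) - V)"
    using V(2) by (auto simp: fibre_def topspace_torus)
  ultimately obtain r where "r > 0" "ball 0 r \<subseteq> torus_proj -` (topspace torus_top - \<rho> ` (topspace (surf X) - V))"
    unfolding openin_torus by (meson open_contains_ball vimageI)
  then show ?thesis using that by blast
qed

end

section \<open>Saddle connections\<close>

text \<open>The combinatorial core of \<open>saddle_connection_exists\<close>. \<open>A\<close> is a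
  set of directed edges between vertices \<open>P\<close>; an edge is determined by its end unless
  the end lies in \<open>S\<close>. Among \<open>card A + 1\<close> consecutive edges two coincide.
  If no end were in \<open>S\<close>, the coincidence could be moved back to the initial edge, whose
  start \<open>x0\<close> would then be an end outside \<open>S\<close>.\<close>

lemma chain_between_marked_points:
  assumes A: "finite A" and st: "P \<subseteq> st ` A" and en: "en ` A \<subseteq> P" and x0: "x0 \<in> P" "x0 \<in> S"
    and inj: "\<And>a b. a \<in> A \<Longrightarrow> b \<in> A \<Longrightarrow> en a = en b \<Longrightarrow> en a \<notin> S \<Longrightarrow> a = b"
  obtains k f where "1 \<le> k" "k \<le> card A" "\<And>i. f i \<in> A" "\<And>i. st (f (Suc i)) = en (f i)"
    "st (f 0) \<in> S" "\<And>i. Suc i < k \<Longrightarrow> en (f i) \<notin> S" "en (f (k - 1)) \<in> S"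
proof -
  obtain a0 where a0: "a0 \<in> A" "st a0 = x0" using st x0 by blast
  define nxt where "nxt a = (SOME b. b \<in> A \<and> st b = en a)" for a
  have nxt: "nxt a \<in> A" "st (nxt a) = en a" if "a \<in> A" for a
  proof -
    have "\<exists>b. b \<in> A \<and> st b = en a" using st en that by (metis imageE image_subset_iff subsetD)
    from someI_ex[OF this] show "nxt a \<in> A" "st (nxt a) = en a" by (auto simp: nxt_def)
  qed
  define f where "f i = (nxt ^^ i) a0" for i
  have f0: "f 0 = a0" and fS: "f (Suc i) = nxt (f i)" for i by (auto simp: f_def)
  have fA: "f i \<in> A" for i by (induction i) (auto simp: f0 fS a0 nxt)
  have stS: "st (f (Suc i)) = en (f i)" for i using nxt fA by (simp add: fS)
  have "\<exists>i<card A. en (f i) \<in> S"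
  proof (rule ccontr)
    assume "\<not> ?thesis"
    then have no: "en (f i) \<notin> S" if "i < card A" for i using that by blast
    have ne: "f i \<noteq> f j" if "i < j" "j \<le> card A" for i j
      using that
    proof (induction i arbitrary: j)
      case 0
      then obtain j' where j': "j = Suc j'" by (cases j) auto
      then have "st (f j) \<notin> S" using no[of j'] 0 stS by simp
      then show ?case using f0 a0 x0 by auto
    next
      case (Suc i)
      then obtain j' where j': "j = Suc j'" by (cases j) auto
      show ?case
      proof
        assume "f (Suc i) = f j"
        then have "en (f i) = en (f j')" using stS j' by metis
        then have "f i = f j'" using inj fA no[of i] Suc.prems j' by auto
        then show False using Suc.IH[of j'] Suc.prems j' by auto
      qed
    qed
    have "inj_on f {..card A}" by (rule inj_onI) (metis ne atMost_iff linorder_neqE_nat)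
    then have "card {..card A} \<le> card A" using fA A by (intro card_inj_on_le[of f]) auto
    then show False by simp
  qed
  then obtain i0 where i0: "i0 < card A" "en (f i0) \<in> S" by blast
  \<comment> \<open>Stopping at the least such index keeps all earlier ends out of \<open>S\<close>;
    the chain has \<open>Suc m\<close> edges.\<close>
  define m where "m = (LEAST i. en (f i) \<in> S)"
  have "en (f m) \<in> S" unfolding m_def using i0(2) by (rule LeastI)
  then have m: "en (f (Suc m - 1)) \<in> S" by simp
  have "m \<le> i0" unfolding m_def using i0(2) by (rule Least_le)
  then have card: "Suc m \<le> card A" using i0(1) by simp
  have mid: "en (f i) \<notin> S" if "Suc i < Suc m" for i
    using not_less_Least[of i "\<lambda>i. en (f i) \<in> S"] that unfolding m_def[symmetric] by blast
  have start: "st (f 0) \<in> S" using f0 a0 x0 by simp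
  have "1 \<le> Suc m" by simp
  then show ?thesis using that[OF _ card fA stS start mid m] by blast
qed

section \<open>Lifts of segments in primitive directions\<close>

context flat_cover
begin

text \<open>The primitive lattice vectors, expressed by what lifting needs: the open segment from 0
  to \<open>u\<close> avoids the lattice. In particular \<open>u = 0\<close> is excluded.\<close>

definition seg_dir :: "complex \<Rightarrow> bool" where
  "seg_dir u \<longleftrightarrow> u \<in> gaussian_ints \<and> (\<forall>t\<in>{0<..<1}. of_real t * u \<notin> gaussian_ints)"

definition is_seg :: "complex \<Rightarrow> (real \<Rightarrow> 'a) \<Rightarrow> bool" where
  "is_seg u L \<longleftrightarrow> continuous_map (top_of_set {0..1}) (surf X) L \<and> (\<forall>t\<in>{0..1}. \<rho> (L t) = torus_proj (of_real t * u))"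

text \<open>The covering yields lifts of this kind only; those of \<open>is_seg\<close> arise by
  adding limits at both ends.\<close>

definition open_seg :: "complex \<Rightarrow> (real \<Rightarrow> 'a) \<Rightarrow> bool" where
  "open_seg u L \<longleftrightarrow> continuous_map (top_of_set {0<..<1}) (surf X) L \<and> (\<forall>t\<in>{0<..<1}. \<rho> (L t) = torus_proj (of_real t * u))"

lemma seg_dir_minus: "seg_dir u \<Longrightarrow> seg_dir (- u)"
  unfolding seg_dir_def using gaussian_ints_closed_ops(2) by fastforce

text \<open>The two points differ by the lattice vector \<open>u\<close>. Hence a reversed lift for
  \<open>u\<close> is a lift for \<open>- u\<close>, and facts about starts turn into facts about
  ends.\<close>

lemma torus_proj_reverse: "u \<in> gaussian_ints \<Longrightarrow> torus_proj (of_real (1 - t) * u) = torus_proj (of_real t * - u)"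
  unfolding torus_proj_eq_iff by (simp add: algebra_simps)

lemma continuous_map_reverse:
  assumes "continuous_map (top_of_set S) Y L" "(\<lambda>t::real. 1 - t) ` T \<subseteq> S"
  shows "continuous_map (top_of_set T) Y (\<lambda>t. L (1 - t))"
proof -
  have "continuous_map (top_of_set T) (top_of_set S) (\<lambda>t. 1 - t)"
    using assms(2) by (auto intro!: continuous_intros)
  from continuous_map_compose[OF this assms(1)] show ?thesis by (simp add: comp_def)
qed

lemma is_seg_reverse: "is_seg u L \<Longrightarrow> u \<in> gaussian_ints \<Longrightarrow> is_seg (- u) (\<lambda>t. L (1 - t))"
  unfolding is_seg_def using torus_proj_reverse[of u]
  by (auto intro!: continuous_map_reverse[of "{0..1}"])

lemma open_seg_reverse: "open_seg u L \<Longrightarrow> u \<in> gaussian_ints \<Longrightarrow> open_seg (- u) (\<lambda>t. L (1 - t))"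
  unfolding open_seg_def using torus_proj_reverse[of u]
  by (auto intro!: continuous_map_reverse[of "{0<..<1}"])

lemma is_seg_fibre: "is_seg u L \<Longrightarrow> t \<in> {0..1} \<Longrightarrow> L t \<in> fibre (of_real t * u)"
  unfolding is_seg_def fibre_def by (auto simp: continuous_map_def)

lemma is_seg_ends: "is_seg u L \<Longrightarrow> u \<in> gaussian_ints \<Longrightarrow> L 0 \<in> fibre 0 \<and> L 1 \<in> fibre 0"
  using is_seg_fibre[of u L 0] is_seg_fibre[of u L 1] by (simp add: fibre_def torus_proj_eq_0_iff[THEN iffD2])

lemma open_seg_eventually:
  assumes L: "open_seg u L" and V: "openin (surf X) V" "fibre 0 \<subseteq> V"
  obtains b where "0 < b" "b \<le> 1" "\<And>t. 0 < t \<Longrightarrow> t < b \<Longrightarrow> L t \<in> V"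
proof -
  obtain r where r: "r > 0" "\<And>y. y \<in> topspace (surf X) \<Longrightarrow> \<rho> y \<in> torus_proj ` ball 0 r \<Longrightarrow> y \<in> V"
    using fibre_0_proper[OF V] by blast
  \<comment> \<open>For \<open>t < b\<close> the point \<open>t * u\<close> has norm below
    \<open>r\<close>; the summand 1 avoids division by 0.\<close>
  define b where "b = min 1 (r / (norm u + 1))"
  have "L t \<in> V" if "0 < t" "t < b" for t
  proof (rule r(2))
    show "L t \<in> topspace (surf X)" using L that by (auto simp: open_seg_def continuous_map_def b_def)
    have "t * (norm u + 1) < r" using that by (simp add: b_def pos_less_divide_eq add_nonneg_pos)
    then have "t * norm u < r" using that by (simp add: algebra_simps)
    then have "of_real t * u \<in> ball 0 r" using that by (simp add: norm_mult)
    then show "\<rho> (L t) \<in> torus_proj ` ball 0 r" using L that by (auto simp: open_seg_def b_def)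
  qed
  moreover have "0 < b" "b \<le> 1" using r(1) by (auto simp: b_def add_nonneg_pos)
  ultimately show ?thesis using that by blast
qed

text \<open>An initial piece of the segment lies in the union of the two sets, and being connected
  it lies in one of them.\<close>

lemma open_seg_eventually_cases:
  assumes L: "open_seg u L" and V: "openin (surf X) V" "openin (surf X) W" "fibre 0 \<subseteq> V \<union> W" "disjnt V W"
  shows "(\<forall>\<^sub>F t in at_right 0. L t \<in> V) \<or> (\<forall>\<^sub>F t in at_right 0. L t \<in> W)"
proof -
  obtain b where b: "0 < b" "b \<le> 1" "\<And>t. 0 < t \<Longrightarrow> t < b \<Longrightarrow> L t \<in> V \<union> W"
    using open_seg_eventually[OF L, of "V \<union> W"] V by blast
  have "continuous_map (top_of_set {0<..<b}) (surf X) L"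
    using L b(2) by (auto simp: open_seg_def intro: continuous_map_from_subtopology_mono)
  then have "connectedin (surf X) (L ` {0<..<b})"
    by (rule connectedin_continuous_map_image) (simp add: connectedin_subtopology)
  moreover have "L t \<in> V \<union> W" if "t \<in> {0<..<b}" for t using b(3)[of t] that by simp
  then have "L ` {0<..<b} \<subseteq> V \<union> W" by blast
  moreover have "V \<inter> W \<inter> L ` {0<..<b} = {}" using V(4) by (auto simp: disjnt_def)
  ultimately have "V \<inter> L ` {0<..<b} = {} \<or> W \<inter> L ` {0<..<b} = {}"
    unfolding connectedin using V by blast
  then have "(\<forall>t. 0 < t \<and> t < b \<longrightarrow> L t \<in> W) \<or> (\<forall>t. 0 < t \<and> t < b \<longrightarrow> L t \<in> V)"
  proof
    assume "V \<inter> L ` {0<..<b} = {}"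
    then have "L t \<notin> V" if "0 < t" "t < b" for t using that by auto
    then show ?thesis using b(3) by blast
  next
    assume "W \<inter> L ` {0<..<b} = {}"
    then have "L t \<notin> W" if "0 < t" "t < b" for t using that by auto
    then show ?thesis using b(3) by blast
  qed
  then show ?thesis unfolding eventually_at_right_field using b(1) by blast
qed

text \<open>If no point of the fibre were a limit, each would have a neighbourhood that the segment
  eventually avoids: the point can be separated from the rest of the finite fibre, and the segment
  settles on one side. But it must eventually lie in the union of these finitely many
  neighbourhoods.\<close>

lemma open_seg_limit:
  assumes L: "open_seg u L"
  obtains x where "x \<in> fibre 0" "limitin (surf X) L x (at_right 0)"
proof -
  have "\<exists>x\<in>fibre 0. limitin (surf X) L x (at_right 0)"
  proof (rule ccontr)
    assume no: "\<not> ?thesis"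
    have "\<exists>V. openin (surf X) V \<and> x \<in> V \<and> (\<forall>\<^sub>F t in at_right 0. L t \<notin> V)" if x: "x \<in> fibre 0" for x
    proof -
      have xt: "x \<in> topspace (surf X)" using x by (simp add: fibre_def)
      have "compactin (surf X) {x}" "compactin (surf X) (fibre 0 - {x})"
        using finite_fibre[of 0] xt by (auto intro!: finite_imp_compactin simp: fibre_def)
      then obtain A B where AB: "openin (surf X) A" "openin (surf X) B" "{x} \<subseteq> A" "fibre 0 - {x} \<subseteq> B" "disjnt A B"
        using Hausdorff_space_compact_separation[OF Hausdorff_surf, of "{x}" "fibre 0 - {x}"] by auto
      obtain V where V: "openin (surf X) V" "x \<in> V" "\<not> (\<forall>\<^sub>F t in at_right 0. L t \<in> V)"
        using no x xt unfolding limitin_def by blast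
      have "(\<forall>\<^sub>F t in at_right 0. L t \<in> A \<inter> V) \<or> (\<forall>\<^sub>F t in at_right 0. L t \<in> B)"
        by (rule open_seg_eventually_cases[OF L]) (use AB V in \<open>auto simp: disjnt_def\<close>)
      moreover have "\<not> (\<forall>\<^sub>F t in at_right 0. L t \<in> A \<inter> V)" using V(3) by (metis (mono_tags, lifting) IntD2 eventually_mono)
      ultimately have "\<forall>\<^sub>F t in at_right 0. L t \<in> B" by blast
      then have "\<forall>\<^sub>F t in at_right 0. L t \<notin> A" by (rule eventually_mono) (use AB in \<open>auto simp: disjnt_def\<close>)
      then show ?thesis using AB by blast
    qed
    then obtain V where V: "\<And>x. x \<in> fibre 0 \<Longrightarrow> openin (surf X) (V x) \<and> x \<in> V x \<and> (\<forall>\<^sub>F t in at_right 0. L t \<notin> V x)" by metis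
    have "openin (surf X) (\<Union>x\<in>fibre 0. V x)" "fibre 0 \<subseteq> (\<Union>x\<in>fibre 0. V x)" using V by blast+
    then obtain b where "0 < b" "\<And>t. 0 < t \<Longrightarrow> t < b \<Longrightarrow> L t \<in> (\<Union>x\<in>fibre 0. V x)"
      using open_seg_eventually[OF L] by metis
    then have "\<forall>\<^sub>F t in at_right 0. L t \<in> (\<Union>x\<in>fibre 0. V x)" unfolding eventually_at_right_field by blast
    moreover have "\<forall>\<^sub>F t in at_right 0. \<forall>x\<in>fibre 0. L t \<notin> V x" using V finite_fibre by (intro eventually_ball_finite) auto
    ultimately have "\<forall>\<^sub>F t in at_right (0::real). False" by eventually_elim auto
    then show False by (simp add: eventually_False)
  qed
  then show ?thesis using that by blast
qed

lemma open_seg_closure: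
  assumes L0: "open_seg u L0" and u: "u \<in> gaussian_ints"
  obtains L where "is_seg u L" "\<And>t. t \<in> {0<..<1} \<Longrightarrow> L t = L0 t"
proof -
  obtain x where x: "x \<in> fibre 0" "limitin (surf X) L0 x (at_right 0)" using open_seg_limit[OF L0] .
  obtain y where y: "y \<in> fibre 0" "limitin (surf X) (\<lambda>t. L0 (1 - t)) y (at_right 0)"
    using open_seg_limit[OF open_seg_reverse[OF L0 u]] .
  define L where "L t = (if t \<le> 0 then x else if t \<ge> 1 then y else L0 t)" for t
  have mid: "L t = L0 t" if "t \<in> {0<..<1}" for t using that by (auto simp: L_def)
  have top: "L t \<in> topspace (surf X)" if "t \<in> {0..1}" for t
    using L0 x(1) y(1) that by (auto simp: L_def open_seg_def continuous_map_def fibre_def)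
  let ?I = "top_of_set {0..1::real}"
  have "openin ?I {t \<in> topspace ?I. L t \<in> V}" if V: "openin (surf X) V" for V
  proof (subst openin_subopen, intro ballI)
    fix t assume t: "t \<in> {t \<in> topspace ?I. L t \<in> V}"
    then consider "t = 0" | "t = 1" | "t \<in> {0<..<1}" by force
    then show "\<exists>T. openin ?I T \<and> t \<in> T \<and> T \<subseteq> {t \<in> topspace ?I. L t \<in> V}"
    proof cases
      case 1
      then have "x \<in> V" using t by (simp add: L_def)
      then have "\<forall>\<^sub>F t in at_right 0. L0 t \<in> V" using x V by (auto simp: limitin_def)
      then obtain b where b: "b > 0" "\<And>t. 0 < t \<Longrightarrow> t < b \<Longrightarrow> L0 t \<in> V" unfolding eventually_at_right_field by blast
      have "L s \<in> V" if "s \<in> {0..1} \<inter> {..<min b 1}" for s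
        using b(2)[of s] \<open>x \<in> V\<close> that by (auto simp: L_def)
      then have "{0..1} \<inter> {..<min b 1} \<subseteq> {t \<in> topspace ?I. L t \<in> V}" by auto
      then show ?thesis using 1 b(1) by (intro exI[of _ "{0..1} \<inter> {..<min b 1}"]) auto
    next
      case 2
      then have "y \<in> V" using t by (simp add: L_def)
      then have "\<forall>\<^sub>F t in at_right 0. L0 (1 - t) \<in> V" using y V by (auto simp: limitin_def)
      then obtain b where b: "b > 0" "\<And>t. 0 < t \<Longrightarrow> t < b \<Longrightarrow> L0 (1 - t) \<in> V" unfolding eventually_at_right_field by blast
      have "L s \<in> V" if "s \<in> {0..1} \<inter> {max (1 - b) 0<..}" for s
        using b(2)[of "1 - s"] \<open>y \<in> V\<close> that by (auto simp: L_def)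
      then have "{0..1} \<inter> {max (1 - b) 0<..} \<subseteq> {t \<in> topspace ?I. L t \<in> V}" by auto
      then show ?thesis using 2 b(1) by (intro exI[of _ "{0..1} \<inter> {max (1 - b) 0<..}"]) auto
    next
      case 3
      have "openin (top_of_set {0<..<1}) {t \<in> topspace (top_of_set {0<..<1}). L0 t \<in> V}"
        by (rule openin_continuous_map_preimage[OF _ V]) (use L0 in \<open>simp add: open_seg_def\<close>)
      then have "open {t \<in> topspace (top_of_set {0<..<1}). L0 t \<in> V}" by (simp add: openin_open_eq)
      then have "openin ?I {t \<in> topspace (top_of_set {0<..<1}). L0 t \<in> V}" by (intro open_subset) auto
      moreover have "{t \<in> topspace (top_of_set {0<..<1}). L0 t \<in> V} \<subseteq> {t \<in> topspace ?I. L t \<in> V}" by (auto simp: L_def)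
      ultimately show ?thesis using 3 t mid by (intro exI[of _ "{t \<in> topspace (top_of_set {0<..<1}). L0 t \<in> V}"]) auto
    qed
  qed
  then have "continuous_map ?I (surf X) L" using top by (auto simp: continuous_map_def)
  moreover have "\<rho> (L t) = torus_proj (of_real t * u)" if t: "t \<in> {0..1}" for t
  proof -
    consider "t = 0" | "t = 1" | "t \<in> {0<..<1}" using t by force
    then show ?thesis
    proof cases
      case 3 then show ?thesis using mid[OF 3] L0 by (auto simp: open_seg_def)
    qed (use x y u in \<open>auto simp: L_def fibre_def torus_proj_eq_0_iff[THEN iffD2]\<close>)
  qed
  ultimately have "is_seg u L" by (auto simp: is_seg_def)
  then show ?thesis using that mid by blast
qed

text \<open>The lifting results concern planar domains, so a segment is viewed as a map of the open
  square that depends on the real part only.\<close>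

lemma seg_lift:
  assumes "continuous_map (top_of_set {0<..<1}) (surf X) L" "\<And>t. t \<in> {0<..<1} \<Longrightarrow> \<rho> (L t) = torus_proj (of_real t * u)"
  shows "is_lift (\<lambda>z. torus_proj (of_real (Re z) * u)) unit_square (\<lambda>z. L (Re z))"
proof -
  have "continuous_map (top_of_set unit_square) (top_of_set {0<..<1}) Re"
    by (auto simp: in_box_complex_iff intro!: continuous_intros)
  from continuous_map_compose[OF this assms(1)] show ?thesis
    using assms(2) by (auto simp: is_lift_def comp_def in_box_complex_iff)
qed

lemma seg_dir_off:
  assumes "seg_dir u" "z \<in> unit_square"
  shows "torus_proj (of_real (Re z) * u) \<notin> {torus_proj 0}"
  using assms by (auto simp: seg_dir_def torus_proj_eq_0_iff in_box_complex_iff)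

lemma seg_exists:
  assumes u: "seg_dir u" and t: "t \<in> {0<..<1}" and y: "y \<in> fibre (of_real t * u)"
  obtains L where "is_seg u L" "L t = y"
proof -
  let ?g = "\<lambda>z. torus_proj (of_real (Re z) * u)"
  have "liftable ?g unit_square"
  proof (rule liftable_unit_square)
    show "continuous_map (top_of_set unit_square) torus_top ?g"
      by (intro continuous_torus_proj_comp continuous_intros)
  qed (rule seg_dir_off[OF u])
  \<comment> \<open>The height \<open>1 / 2\<close> is an arbitrary value inside the square.\<close>
  moreover have "Complex t (1 / 2) \<in> unit_square" using t by (auto simp: in_box_complex_iff)
  ultimately obtain s where s: "is_lift ?g unit_square s" "s (Complex t (1 / 2)) = y"
    using y unfolding liftable_def fibre_def by force
  define L0 where "L0 r = s (Complex r (1 / 2))" for r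
  have cont: "continuous_map (top_of_set {0<..<1}) (top_of_set unit_square) (\<lambda>r. Complex r (1 / 2))"
    by (auto simp: in_box_complex_iff Complex_eq intro!: continuous_intros)
  have "continuous_map (top_of_set unit_square) (surf X) s" using s(1) by (simp add: is_lift_def)
  from continuous_map_compose[OF cont this] have "continuous_map (top_of_set {0<..<1}) (surf X) L0"
    unfolding L0_def comp_def .
  moreover have "\<rho> (L0 r) = torus_proj (of_real r * u)" if "r \<in> {0<..<1}" for r
  proof -
    have "Complex r (1 / 2) \<in> unit_square" using that by (auto simp: in_box_complex_iff)
    then show ?thesis using s(1) unfolding is_lift_def L0_def by fastforce
  qed
  ultimately have "open_seg u L0" by (simp add: open_seg_def)
  then obtain L where "is_seg u L" "\<And>t. t \<in> {0<..<1} \<Longrightarrow> L t = L0 t"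
    using open_seg_closure u unfolding seg_dir_def by metis
  then show ?thesis using that t s(2) by (auto simp: L0_def)
qed

text \<open>Uniqueness of lifts settles the open segment, and the end points follow because the
  coincidence set is closed.\<close>

lemma seg_unique:
  assumes u: "seg_dir u" and L: "is_seg u L" "is_seg u L'" and t: "t \<in> {0<..<1}" "L t = L' t" and r: "r \<in> {0..1}"
  shows "L r = L' r"
proof -
  have lift: "is_lift (\<lambda>z. torus_proj (of_real (Re z) * u)) unit_square (\<lambda>z. K (Re z))" if "is_seg u K" for K
  proof (rule seg_lift)
    show "continuous_map (top_of_set {0<..<1}) (surf X) K"
      using that by (auto simp: is_seg_def elim!: continuous_map_from_subtopology_mono)
  qed (use that in \<open>auto simp: is_seg_def\<close>)
  have eq: "L s = L' s" if s: "s \<in> {0<..<1}" for s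
    using lift_unique[OF convex_connected[OF convex_box(2)] lift[OF L(1)] lift[OF L(2)] seg_dir_off[OF u],
        of "Complex t (1 / 2)" "Complex s (1 / 2)"] t s by (auto simp: in_box_complex_iff)
  let ?I = "top_of_set {0..1::real}"
  let ?C = "{s \<in> topspace ?I. L s = L' s}"
  have "closedin ?I ?C"
    by (rule closedin_continuous_maps_eq[OF Hausdorff_surf]) (use L in \<open>auto simp: is_seg_def\<close>)
  then have "closed ?C" by (rule closedin_closed_trans) simp
  moreover have "{0<..<1} \<subseteq> ?C" using eq by auto
  ultimately have "closure {0<..<1} \<subseteq> ?C" by (rule closure_minimal[rotated])
  then show ?thesis using r by auto
qed

text \<open>The lifts of the segment are finitely many, being indexed by their midpoints. If none
  started at \<open>x\<close>, a common neighbourhood of \<open>x\<close> would be avoided by all of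
  them at small positive times. By openness of \<open>\<rho>\<close> at \<open>x\<close> it
  nevertheless contains points over \<open>t * u\<close> for small \<open>t\<close>, and every such
  point lies on a lift.\<close>

lemma seg_start_surj:
  assumes u: "seg_dir u" and x: "x \<in> fibre 0"
  obtains L where "is_seg u L" "L 0 = x"
proof -
  have "\<exists>L. is_seg u L \<and> L 0 = x"
  proof (rule ccontr)
    assume no: "\<not> ?thesis"
    define A where "A = fibre (of_real (1 / 2) * u)"
    have finA: "finite A" unfolding A_def by (rule finite_fibre)
    have xt: "x \<in> topspace (surf X)" using x by (simp add: fibre_def)
    have "\<exists>L. is_seg u L \<and> L (1 / 2) = y" if "y \<in> A" for y using seg_exists[OF u, of "1 / 2" y] that unfolding A_def by auto
    then obtain S where S: "\<And>y. y \<in> A \<Longrightarrow> is_seg u (S y) \<and> S y (1 / 2) = y" by metis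
    have "\<exists>V b. openin (surf X) V \<and> x \<in> V \<and> 0 < b \<and> (\<forall>t. 0 < t \<and> t < b \<longrightarrow> S y t \<notin> V)" if y: "y \<in> A" for y
    proof -
      have "S y 0 \<in> topspace (surf X)" "S y 0 \<noteq> x"
        using S[OF y] is_seg_fibre[of u "S y" 0] no by (auto simp: fibre_def)
      then obtain V W where VW: "openin (surf X) V" "openin (surf X) W" "x \<in> V" "S y 0 \<in> W" "disjnt V W"
        using Hausdorff_surf xt unfolding Hausdorff_space_def by metis
      have "openin (top_of_set {0..1}) {t \<in> topspace (top_of_set {0..1}). S y t \<in> W}"
        by (rule openin_continuous_map_preimage[OF _ VW(2)]) (use S[OF y] in \<open>simp add: is_seg_def\<close>)
      then obtain e where e: "e > 0" "ball 0 e \<inter> {0..1} \<subseteq> {t \<in> topspace (top_of_set {0..1}). S y t \<in> W}"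
        unfolding openin_contains_ball using VW(4) by (auto dest!: bspec[of _ _ 0])
      have "S y t \<notin> V" if "0 < t" "t < min e 1" for t
      proof -
        have "t \<in> ball 0 e \<inter> {0..1}" using that by auto
        then have "S y t \<in> W" using e(2) by blast
        then show ?thesis using VW(5) by (auto simp: disjnt_def)
      qed
      then show ?thesis using VW e(1) by (intro exI[of _ V] exI[of _ "min e 1"]) auto
    qed
    then obtain V b where Vb: "\<And>y. y \<in> A \<Longrightarrow> openin (surf X) (V y) \<and> x \<in> V y \<and> 0 < b y \<and> (\<forall>t. 0 < t \<and> t < b y \<longrightarrow> S y t \<notin> V y)" by metis
    define W where "W = (\<Inter>y\<in>A. V y) \<inter> topspace (surf X)"
    have W: "openin (surf X) W" "x \<in> W" unfolding W_def using Vb finA xt by (auto intro!: openin_INT)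
    obtain r where r: "r > 0" "torus_proj ` ball 0 r \<subseteq> \<rho> ` W" using open_at_fibre_0[OF x W] .
    \<comment> \<open>Before this time \<open>t * u\<close> stays in \<open>ball 0 r\<close> and
      each lift \<open>S y\<close> is outside its neighbourhood \<open>V y\<close>; the entry 1
      keeps \<open>t\<close> inside the segment.\<close>
    define \<beta> where "\<beta> = Min (insert 1 (insert (r / (norm u + 1)) (b ` A)))"
    have \<beta>: "\<beta> > 0" "\<beta> \<le> 1" "\<beta> \<le> r / (norm u + 1)" "\<And>y. y \<in> A \<Longrightarrow> \<beta> \<le> b y"
    proof -
      let ?B = "insert 1 (insert (r / (norm u + 1)) (b ` A))"
      have fin: "finite ?B" using finA by simp
      then have "\<beta> \<in> ?B" unfolding \<beta>_def by (intro Min_in) auto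
      then show "\<beta> > 0" using Vb r(1) by (auto simp: add_nonneg_pos)
      have "\<beta> \<le> x" if "x \<in> ?B" for x unfolding \<beta>_def using fin that by (rule Min_le)
      then show "\<beta> \<le> 1" "\<beta> \<le> r / (norm u + 1)" "\<And>y. y \<in> A \<Longrightarrow> \<beta> \<le> b y" by auto
    qed
    define t where "t = \<beta> / 2"
    have t: "0 < t" "t < \<beta>" using \<beta> by (auto simp: t_def)
    have "t < r / (norm u + 1)" using t \<beta>(3) by linarith
    then have "t * (norm u + 1) < r" by (simp add: pos_less_divide_eq add_nonneg_pos)
    then have "of_real t * u \<in> ball 0 r" using t by (simp add: norm_mult algebra_simps)
    then obtain w where w: "w \<in> W" "\<rho> w = torus_proj (of_real t * u)" using r(2) by (metis imageE image_subset_iff)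
    have "w \<in> fibre (of_real t * u)" using w by (auto simp: fibre_def W_def)
    moreover have t01: "t \<in> {0<..<1}" using t \<beta> by auto
    ultimately obtain L where L: "is_seg u L" "L t = w" using seg_exists[OF u] by blast
    have y: "L (1 / 2) \<in> A" using is_seg_fibre[OF L(1), of "1 / 2"] by (simp add: A_def)
    then have "L t = S (L (1 / 2)) t"
      using seg_unique[OF u L(1), of "S (L (1 / 2))" "1 / 2" t] S t01 by auto
    then have "w \<notin> V (L (1 / 2))" using Vb[OF y] t \<beta>(4)[OF y] L(2) by auto
    then show False using w(1) y by (auto simp: W_def)
  qed
  then show ?thesis using that by blast
qed

text \<open>Both lifts begin in a neighbourhood on which \<open>\<rho>\<close> is injective, so they
  agree at a small positive time, and \<open>seg_unique\<close> applies.\<close>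

lemma seg_start_inj:
  assumes u: "seg_dir u" and L: "is_seg u L" "is_seg u L'" and eq: "L 0 = L' 0" and reg: "L 0 \<notin> zeros X"
    and r: "r \<in> {0..1}"
  shows "L r = L' r"
proof -
  have "L 0 \<in> fibre 0" using is_seg_fibre[OF L(1), of 0] by simp
  then obtain V where V: "openin (surf X) V" "L 0 \<in> V" "inj_on \<rho> V" using inj_at_regular reg by blast
  have "\<exists>e>0. \<forall>t\<in>{0..1}. t < e \<longrightarrow> K t \<in> V" if K: "is_seg u K" "K 0 = L 0" for K
  proof -
    have "openin (top_of_set {0..1}) {t \<in> topspace (top_of_set {0..1}). K t \<in> V}"
      by (rule openin_continuous_map_preimage[OF _ V(1)]) (use K in \<open>simp add: is_seg_def\<close>)
    then obtain e where "e > 0" "ball 0 e \<inter> {0..1} \<subseteq> {t \<in> topspace (top_of_set {0..1}). K t \<in> V}"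
      unfolding openin_contains_ball using V(2) K(2) by (auto dest!: bspec[of _ _ 0])
    then show ?thesis by (intro exI[of _ e]) (auto simp: subset_iff)
  qed
  from this[OF L(1)] this[OF L(2)] obtain e e' where e: "e > 0" "e' > 0"
    "\<And>t. t \<in> {0..1} \<Longrightarrow> t < e \<Longrightarrow> L t \<in> V" "\<And>t. t \<in> {0..1} \<Longrightarrow> t < e' \<Longrightarrow> L' t \<in> V" using eq by metis
  define t where "t = min (min e e') 1 / 2"
  have t: "t \<in> {0<..<1}" "t < e" "t < e'" using e by (auto simp: t_def)
  then have "L t \<in> V" "L' t \<in> V" "\<rho> (L t) = \<rho> (L' t)" using e L by (auto simp: is_seg_def)
  then have "L t = L' t" using V(3) by (auto simp: inj_on_def)
  then show ?thesis using seg_unique[OF u L t(1) _ r] by blast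
qed

text \<open>Near time \<open>t\<close> the local inverse of \<open>torus_proj\<close> around
  \<open>t * v\<close>, composed with \<open>\<rho>\<close>, is a primitive that takes the value
  \<open>s * v\<close> at \<open>\<gamma> s\<close>.\<close>

lemma integral_along_segment:
  assumes "\<And>t. t \<in> {0..1} \<Longrightarrow> \<gamma> t \<in> topspace (surf X) \<and> \<rho> (\<gamma> t) = torus_proj (of_real t * v)"
  shows "integral_along X \<gamma> (\<lambda>t. of_real t * v)"
  unfolding integral_along_def
proof (intro conjI ballI)
  fix t :: real assume t: "t \<in> {0..1}"
  let ?z = "of_real t * v"
  let ?B = "ball ?z (1 / 2)"
  let ?F = "inv_into ?B torus_proj \<circ> \<rho>"
  \<comment> \<open>For \<open>\<bar>s - t\<bar>\<close> below this bound \<open>s * v\<close> stays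
    within \<open>1 / 2\<close> of \<open>t * v\<close>.\<close>
  let ?e = "1 / 2 / (norm v + 1)"
  have e: "?e > 0" by (simp add: add_nonneg_pos)
  have "\<gamma> s \<in> {x \<in> topspace (surf X). \<rho> x \<in> torus_proj ` ?B} \<and> ?F (\<gamma> s) = of_real s * v"
    if s: "s \<in> {0..1}" "\<bar>s - t\<bar> < ?e" for s
  proof -
    have "\<bar>t - s\<bar> * (norm v + 1) < 1 / 2" using s(2) pos_less_divide_eq[of "norm v + 1" "\<bar>t - s\<bar>" "1 / 2"]
      by (simp add: add_nonneg_pos abs_minus_commute del: divide_divide_eq_left)
    moreover have "\<bar>t - s\<bar> * norm v \<le> \<bar>t - s\<bar> * (norm v + 1)" by (intro mult_left_mono) auto
    ultimately have "\<bar>t - s\<bar> * norm v < 1 / 2" by linarith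
    moreover have "dist ?z (of_real s * v) = \<bar>t - s\<bar> * norm v"
      by (simp add: dist_norm norm_mult flip: left_diff_distrib of_real_diff)
    ultimately have "of_real s * v \<in> ?B" by simp
    then show ?thesis using assms[OF s(1)] inj_on_torus_proj_ball by auto
  qed
  moreover have "primitive_on X {x \<in> topspace (surf X). \<rho> x \<in> torus_proj ` ?B} ?F"
    by (intro primitive_pullback primitive_on_inv_torus_proj inj_on_torus_proj_ball) simp
  ultimately show "\<exists>W F e. primitive_on X W F \<and> 0 < e \<and> (\<forall>s\<in>{0..1}. \<bar>s - t\<bar> < e \<longrightarrow>
      \<gamma> s \<in> W \<and> F (\<gamma> s) - F (\<gamma> t) = of_real s * v - of_real t * v)"
    using e t by (intro exI[of _ "{x \<in> topspace (surf X). \<rho> x \<in> torus_proj ` ?B}"] exI[of _ ?F] exI[of _ ?e]) force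
qed simp

text \<open>Start at a singularity and follow consecutive lifts of the segment from \<open>0\<close> to \<open>u\<close>. There are
  finitely many of them, and at a regular point the incoming one is unique, so the first one to be
  repeated would have to start at the initial singularity.\<close>

lemma saddle_connection_exists:
  assumes u: "seg_dir u" and x0: "x0 \<in> singularities X" "x0 \<in> fibre 0" and sing: "singularities X \<subseteq> fibre 0"
  obtains k \<gamma> where "1 \<le> k" "k \<le> card (fibre (of_real (1 / 2) * u))" "saddle_connection X \<gamma> (of_nat k * u)"
proof -
  \<comment> \<open>A lift is determined by its midpoint, so the points over \<open>u / 2\<close>
    name the lifts and count them.\<close>
  define A where "A = fibre (of_real (1 / 2) * u)"
  have ug: "u \<in> gaussian_ints" using u by (simp add: seg_dir_def)
  have "\<exists>L. is_seg u L \<and> L (1 / 2) = y" if "y \<in> A" for y using seg_exists[OF u, of "1 / 2" y] that unfolding A_def by auto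
  then obtain S where S: "\<And>y. y \<in> A \<Longrightarrow> is_seg u (S y)" "\<And>y. y \<in> A \<Longrightarrow> S y (1 / 2) = y" by metis
  have inA: "L (1 / 2) \<in> A" if "is_seg u L" for L using is_seg_fibre[OF that, of "1 / 2"] by (simp add: A_def)
  have "fibre 0 \<subseteq> (\<lambda>y. S y 0) ` A"
  proof
    fix x assume "x \<in> fibre 0"
    then obtain L where L: "is_seg u L" "L 0 = x" using seg_start_surj[OF u] by blast
    then have "S (L (1 / 2)) 0 = x" using seg_unique[OF u S(1)[OF inA[OF L(1)]] L(1), of "1 / 2" 0] S(2)[OF inA[OF L(1)]] by auto
    then show "x \<in> (\<lambda>y. S y 0) ` A" using inA[OF L(1)] by blast
  qed
  moreover have "(\<lambda>y. S y 1) ` A \<subseteq> fibre 0" using S is_seg_ends ug by blast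
  moreover have "a = b" if ab: "a \<in> A" "b \<in> A" "S a 1 = S b 1" "S a 1 \<notin> singularities X" for a b
  proof -
    \<comment> \<open>Reversed, both lifts start at the same regular point in direction
      \<open>- u\<close>, hence agree at their midpoints.\<close>
    have "S a (1 - 1 / 2) = S b (1 - 1 / 2)"
      using seg_start_inj[OF seg_dir_minus[OF u] is_seg_reverse[OF S(1)[OF ab(1)] ug] is_seg_reverse[OF S(1)[OF ab(2)] ug], of "1 / 2"] ab
      by (auto simp: singularities_def)
    then show ?thesis using S(2)[OF ab(1)] S(2)[OF ab(2)] by simp
  qed
  moreover have "finite A" unfolding A_def by (rule finite_fibre)
  ultimately obtain k f where k: "1 \<le> k" "k \<le> card A" and fA: "\<And>i. f i \<in> A" and fS: "\<And>i. S (f (Suc i)) 0 = S (f i) 1"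
    and ends: "S (f 0) 0 \<in> singularities X" "S (f (k - 1)) 1 \<in> singularities X"
    and mid: "\<And>i. Suc i < k \<Longrightarrow> S (f i) 1 \<notin> singularities X"
    using chain_between_marked_points[of A "fibre 0" "\<lambda>y. S y 0" "\<lambda>y. S y 1" x0 "singularities X"] x0 by metis
  \<comment> \<open>The \<open>k\<close> lifts are concatenated with one unit of time each;
    neighbours match at the integers by \<open>fS\<close>.\<close>
  let ?X = "top_of_set {0..real k}"
  let ?T = "\<lambda>i. {real i..real i + 1}"
  have seg: "is_seg u (S (f i))" for i using S fA by blast
  obtain g where g: "continuous_map ?X (surf X) g"
    "\<And>x i. i \<in> {..<k} \<Longrightarrow> x \<in> topspace ?X \<inter> ?T i \<Longrightarrow> g x = S (f i) (x - real i)"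
  proof (rule pasting_lemma_exists_closed[where I = "{..<k}" and X = ?X and T = ?T and Y = "surf X" and f = "\<lambda>i x. S (f i) (x - real i)"])
    show "topspace ?X \<subseteq> \<Union> (?T ` {..<k})"
    proof
      fix x assume x: "x \<in> topspace ?X"
      show "x \<in> \<Union> (?T ` {..<k})"
      proof (cases "x = real k")
        case True
        then have "x \<in> ?T (k - 1)" using k by auto
        then show ?thesis using k by (intro UN_I[of "k - 1"]) auto
      next
        case False
        then have "nat \<lfloor>x\<rfloor> < k" "x \<in> ?T (nat \<lfloor>x\<rfloor>)" using x by (auto simp: floor_less_iff nat_less_iff)
        then show ?thesis by blast
      qed
    qed
    fix i assume i: "i \<in> {..<k}"
    show "closedin ?X (?T i)" using i by (intro closed_subset) auto
    have "subtopology ?X (?T i) = top_of_set (?T i)"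
      using i by (auto simp: subtopology_subtopology intro!: arg_cong[of _ _ top_of_set])
    moreover have "continuous_map (top_of_set (?T i)) (top_of_set {0..1}) (\<lambda>x. x - real i)"
      by (auto intro!: continuous_intros)
    from continuous_map_compose[OF this] have "continuous_map (top_of_set (?T i)) (surf X) (\<lambda>x. S (f i) (x - real i))"
      using seg[of i] by (auto simp: is_seg_def comp_def)
    ultimately show "continuous_map (subtopology ?X (?T i)) (surf X) (\<lambda>x. S (f i) (x - real i))" by simp
  next
    have le: "S (f i) (x - real i) = S (f j) (x - real j)" if "x \<in> ?T i" "x \<in> ?T j" "i < j" for i j x
    proof -
      have "j = Suc i" "x = real i + 1" using that by auto
      then show ?thesis using fS[of i] by simp
    qed
    fix i j x assume *: "i \<in> {..<k}" "j \<in> {..<k}" "x \<in> topspace ?X \<inter> ?T i \<inter> ?T j"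
    consider "i < j" | "i = j" | "j < i" by linarith
    then show "S (f i) (x - real i) = S (f j) (x - real j)"
    proof cases
      case 1 then show ?thesis using le[of x i j] * by blast
    next
      case 3 then show ?thesis using le[of x j i] * by (metis IntD1 IntD2)
    qed simp
  qed auto
  have g_at: "g (real i + t) = S (f i) t" if "i < k" "t \<in> {0..1}" for i t
    using g(2)[of i "real i + t"] that by auto
  have split: "\<exists>i t. i < k \<and> t \<in> {0..<1} \<and> x = real i + t" if "0 \<le> x" "x < real k" for x
  proof (intro exI conjI)
    show "nat \<lfloor>x\<rfloor> < k" using that by (auto simp: floor_less_iff nat_less_iff)
    show "frac x \<in> {0..<1}" by (auto simp: frac_lt_1)
    show "x = real (nat \<lfloor>x\<rfloor>) + frac x" using that by (simp add: frac_def)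
  qed
  have g_end: "g (real k) = S (f (k - 1)) 1" using g_at[of "k - 1" 1] k by (simp add: of_nat_diff)
  have \<rho>g: "\<rho> (g x) = torus_proj (of_real x * u)" if x: "x \<in> {0..real k}" for x
  proof (cases "x = real k")
    case True
    have "S (f (k - 1)) 1 \<in> fibre 0" using is_seg_ends[OF seg ug] by blast
    then show ?thesis using True g_end gaussian_ints_closed_ops(5)[OF ug, of k]
      by (simp add: fibre_def torus_proj_eq_0_iff[THEN iffD2])
  next
    case False
    then obtain i t where it: "i < k" "t \<in> {0..<1}" "x = real i + t" using split[of x] x by auto
    then have "\<rho> (g x) = torus_proj (of_real t * u)" using g_at[of i t] seg[of i] by (auto simp: is_seg_def)
    also have "\<dots> = torus_proj (of_real x * u)" unfolding it torus_proj_eq_iff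
      using gaussian_ints_closed_ops(2)[OF gaussian_ints_closed_ops(5)[OF ug, of i]] by (simp add: algebra_simps)
    finally show ?thesis .
  qed
  define \<gamma> where "\<gamma> t = g (real k * t)" for t
  have kt: "real k * t \<in> {0..real k}" if "t \<in> {0..1}" for t using that by (auto simp: mult_left_le)
  have "continuous_map (top_of_set {0..1}) ?X (\<lambda>t. real k * t)"
    using kt by (auto intro!: continuous_intros)
  from continuous_map_compose[OF this g(1)] have path: "pathin (surf X) \<gamma>" by (simp add: pathin_def \<gamma>_def[abs_def] comp_def)
  have "saddle_connection X \<gamma> (of_nat k * u)"
    unfolding saddle_connection_def
  proof (intro conjI ballI)
    have "u \<noteq> 0"
    proof
      assume "u = 0"
      then have "of_real (1 / 2) * u \<in> gaussian_ints" using gaussian_ints_closed_ops(1) by simp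
      moreover have "of_real (1 / 2) * u \<notin> gaussian_ints" using u unfolding seg_dir_def by fastforce
      ultimately show False by blast
    qed
    then show "of_nat k * u \<noteq> 0" using k by simp
    show "pathin (surf X) \<gamma>" by (rule path)
    show "\<gamma> 0 \<in> singularities X" using g_at[of 0 0] k ends(1) by (simp add: \<gamma>_def)
    show "\<gamma> 1 \<in> singularities X" using g_end ends(2) by (simp add: \<gamma>_def)
  next
    fix t :: real assume t: "t \<in> {0<..<1}"
    then have "0 < real k * t" "real k * t < real k" using k by auto
    then obtain i s where idx: "i < k" "s \<in> {0..<1}" "real k * t = real i + s" using split[of "real k * t"] by auto
    \<comment> \<open>At integer times the path is at a junction, which the chain keeps regular; at
      other times it is not over the lattice, since \<open>u\<close> is primitive.\<close>
    show "\<gamma> t \<notin> singularities X"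
    proof (cases "s = 0")
      case True
      then have "i > 0" using idx t k by (cases i) auto
      then obtain j where j: "i = Suc j" by (cases i) auto
      have "\<gamma> t = S (f j) 1" using g_at[of i 0] idx True fS[of j] j by (simp add: \<gamma>_def)
      then show ?thesis using mid[of j] idx(1) j by simp
    next
      case False
      then have "s \<in> {0<..<1}" using idx by auto
      then have "of_real s * u \<notin> gaussian_ints" using u by (simp add: seg_dir_def)
      moreover have "\<gamma> t = S (f i) s" using g_at[of i s] idx by (auto simp: \<gamma>_def)
      moreover have "\<rho> (S (f i) s) = torus_proj (of_real s * u)" using seg[of i] idx by (auto simp: is_seg_def)
      ultimately have "\<gamma> t \<notin> fibre 0" by (simp add: fibre_def torus_proj_eq_0_iff)
      then show ?thesis using sing by blast
    qed
  next
    show "integral_along X \<gamma> (\<lambda>t. of_real t * (of_nat k * u))"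
    proof (rule integral_along_segment)
      fix t :: real assume t: "t \<in> {0..1}"
      have "\<rho> (\<gamma> t) = torus_proj (of_real (real k * t) * u)" unfolding \<gamma>_def by (rule \<rho>g[OF kt[OF t]])
      moreover have "\<gamma> t \<in> topspace (surf X)" using path t by (auto simp: pathin_def continuous_map_def)
      ultimately show "\<gamma> t \<in> topspace (surf X) \<and> \<rho> (\<gamma> t) = torus_proj (of_real t * (of_nat k * u))" by (simp add: algebra_simps)
    qed
  qed
  then show ?thesis using that k unfolding A_def by blast
qed

end

section \<open>Area\<close>

text \<open>Transports Lebesgue measure from \<open>real^2\<close> to the complex plane, so that its
  invariance under orthogonal transformations can be used for rotations.\<close>

lemma distr_lborel_complex_of_vec:
  "distr lborel borel (\<lambda>v :: real^2. Complex (v $ 1) (v $ 2)) = lborel"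
proof (rule sym, rule lborel_eqI)
  have B: "(Basis :: (real^2) set) = {axis 1 1, axis 2 1}"
    unfolding Basis_vec_def by (auto simp: UNIV_2)
  have ne: "(axis 1 1 :: real^2) \<noteq> axis 2 1" by (simp add: axis_eq_axis)
  have meas: "(\<lambda>v :: real^2. Complex (v $ 1) (v $ 2)) \<in> borel_measurable lborel"
    unfolding Complex_eq measurable_lborel2 by (intro borel_measurable_continuous_onI continuous_intros)
  fix l u :: complex assume le: "\<And>b. b \<in> Basis \<Longrightarrow> l \<bullet> b \<le> u \<bullet> b"
  let ?l = "vector [Re l, Im l] :: real^2" and ?u = "vector [Re u, Im u] :: real^2"
  have vim: "(\<lambda>v :: real^2. Complex (v $ 1) (v $ 2)) -` box l u = box ?l ?u"
    by (auto simp: in_box_complex_iff mem_box_cart forall_2)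
  have le': "Re l \<le> Re u" "Im l \<le> Im u" using le[of 1] le[of \<i>] by (auto simp: Basis_complex_def)
  have "emeasure (distr lborel borel (\<lambda>v :: real^2. Complex (v $ 1) (v $ 2))) (box l u) = emeasure lborel (box ?l ?u)"
    using meas by (subst emeasure_distr) (auto simp: vim)
  also have "\<dots> = (\<Prod>b\<in>Basis. (?u - ?l) \<bullet> b)"
    by (rule emeasure_lborel_box) (auto simp: B inner_axis le')
  also have "(\<Prod>b\<in>Basis. (?u - ?l) \<bullet> b) = (\<Prod>b\<in>Basis. (u - l) \<bullet> b)"
    using ne by (simp add: B inner_axis Basis_complex_def inner_complex_def)
  finally show "emeasure (distr lborel borel (\<lambda>v :: real^2. Complex (v $ 1) (v $ 2))) (box l u) = ennreal (\<Prod>b\<in>Basis. (u - l) \<bullet> b)" .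
qed simp

lemma emeasure_lborel_complex_vec:
  assumes "A \<in> sets borel"
  shows "emeasure lborel ((\<lambda>v :: real^2. Complex (v $ 1) (v $ 2)) -` A) = emeasure lborel A"
proof -
  have meas: "(\<lambda>v :: real^2. Complex (v $ 1) (v $ 2)) \<in> borel_measurable lborel"
    unfolding Complex_eq measurable_lborel2 by (intro borel_measurable_continuous_onI continuous_intros)
  have "emeasure lborel A = emeasure (distr lborel borel (\<lambda>v :: real^2. Complex (v $ 1) (v $ 2))) A"
    by (simp add: distr_lborel_complex_of_vec)
  also have "\<dots> = emeasure lborel ((\<lambda>v :: real^2. Complex (v $ 1) (v $ 2)) -` A)"
    using meas assms by (subst emeasure_distr) auto
  finally show ?thesis by simp
qed

text \<open>Lebesgue measure is determined by boxes, and the preimage of a box here is its image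
  under multiplication by \<open>c\<close>, which in real coordinates is the orthogonal map
  \<open>R\<close>.\<close>

lemma distr_lborel_rotation:
  fixes c :: complex
  assumes c: "norm c = 1"
  shows "distr lborel borel (\<lambda>z. cnj c * z) = lborel"
proof (rule sym, rule lborel_eqI)
  define h :: "real^2 \<Rightarrow> complex" where "h v = Complex (v $ 1) (v $ 2)" for v
  define k :: "complex \<Rightarrow> real^2" where "k z = vector [Re z, Im z]" for z
  define R where "R v = k (c * h v)" for v
  have hk: "h (k z) = z" "k (h v) = v" for z v by (auto simp: h_def k_def vec_eq_iff forall_2 complex_eq_iff)
  have hl: "h (x + y) = h x + h y" "h (r *\<^sub>R x) = of_real r * h x" for x y r by (auto simp: h_def complex_eq_iff)
  have kl: "k (x + y) = k x + k y" "k (of_real r * x) = r *\<^sub>R k x" for x y r by (auto simp: k_def vec_eq_iff forall_2)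
  have kn: "norm (k z) = norm z" for z by (simp add: k_def norm_vec_def L2_set_def UNIV_2 cmod_def)
  have hn: "norm (h v) = norm v" for v using kn[of "h v"] by (simp add: hk)
  have "orthogonal_transformation R"
    unfolding orthogonal_transformation
  proof (intro conjI allI)
    show "linear R" by (rule linearI) (auto simp: R_def hl kl distrib_left mult.left_commute[of c])
    show "norm (R v) = norm v" for v using c by (simp add: R_def kn norm_mult hn)
  qed
  have meas: "(\<lambda>z. cnj c * z) \<in> borel_measurable lborel"
    unfolding measurable_lborel2 by (intro borel_measurable_continuous_onI continuous_intros)
  have cc: "c * (cnj c * z) = z" "cnj c * (c * z) = z" for z
    using c complex_norm_square[of c] by (simp_all add: mult.assoc[symmetric] mult.commute)
  have hc: "continuous_on UNIV h" unfolding h_def[abs_def] Complex_eq by (intro continuous_intros)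
  fix l u :: complex assume le: "\<And>b. b \<in> Basis \<Longrightarrow> l \<bullet> b \<le> u \<bullet> b"
  let ?V = "(\<lambda>z. cnj c * z) -` box l u"
  have oV: "open ?V" by (intro open_vimage open_box continuous_intros)
  have vb: "h -` box l u = box (k l) (k u)"
    by (auto simp: h_def k_def in_box_complex_iff mem_box_cart forall_2)
  have img: "h -` ?V = R ` (h -` box l u)"
  proof (intro equalityI subsetI)
    fix v assume "v \<in> h -` ?V"
    then have "k (cnj c * h v) \<in> h -` box l u" by (simp add: hk)
    moreover have "R (k (cnj c * h v)) = v" by (simp add: R_def hk cc)
    ultimately show "v \<in> R ` (h -` box l u)" by (metis imageI)
  qed (auto simp: R_def hk cc)
  have m1: "h -` box l u \<in> lmeasurable" unfolding vb by simp
  have m2: "R ` (h -` box l u) \<in> lmeasurable"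
    by (rule measurable_orthogonal_image[OF \<open>orthogonal_transformation R\<close> m1])
  have o2: "open (h -` ?V)" by (rule open_vimage[OF oV hc])
  have "emeasure (distr lborel borel (\<lambda>z. cnj c * z)) (box l u) = emeasure lborel ?V"
    using meas by (subst emeasure_distr) auto
  also have "\<dots> = emeasure lborel (h -` ?V)"
    unfolding h_def[abs_def] using oV by (intro emeasure_lborel_complex_vec[symmetric]) auto
  also have "\<dots> = emeasure lebesgue (h -` ?V)" using o2 by simp
  also have "\<dots> = measure lebesgue (R ` (h -` box l u))" unfolding img using m2 by (rule emeasure_eq_measure2)
  also have "\<dots> = measure lebesgue (h -` box l u)"
    using measure_orthogonal_image[OF \<open>orthogonal_transformation R\<close> m1] by simp
  also have "\<dots> = emeasure lebesgue (h -` box l u)" using emeasure_eq_measure2[OF m1] by simp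
  also have "\<dots> = emeasure lborel (h -` box l u)" unfolding vb by simp
  also have "\<dots> = emeasure lborel (box l u)" unfolding h_def[abs_def] by (intro emeasure_lborel_complex_vec) auto
  also have "\<dots> = (\<Prod>b\<in>Basis. (u - l) \<bullet> b)" by (rule emeasure_lborel_box[OF le])
  finally show "emeasure (distr lborel borel (\<lambda>z. cnj c * z)) (box l u) = ennreal (\<Prod>b\<in>Basis. (u - l) \<bullet> b)" .
qed simp

lemma rotation_translation_image:
  fixes c w :: complex
  assumes c: "norm c = 1" and A: "A \<in> sets borel"
  shows "(\<lambda>z. c * z + w) ` A \<in> sets borel" and "emeasure lborel ((\<lambda>z. c * z + w) ` A) = emeasure lborel A"
proof -
  have cc: "c * (cnj c * z) = z" "cnj c * (c * z) = z" for z
    using c complex_norm_square[of c] by (simp_all add: mult.assoc[symmetric] mult.commute)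
  have eq: "(\<lambda>z. c * z + w) ` A = (\<lambda>z. z - w) -` ((\<lambda>z. cnj c * z) -` A)"
  proof (intro equalityI subsetI)
    fix z assume "z \<in> (\<lambda>z. z - w) -` ((\<lambda>z. cnj c * z) -` A)"
    then have "cnj c * (z - w) \<in> A" "z = c * (cnj c * (z - w)) + w" by (auto simp: cc)
    then show "z \<in> (\<lambda>z. c * z + w) ` A" by blast
  qed (auto simp: cc)
  have m1: "(\<lambda>z. cnj c * z) \<in> borel_measurable borel" by (intro borel_measurable_continuous_onI continuous_intros)
  have m2: "(\<lambda>z. z - w) \<in> borel_measurable borel" by (intro borel_measurable_continuous_onI continuous_intros)
  have b1: "(\<lambda>z. cnj c * z) -` A \<in> sets borel" using measurable_sets[OF m1 A] by simp
  have b2: "(\<lambda>z. z - w) -` ((\<lambda>z. cnj c * z) -` A) \<in> sets borel" using measurable_sets[OF m2 b1] by simp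
  then show "(\<lambda>z. c * z + w) ` A \<in> sets borel" unfolding eq .
  have "distr lborel borel ((+) (- w)) = (lborel :: complex measure)" by (rule lborel_distr_plus)
  then have t: "distr lborel borel (\<lambda>z. z - w) = (lborel :: complex measure)" by (simp add: fun_eq_iff[THEN iffD2, of "(+) (- w)" "\<lambda>z. z - w"])
  have "emeasure lborel ((\<lambda>z. c * z + w) ` A) = emeasure (distr lborel borel (\<lambda>z. z - w)) ((\<lambda>z. cnj c * z) -` A)"
    unfolding eq using m2 b1 by (subst emeasure_distr) auto
  also have "\<dots> = emeasure (distr lborel borel (\<lambda>z. cnj c * z)) A"
    unfolding t using m1 A by (subst emeasure_distr) auto
  also have "\<dots> = emeasure lborel A" by (simp add: distr_lborel_rotation[OF c])
  finally show "emeasure lborel ((\<lambda>z. c * z + w) ` A) = emeasure lborel A" .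
qed

text \<open>On each component of \<open>A\<close> such an \<open>f\<close> is a rotation followed by a translation.\<close>

lemma local_isometry_image:
  fixes f :: "complex \<Rightarrow> complex"
  assumes A: "open A" and f: "\<And>z. z \<in> A \<Longrightarrow> (f has_field_derivative c) (at z)" and c: "norm c = 1"
    and inj: "inj_on f A" and S: "S \<in> sets borel" "S \<subseteq> A"
  shows "f ` S \<in> sets borel" and "emeasure lborel (f ` S) = emeasure lborel S"
proof -
  \<comment> \<open>On \<open>P w\<close> the translation part of \<open>f\<close> is
    \<open>w\<close>. As \<open>z \<mapsto> f z - c * z\<close> is locally constant, these sets are
    open; being disjoint, only countably many are nonempty, and additivity over them finishes the
    argument.\<close>
  define P where "P w = {z \<in> A. f z - c * z = w}" for w
  define I where "I = (\<lambda>z. f z - c * z) ` A"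
  have oP: "open (P w)" for w
  proof (subst open_subopen, intro ballI)
    fix z assume z: "z \<in> P w"
    then obtain e where e: "e > 0" "ball z e \<subseteq> A" using A by (auto simp: P_def open_contains_ball)
    have "((\<lambda>z. f z - c * z) has_field_derivative 0) (at x within ball z e)" if "x \<in> ball z e" for x
    proof -
      have "(f has_field_derivative c) (at x)" using f e that by auto
      then have "((\<lambda>z. f z - c * z) has_field_derivative c - c * 1) (at x)" by (auto intro!: derivative_eq_intros)
      then show ?thesis by (simp add: has_field_derivative_at_within)
    qed
    then obtain d where d: "\<And>x. x \<in> ball z e \<Longrightarrow> f x - c * x = d"
      using has_field_derivative_zero_constant[of "ball z e" "\<lambda>z. f z - c * z"] by auto
    have "ball z e \<subseteq> P w"
    proof
      fix x assume x: "x \<in> ball z e"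
      have "z \<in> ball z e" using e by simp
      then have "f x - c * x = f z - c * z" using d x by metis
      then show "x \<in> P w" using x z e by (auto simp: P_def)
    qed
    then show "\<exists>T. open T \<and> z \<in> T \<and> T \<subseteq> P w" using e by (intro exI[of _ "ball z e"]) auto
  qed
  have "countable (P ` I)"
    by (rule countable_disjoint_open_subsets) (use oP in \<open>auto simp: pairwise_def disjnt_def P_def\<close>)
  moreover have "inj_on P I" by (rule inj_onI) (force simp: P_def I_def)
  ultimately have countI: "countable I" by (metis countable_image_inj_on)
  have SP: "S \<inter> P w \<in> sets borel" for w using S oP by auto
  have fSP: "f ` (S \<inter> P w) = (\<lambda>z. c * z + w) ` (S \<inter> P w)" for w
  proof (rule image_cong[OF refl])
    fix z assume "z \<in> S \<inter> P w"
    then have "f z - c * z = w" by (simp add: P_def)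
    then show "f z = c * z + w" by (metis add.commute diff_add_cancel)
  qed
  have meas: "f ` (S \<inter> P w) \<in> sets borel" for w unfolding fSP by (rule rotation_translation_image[OF c SP])
  have emeas: "emeasure lborel (f ` (S \<inter> P w)) = emeasure lborel (S \<inter> P w)" for w
    unfolding fSP by (rule rotation_translation_image[OF c SP])
  have Seq: "S = (\<Union>w\<in>I. S \<inter> P w)" using S(2) by (auto simp: I_def P_def)
  then have fS: "f ` S = (\<Union>w\<in>I. f ` (S \<inter> P w))" by blast
  show "f ` S \<in> sets borel" unfolding fS using countI meas by (intro sets.countable_UN'') auto
  have disj: "disjoint_family_on (\<lambda>w. S \<inter> P w) I" by (auto simp: disjoint_family_on_def P_def)
  have disjf: "disjoint_family_on (\<lambda>w. f ` (S \<inter> P w)) I"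
    unfolding disjoint_family_on_def
  proof (intro ballI impI)
    fix w v assume "w \<in> I" "v \<in> I" "w \<noteq> v"
    show "f ` (S \<inter> P w) \<inter> f ` (S \<inter> P v) = {}"
    proof (rule ccontr)
      assume "\<not> ?thesis"
      then obtain x y where "x \<in> P w" "y \<in> P v" "f x = f y" by blast
      moreover from this have "x = y" using inj by (auto simp: inj_on_def P_def)
      ultimately show False using \<open>w \<noteq> v\<close> by (simp add: P_def)
    qed
  qed
  have "emeasure lborel (f ` S) = (\<integral>\<^sup>+w. emeasure lborel (f ` (S \<inter> P w)) \<partial>count_space I)"
    unfolding fS using meas countI disjf by (intro emeasure_UN_countable) auto
  also have "\<dots> = (\<integral>\<^sup>+w. emeasure lborel (S \<inter> P w) \<partial>count_space I)" by (simp add: emeas)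
  also have "\<dots> = emeasure lborel (\<Union>w\<in>I. S \<inter> P w)"
    using SP countI disj by (intro emeasure_UN_countable[symmetric]) auto
  finally show "emeasure lborel (f ` S) = emeasure lborel S" using Seq by simp
qed

lemma null_sets_coordinate_line:
  "{z. Re z = r} \<in> null_sets lborel" "{z. Im z = r} \<in> null_sets lborel"
proof -
  have "negligible {z :: complex. 1 \<bullet> z = r}" "negligible {z :: complex. \<i> \<bullet> z = r}"
    by (rule negligible_hyperplane, simp)+
  moreover have "closed {z. Re z = r}" "closed {z. Im z = r}"
    by (auto intro!: closed_Collect_eq continuous_intros)
  ultimately show "{z. Re z = r} \<in> null_sets lborel" "{z. Im z = r} \<in> null_sets lborel"
    unfolding negligible_iff_null_sets using null_sets_completion_iff[of _ "lborel :: complex measure"]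
    by (auto simp: inner_complex_def)
qed

lemma unit_square_diff_gaussian:
  assumes "z \<in> box 0 (Complex 1 1)" "w \<in> box 0 (Complex 1 1)" "z - w \<in> gaussian_ints"
  shows "z = w"
proof -
  have int0: "r = 0" if "r \<in> \<int>" "\<bar>r\<bar> < 1" for r :: real using that by (auto elim!: Ints_cases)
  have "Re (z - w) \<in> \<int>" "Im (z - w) \<in> \<int>" "\<bar>Re (z - w)\<bar> < 1" "\<bar>Im (z - w)\<bar> < 1"
    using assms by (auto simp: gaussian_ints_iff in_box_complex_iff abs_if)
  then have "Re (z - w) = 0" "Im (z - w) = 0" using int0 by blast+
  then show ?thesis by (simp add: complex_eq_iff)
qed

lemma inj_on_torus_proj_unit_square: "inj_on torus_proj (box 0 (Complex 1 1))"
  using unit_square_diff_gaussian by (auto simp: inj_on_def torus_proj_eq_iff)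

lemma emeasure_unit_square: "emeasure lborel (box 0 (Complex 1 1)) = 1"
  by (subst emeasure_lborel_box) (auto simp: Basis_complex_def)

section \<open>Sections over translated squares\<close>

context flat_cover
begin

abbreviation centre :: complex where "centre \<equiv> Complex (1 / 2) (1 / 2)"

lemma centre_in: "centre \<in> unit_square" by (simp add: in_box_complex_iff)

text \<open>Selects the translates of the open unit square that miss the lattice, so that the
  covering has sections over them. The shift 0 gives the cells; shifts by half a side give squares
  straddling the edges.\<close>

definition shift_ok :: "complex \<Rightarrow> bool" where
  "shift_ok b \<longleftrightarrow> (\<forall>z\<in>unit_square. z + b \<notin> gaussian_ints)"

abbreviation shift_proj :: "complex \<Rightarrow> complex \<Rightarrow> complex set" where
  "shift_proj b \<equiv> \<lambda>z. torus_proj (z + b)"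

lemma shift_ok_off: "shift_ok b \<Longrightarrow> z \<in> unit_square \<Longrightarrow> shift_proj b z \<notin> {torus_proj 0}"
  by (auto simp: shift_ok_def torus_proj_eq_0_iff)

lemma no_int_between: "0 < r \<Longrightarrow> r < 1 \<Longrightarrow> (r :: real) \<notin> \<int>"
  by (auto elim!: Ints_cases)

lemma shift_ok_I:
  assumes "Re b = 0 \<or> Im b = 0"
  shows "shift_ok b"
  using assms no_int_between by (auto simp: shift_ok_def gaussian_ints_iff in_box_complex_iff)

text \<open>The choice is immaterial on the square, where a lift is determined by its value at the
  centre.\<close>

definition sect :: "complex \<Rightarrow> 'a \<Rightarrow> complex \<Rightarrow> 'a" where
  "sect b y = (SOME s. is_lift (shift_proj b) unit_square s \<and> s centre = y)"

lemma lift_through: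
  assumes b: "shift_ok b" and z: "z \<in> unit_square" and x: "x \<in> fibre (z + b)"
  obtains s where "is_lift (shift_proj b) unit_square s" "s z = x"
proof -
  have "liftable (shift_proj b) unit_square"
    by (rule liftable_unit_square) (intro continuous_torus_proj_comp continuous_intros, rule shift_ok_off[OF b])
  then show ?thesis using z x that unfolding liftable_def fibre_def by blast
qed

lemma sect:
  assumes "shift_ok b" "y \<in> fibre (centre + b)"
  shows "is_lift (shift_proj b) unit_square (sect b y)" "sect b y centre = y"
proof -
  obtain s where "is_lift (shift_proj b) unit_square s \<and> s centre = y"
    using lift_through[OF assms(1) centre_in assms(2)] by blast
  then show "is_lift (shift_proj b) unit_square (sect b y)" "sect b y centre = y"
    unfolding sect_def by (metis (mono_tags, lifting) someI_ex)+
qed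

lemma lift_fibre: "is_lift (shift_proj b) unit_square s \<Longrightarrow> z \<in> unit_square \<Longrightarrow> s z \<in> fibre (z + b)"
  using is_lift_in by (auto simp: is_lift_def fibre_def)

text \<open>A common value forces equal projections, and no two points of a translated open unit
  square are congruent modulo the lattice. So the value is taken at one and the same point, and
  uniqueness of lifts applies.\<close>

lemma lift_eq:
  assumes "shift_ok b" "is_lift (shift_proj b) unit_square s" "is_lift (shift_proj b) unit_square t"
    "z \<in> unit_square" "w \<in> unit_square" "s z = t w" "v \<in> unit_square"
  shows "z = w" "s v = t v"
proof -
  have "torus_proj (z + b) = torus_proj (w + b)" using assms by (auto simp: is_lift_def)
  then show zw: "z = w" using unit_square_diff_gaussian assms by (auto simp: torus_proj_eq_iff)
  show "s v = t v"
    using lift_unique[OF convex_connected[OF convex_box(2)] assms(2,3) shift_ok_off[OF assms(1)] assms(4) _ assms(7)] assms(6) zw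
    by simp
qed

lemma sect_cover:
  assumes b: "shift_ok b" and z: "z \<in> unit_square" and x: "x \<in> fibre (z + b)"
  obtains y where "y \<in> fibre (centre + b)" "sect b y z = x"
proof -
  obtain s where s: "is_lift (shift_proj b) unit_square s" "s z = x" using lift_through[OF assms] .
  have y: "s centre \<in> fibre (centre + b)" using lift_fibre[OF s(1) centre_in] .
  have "sect b (s centre) z = x"
    using lift_eq(2)[OF b sect(1)[OF b y] s(1) centre_in centre_in _ z] sect(2)[OF b y] s(2) by simp
  then show ?thesis using that y by blast
qed

lemma lift_preimage_open:
  assumes "is_lift (shift_proj b) unit_square s" "openin (surf X) U"
  shows "open {z \<in> unit_square. s z \<in> U}"
proof -
  have "openin (top_of_set unit_square) {z \<in> topspace (top_of_set unit_square). s z \<in> U}"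
    by (rule openin_continuous_map_preimage[OF _ assms(2)]) (use assms(1) in \<open>simp add: is_lift_def\<close>)
  then show ?thesis by (simp add: openin_open_eq open_box)
qed

text \<open>On a sheet around \<open>s z\<close> a point is determined by its projection, so the
  points of the sheet over a small ball are values of \<open>s\<close>.\<close>

lemma lift_image_open:
  assumes b: "shift_ok b" and s: "is_lift (shift_proj b) unit_square s"
  shows "openin (surf X) (s ` unit_square)"
proof (subst openin_subopen, intro ballI)
  fix x assume "x \<in> s ` unit_square"
  then obtain z where z: "z \<in> unit_square" "x = s z" by blast
  have x: "x \<in> topspace (surf X)" "\<rho> x \<notin> {torus_proj 0}"
    using lift_fibre[OF s z(1)] shift_ok_off[OF b z(1)] z(2) by (auto simp: fibre_def)
  obtain U where U: "openin (surf X) U" "x \<in> U" "inj_on \<rho> U" using local_sheet[OF x] by metis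
  obtain r where r: "r > 0" "ball z r \<subseteq> {z \<in> unit_square. s z \<in> U}"
    using lift_preimage_open[OF s U(1)] z U(2) by (metis (mono_tags, lifting) mem_Collect_eq open_contains_ball)
  let ?T = "U \<inter> {x \<in> topspace (surf X). \<rho> x \<in> torus_proj ` ball (z + b) r}"
  have "openin (surf X) ?T" using U(1) openin_ball_preimage by blast
  moreover have "x \<in> ?T" using U(2) x(1) lift_fibre[OF s z(1)] z(2) r(1) by (auto simp: fibre_def)
  moreover have "?T \<subseteq> s ` unit_square"
  proof
    fix v assume v: "v \<in> ?T"
    then obtain w where w: "w \<in> ball (z + b) r" "\<rho> v = torus_proj w" by auto
    have "w - b \<in> ball z r" using w(1) by (simp add: dist_norm algebra_simps)
    then have wb: "w - b \<in> unit_square" "s (w - b) \<in> U" using r(2) by auto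
    have "\<rho> (s (w - b)) = \<rho> v" using s wb(1) w(2) by (simp add: is_lift_def)
    then have "s (w - b) = v" using U(3) v wb(2) by (auto simp: inj_on_def)
    then show "v \<in> s ` unit_square" using wb(1) by blast
  qed
  ultimately show "\<exists>T. openin (surf X) T \<and> x \<in> T \<and> T \<subseteq> s ` unit_square" by blast
qed

text \<open>In the local coordinate \<open>G (\<phi> (s z)) = z + b\<close>, so
  \<open>\<phi> \<circ> s\<close> inverts a translate of \<open>G\<close> and its derivative is the
  reciprocal of the form. The primitive contributes \<open>cis \<theta>\<close> times the form, and
  the form cancels; it is nonzero because the shifted square misses the lattice.\<close>

lemma lift_derivative:
  assumes b: "shift_ok b" and s: "is_lift (shift_proj b) unit_square s"
    and F: "primitive_on (rotate_surface \<theta> X) U F" and z0: "z0 \<in> unit_square" "s z0 \<in> U"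
  shows "((\<lambda>z. F (s z)) has_field_derivative cis \<theta>) (at z0)"
proof -
  have U: "openin (surf X) U" using F by (simp add: primitive_on_def rotate_surface_def)
  define x where "x = s z0"
  have x: "x \<in> fibre (z0 + b)" unfolding x_def by (rule lift_fibre[OF s z0(1)])
  have xU: "x \<in> U" using z0 by (simp add: x_def)
  obtain V \<phi> r G where V: "(V, \<phi>) \<in> charts X" "x \<in> V" "r > 0" "ball (\<phi> x) r \<subseteq> \<phi> ` V"
    "openin (surf X) (inv_into V \<phi> ` ball (\<phi> x) r)" "inv_into V \<phi> ` ball (\<phi> x) r \<subseteq> U" "inv_into V \<phi> (\<phi> x) = x" and
    G: "\<forall>w\<in>ball (\<phi> x) r. (G has_field_derivative form X (V, \<phi>) w) (at w)"
    "\<forall>w\<in>ball (\<phi> x) r. \<rho> (inv_into V \<phi> w) = torus_proj (G w)"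
    "\<forall>w\<in>ball (\<phi> x) r. G w \<in> ball (z0 + b) (1 / 2)" "G (\<phi> x) = z0 + b"
    by (rule local_coordinate[OF x U xU])
  let ?B = "inv_into V \<phi> ` ball (\<phi> x) r"
  let ?f = "form X (V, \<phi>) (\<phi> x)"
  have xB: "\<phi> x \<in> ball (\<phi> x) r" using V(3) by simp
  have f0: "?f \<noteq> 0" using form_nonzero[OF V(1,2)] x shift_ok_off[OF b z0(1)] by (auto simp: fibre_def)
  have hom: "homeomorphic_map (subtopology (surf X) V) (top_of_set (\<phi> ` V)) \<phi>" "openin (surf X) V"
    using chart[OF V(1)] by auto
  have inj: "inj_on \<phi> V"
    using hom homeomorphic_imp_injective_map openin_subset by (metis inf.absorb_iff2 topspace_subtopology)
  define T where "T = {z \<in> unit_square. s z \<in> ?B} \<inter> ball z0 (1 / 2)"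
  have oT: "open T" unfolding T_def using lift_preimage_open[OF s V(5)] by blast
  have "x \<in> ?B" using V(7) xB by (metis imageI)
  then have z0T: "z0 \<in> T" using z0 unfolding T_def x_def by simp
  have onT: "G (\<phi> (s z)) = z + b" "inv_into V \<phi> (\<phi> (s z)) = s z" if z: "z \<in> T" for z
  proof -
    obtain w where w: "w \<in> ball (\<phi> x) r" "s z = inv_into V \<phi> w" using z unfolding T_def by blast
    have \<phi>w: "\<phi> (s z) = w" using w V(4) by (metis f_inv_into_f subsetD)
    then show "inv_into V \<phi> (\<phi> (s z)) = s z" using w by simp
    have "torus_proj (G w) = torus_proj (z + b)" using G(2) w s z by (auto simp: is_lift_def T_def)
    moreover have "G w \<in> ball (z0 + b) (1 / 2)" using G(3) w(1) by blast
    moreover have "z + b \<in> ball (z0 + b) (1 / 2)" using z by (simp add: T_def)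
    ultimately show "G (\<phi> (s z)) = z + b" using inj_on_torus_proj_ball[of "z0 + b"] \<phi>w by (auto simp: inj_on_def)
  qed
  have "continuous_on T (\<lambda>z. \<phi> (s z))"
  proof -
    have "s z \<in> V" if "z \<in> T" for z
    proof -
      have "s z \<in> ?B" using that unfolding T_def by blast
      then obtain w where "w \<in> ball (\<phi> x) r" "s z = inv_into V \<phi> w" by blast
      then show ?thesis using V(4) by (metis inv_into_into subsetD)
    qed
    then have "continuous_map (top_of_set T) (subtopology (surf X) V) s"
      using s by (auto simp: is_lift_def T_def continuous_map_in_subtopology intro: continuous_map_from_subtopology_mono)
    moreover have "continuous_map (subtopology (surf X) V) euclidean \<phi>"
      using hom(1) by (meson continuous_map_into_fulltopology homeomorphic_imp_continuous_map)
    ultimately have "continuous_map (top_of_set T) euclidean (\<phi> \<circ> s)" by (rule continuous_map_compose)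
    then show ?thesis by (simp add: comp_def)
  qed
  then have cont: "continuous (at z0) (\<lambda>z. \<phi> (s z))" using oT z0T by (simp add: continuous_on_eq_continuous_at)
  have der: "((\<lambda>z. \<phi> (s z)) has_field_derivative inverse ?f) (at z0)"
  proof (rule has_field_derivative_inverse_basic[where f = "\<lambda>w. G w - b" and t = T])
    have "(G has_field_derivative ?f) (at (\<phi> x))" using G(1) xB by blast
    then have "((\<lambda>w. G w - b) has_field_derivative ?f - 0) (at (\<phi> x))" by (intro derivative_intros)
    then show "((\<lambda>w. G w - b) has_field_derivative ?f) (at (\<phi> (s z0)))" by (simp add: x_def)
  qed (use f0 cont oT z0T onT in auto)
  have "(F \<circ> inv_into V \<phi> has_field_derivative cis \<theta> * ?f) (at (\<phi> x))"
    using F V(1,2) xU unfolding primitive_on_def rotate_surface_def by fastforce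
  then have "(F \<circ> inv_into V \<phi> has_field_derivative cis \<theta> * ?f) (at (\<phi> (s z0)))" by (simp add: x_def)
  from DERIV_chain2[OF this der] have "((\<lambda>z. (F \<circ> inv_into V \<phi>) (\<phi> (s z))) has_field_derivative cis \<theta>) (at z0)"
    using right_inverse[OF f0] by (simp only: mult.assoc mult_1_right)
  then show ?thesis
    by (rule has_field_derivative_transform_within_open[OF _ oT z0T]) (simp add: onT)
qed

lemma lift_image_measure:
  assumes b: "shift_ok b" and s: "is_lift (shift_proj b) unit_square s"
    and F: "primitive_on (rotate_surface \<theta> X) U F" "inj_on F U"
    and S: "S \<in> sets borel" "S \<subseteq> {z \<in> unit_square. s z \<in> U}"
  shows "(\<lambda>z. F (s z)) ` S \<in> sets borel" "emeasure lborel ((\<lambda>z. F (s z)) ` S) = emeasure lborel S"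
proof -
  have U: "openin (surf X) U" using F by (simp add: primitive_on_def rotate_surface_def)
  have o: "open {z \<in> unit_square. s z \<in> U}" by (rule lift_preimage_open[OF s U])
  have inj: "inj_on (\<lambda>z. F (s z)) {z \<in> unit_square. s z \<in> U}"
    using F(2) lift_eq(1)[OF b s s] by (auto simp: inj_on_def)
  have der: "\<And>z. z \<in> {z \<in> unit_square. s z \<in> U} \<Longrightarrow> ((\<lambda>z. F (s z)) has_field_derivative cis \<theta>) (at z)"
    using lift_derivative[OF b s F(1)] by blast
  show "(\<lambda>z. F (s z)) ` S \<in> sets borel" "emeasure lborel ((\<lambda>z. F (s z)) ` S) = emeasure lborel S"
    using local_isometry_image[OF o der _ inj S] by auto
qed

definition cell_preimage :: "'a set \<Rightarrow> 'a \<Rightarrow> complex set" where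
  "cell_preimage U y = {z \<in> unit_square. sect 0 y z \<in> U}"

lemma shift_ok_0: "shift_ok 0" by (rule shift_ok_I) simp

text \<open>Apart from points over edges and vertices, \<open>U\<close> is the union of its parts in
  the cells, on which \<open>F\<close> preserves area. The vertices form a finite fibre. The edges
  are midlines of the half-shifted squares, and there too \<open>F\<close> preserves measure, so
  their images are null.\<close>

lemma emeasure_primitive_le:
  assumes F: "primitive_on (rotate_surface \<theta> X) U F" "inj_on F U"
  shows "emeasure lborel (F ` U) \<le> (\<Sum>y\<in>fibre centre. emeasure lborel (cell_preimage U y))"
proof -
  have U: "openin (surf X) U" using F by (simp add: primitive_on_def rotate_surface_def)
  let ?bh = "- (\<i> / 2)" and ?bv = "- (1 / 2) :: complex"
  have okh: "shift_ok ?bh" and okv: "shift_ok ?bv" by (auto intro!: shift_ok_I)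
  \<comment> \<open>The whole square for the cells and a midline for the half shifts: shifting by
    \<open>?bv\<close> turns the edge \<open>Re z = 0\<close> into \<open>Re z = 1 / 2\<close>, and
    \<open>?bh\<close> does the same for \<open>Im z = 0\<close>.\<close>
  define E where "E b = (if b = 0 then unit_square else unit_square \<inter> (if Re b = 0 then {z. Im z = 1 / 2} else {z. Re z = 1 / 2}))" for b
  define A where "A b y = {z \<in> E b. sect b y z \<in> U}" for b y
  define I where "I b y = (\<lambda>z. F (sect b y z)) ` A b y" for b y
  have Eb: "E b \<subseteq> unit_square" "E b \<in> sets borel" for b
  proof -
    have "closed {z. Re z = 1 / 2}" "closed {z. Im z = 1 / 2}" by (auto intro!: closed_Collect_eq continuous_intros)
    then show "E b \<subseteq> unit_square" "E b \<in> sets borel" by (auto simp: E_def)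
  qed
  have A: "A b y \<in> sets borel" "A b y \<subseteq> {z \<in> unit_square. sect b y z \<in> U}"
    if "shift_ok b" "y \<in> fibre (centre + b)" for b y
  proof -
    have "A b y = E b \<inter> {z \<in> unit_square. sect b y z \<in> U}" using Eb by (auto simp: A_def)
    then show "A b y \<in> sets borel" "A b y \<subseteq> {z \<in> unit_square. sect b y z \<in> U}"
      using Eb lift_preimage_open[OF sect(1)[OF that] U] by auto
  qed
  have I: "I b y \<in> sets borel" "emeasure lborel (I b y) = emeasure lborel (A b y)"
    if "shift_ok b" "y \<in> fibre (centre + b)" for b y
    unfolding I_def using lift_image_measure[OF that(1) sect(1)[OF that] F A[OF that]] by auto
  have null: "I b y \<in> null_sets lborel" if "shift_ok b" "y \<in> fibre (centre + b)" "b \<noteq> 0" for b y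
  proof -
    have "A b y \<subseteq> {z. Im z = 1 / 2} \<or> A b y \<subseteq> {z. Re z = 1 / 2}" using that(3) by (auto simp: A_def E_def)
    then have "emeasure lborel (A b y) = 0"
      using null_sets_coordinate_line[of "1 / 2"] null_sets_subset[of _ lborel "A b y"] A(1)[OF that(1,2)] by fastforce
    then show ?thesis using I[OF that(1,2)] by (intro null_setsI) auto
  qed
  let ?N0 = "F ` fibre 0"
  let ?N = "?N0 \<union> (\<Union>y\<in>fibre (centre + ?bh). I ?bh y) \<union> (\<Union>y\<in>fibre (centre + ?bv). I ?bv y)"
  have N0: "F ` fibre 0 \<in> null_sets lborel" by (intro finite_imp_null_set_lborel finite_imageI finite_fibre)
  have N: "?N \<in> null_sets lborel"
    using finite_fibre null[OF okh] null[OF okv]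
    by (intro null_sets.Un null_sets.finite_UN N0) auto
  have cover: "F ` U \<subseteq> (\<Union>y\<in>fibre centre. I 0 y) \<union> ?N"
  proof
    fix w assume "w \<in> F ` U"
    then obtain x where x: "x \<in> U" "w = F x" by blast
    have xt: "x \<in> topspace (surf X)" using x U openin_subset by blast
    then have "\<rho> x \<in> range torus_proj" using surj by blast
    then obtain z0 where z0: "\<rho> x = torus_proj z0" by blast
    define z where "z = Complex (frac (Re z0)) (frac (Im z0))"
    have z: "x \<in> fibre z" using xt z0 by (auto simp: fibre_def torus_proj_eq_iff z_def gaussian_ints_iff frac_def)
    have zr: "0 \<le> Re z" "Re z < 1" "0 \<le> Im z" "Im z < 1" by (auto simp: z_def frac_lt_1)
    have hit: "\<exists>y\<in>fibre (centre + b). w \<in> I b y" if hb: "shift_ok b" "z - b \<in> E b" for b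
    proof -
      have "z - b \<in> unit_square" using hb Eb by blast
      moreover have "x \<in> fibre ((z - b) + b)" using z by simp
      ultimately obtain y where y: "y \<in> fibre (centre + b)" "sect b y (z - b) = x" using sect_cover[OF hb(1)] by blast
      then have "z - b \<in> A b y" using hb x by (simp add: A_def)
      then show ?thesis using y x by (auto simp: I_def intro!: bexI[of _ y] image_eqI[of _ _ "z - b"])
    qed
    consider "Re z = 0" "Im z = 0" | "Re z > 0" "Im z > 0" | "Re z = 0" "Im z > 0" | "Re z > 0" "Im z = 0"
      using zr by linarith
    then show "w \<in> (\<Union>y\<in>fibre centre. I 0 y) \<union> ?N"
    proof cases
      case 1
      then have "z = 0" by (simp add: complex_eq_iff)
      then show ?thesis using z x by auto
    next
      case 2
      then have "z - 0 \<in> E 0" using zr by (auto simp: E_def in_box_complex_iff)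
      then show ?thesis using hit[OF shift_ok_0] by auto
    next
      case 3
      then have "z - ?bv \<in> E ?bv" using zr by (auto simp: E_def in_box_complex_iff)
      then show ?thesis using hit[OF okv] by auto
    next
      case 4
      then have "z - ?bh \<in> E ?bh" using zr by (auto simp: E_def in_box_complex_iff)
      then show ?thesis using hit[OF okh] by auto
    qed
  qed
  have mI: "(\<Union>y\<in>fibre centre. I 0 y) \<in> sets lborel" using finite_fibre I(1)[OF shift_ok_0] by (intro sets.finite_UN) auto
  have "emeasure lborel (F ` U) \<le> emeasure lborel ((\<Union>y\<in>fibre centre. I 0 y) \<union> ?N)"
    using cover mI N by (intro emeasure_mono) auto
  also have "\<dots> = emeasure lborel (\<Union>y\<in>fibre centre. I 0 y)" by (rule emeasure_Un_null_set[OF mI N])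
  also have "\<dots> \<le> (\<Sum>y\<in>fibre centre. emeasure lborel (I 0 y))"
    using finite_fibre I(1)[OF shift_ok_0] by (intro emeasure_subadditive_finite) auto
  also have "\<dots> = (\<Sum>y\<in>fibre centre. emeasure lborel (cell_preimage U y))"
    using I(2)[OF shift_ok_0] by (intro sum.cong) (auto simp: A_def E_def cell_preimage_def)
  finally show ?thesis .
qed

lemma primitive_on_cell:
  assumes y: "y \<in> fibre centre"
  shows "primitive_on (rotate_surface \<theta> X) (sect 0 y ` unit_square)
    (\<lambda>x. cis \<theta> * inv_into unit_square torus_proj (\<rho> x))"
proof -
  have y': "y \<in> fibre (centre + 0)" using y by simp
  let ?W = "{x \<in> topspace (surf X). \<rho> x \<in> torus_proj ` unit_square}"
  have prim: "primitive_on X ?W (inv_into unit_square torus_proj \<circ> \<rho>)"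
    by (intro primitive_pullback primitive_on_inv_torus_proj inj_on_torus_proj_unit_square open_box)
  have sub: "sect 0 y ` unit_square \<subseteq> ?W" using lift_fibre[OF sect(1)[OF shift_ok_0 y']] by (auto simp: fibre_def)
  show ?thesis
    unfolding primitive_on_def
  proof (intro conjI)
    show "openin (surf (rotate_surface \<theta> X)) (sect 0 y ` unit_square)"
      using lift_image_open[OF shift_ok_0 sect(1)[OF shift_ok_0 y']] by (simp add: rotate_surface_def)
    have "(((\<lambda>x. cis \<theta> * inv_into unit_square torus_proj (\<rho> x)) \<circ> inv_into U \<phi>) has_field_derivative
        form (rotate_surface \<theta> X) (U, \<phi>) (\<phi> x)) (at (\<phi> x))"
      if "(U, \<phi>) \<in> charts X" "x \<in> U" "x \<in> sect 0 y ` unit_square" for U \<phi> x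
    proof -
      have "((inv_into unit_square torus_proj \<circ> \<rho>) \<circ> inv_into U \<phi> has_field_derivative form X (U, \<phi>) (\<phi> x)) (at (\<phi> x))"
        using prim that sub unfolding primitive_on_def by blast
      then have "((\<lambda>w. cis \<theta> * ((inv_into unit_square torus_proj \<circ> \<rho>) \<circ> inv_into U \<phi>) w) has_field_derivative cis \<theta> * form X (U, \<phi>) (\<phi> x)) (at (\<phi> x))"
        by (rule DERIV_cmult)
      then show ?thesis by (simp add: rotate_surface_def comp_def)
    qed
    then show "\<forall>(U, \<phi>)\<in>charts (rotate_surface \<theta> X). \<forall>x\<in>U \<inter> sect 0 y ` unit_square.
        ((\<lambda>x. cis \<theta> * inv_into unit_square torus_proj (\<rho> x)) \<circ> inv_into U \<phi> has_field_derivative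
          form (rotate_surface \<theta> X) (U, \<phi>) (\<phi> x)) (at (\<phi> x))"
      by (auto simp: rotate_surface_def)
  qed
qed

lemma sect_0_eqD:
  assumes "y \<in> fibre centre" "y' \<in> fibre centre" "z \<in> unit_square" "w \<in> unit_square" "sect 0 y z = sect 0 y' w"
  shows "y = y'" "z = w"
proof -
  have y: "y \<in> fibre (centre + 0)" "y' \<in> fibre (centre + 0)" using assms by auto
  show "z = w" "y = y'"
    using lift_eq[OF shift_ok_0 sect(1)[OF shift_ok_0 y(1)] sect(1)[OF shift_ok_0 y(2)] assms(3,4,5) centre_in]
      sect(2)[OF shift_ok_0 y(1)] sect(2)[OF shift_ok_0 y(2)] by auto
qed

lemma inj_on_cells: "inj_on (\<lambda>y. sect 0 y ` unit_square) (fibre centre)"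
proof (rule inj_onI)
  fix y y' assume *: "y \<in> fibre centre" "y' \<in> fibre centre" "sect 0 y ` unit_square = sect 0 y' ` unit_square"
  have "sect 0 y centre \<in> sect 0 y' ` unit_square" using *(3) centre_in by blast
  then obtain w where "w \<in> unit_square" "sect 0 y centre = sect 0 y' w" by blast
  then show "y = y'" using sect_0_eqD[OF *(1,2) centre_in] by blast
qed

text \<open>The cells, that is the images of the sections over the open unit square, realise the supremum
  in the definition of the area.\<close>

lemma surface_area_rotate: "surface_area (rotate_surface \<theta> X) = of_nat (card (fibre centre))"
proof (rule antisym)
  let ?F = "\<lambda>x. cis \<theta> * inv_into unit_square torus_proj (\<rho> x)"
  let ?D = "(\<lambda>y. (sect 0 y ` unit_square, ?F)) ` fibre centre"
  have F_sect: "?F (sect 0 y z) = cis \<theta> * z" if "y \<in> fibre centre" "z \<in> unit_square" for y z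
  proof -
    have "y \<in> fibre (centre + 0)" using that by simp
    then have "\<rho> (sect 0 y z) = torus_proj z" using sect(1)[OF shift_ok_0] that by (auto simp: is_lift_def)
    then show ?thesis using that inj_on_torus_proj_unit_square by simp
  qed
  have inj: "inj_on ?F (sect 0 y ` unit_square)" if "y \<in> fibre centre" for y
    by (rule inj_onI) (use F_sect[OF that] in auto)
  have img: "?F ` (sect 0 y ` unit_square) = (\<lambda>z. cis \<theta> * z + 0) ` unit_square" if "y \<in> fibre centre" for y
    unfolding image_image by (intro image_cong) (use F_sect[OF that] in auto)
  have one: "emeasure lborel (?F ` (sect 0 y ` unit_square)) = 1" if "y \<in> fibre centre" for y
    unfolding img[OF that] by (subst rotation_translation_image(2)) (auto simp: emeasure_unit_square)
  have injD: "inj_on (\<lambda>y. (sect 0 y ` unit_square, ?F)) (fibre centre)" using inj_on_cells by (auto simp: inj_on_def)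
  have "(of_nat (card (fibre centre)) :: ennreal) = (\<Sum>y\<in>fibre centre. emeasure lborel (?F ` (sect 0 y ` unit_square)))"
    using one by simp
  also have "\<dots> = (\<Sum>(U, F)\<in>?D. emeasure lborel (F ` U))"
    by (subst sum.reindex[OF injD]) simp
  also have "\<dots> \<le> surface_area (rotate_surface \<theta> X)"
    unfolding surface_area_def
  proof (rule SUP_upper, intro CollectI conjI)
    show "finite ?D" using finite_fibre by simp
    show "\<forall>(U, F)\<in>?D. primitive_on (rotate_surface \<theta> X) U F \<and> inj_on F U" using primitive_on_cell inj by auto
    show "pairwise (\<lambda>(U, _) (V, _). disjnt U V) ?D"
      unfolding pairwise_def
    proof (intro ballI impI)
      fix d d' assume d: "d \<in> ?D" "d' \<in> ?D" "d \<noteq> d'"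
      then obtain y y' where y: "y \<in> fibre centre" "d = (sect 0 y ` unit_square, ?F)"
        "y' \<in> fibre centre" "d' = (sect 0 y' ` unit_square, ?F)" by blast
      then have "y \<noteq> y'" using d(3) by blast
      then have "disjnt (sect 0 y ` unit_square) (sect 0 y' ` unit_square)"
        using sect_0_eqD(1)[OF y(1,3)] unfolding disjnt_def by blast
      then show "(case d of (U, _) \<Rightarrow> \<lambda>(V, _). disjnt U V) d'" using y by simp
    qed
  qed
  finally show "of_nat (card (fibre centre)) \<le> surface_area (rotate_surface \<theta> X)" .
next
  show "surface_area (rotate_surface \<theta> X) \<le> of_nat (card (fibre centre))"
    unfolding surface_area_def
  proof (rule SUP_least)
    fix D :: "('a set \<times> ('a \<Rightarrow> complex)) set"
    assume "D \<in> {D. finite D \<and> (\<forall>(U, F)\<in>D. primitive_on (rotate_surface \<theta> X) U F \<and> inj_on F U) \<and>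
       pairwise (\<lambda>(U, _) (V, _). disjnt U V) D}"
    then have fin: "finite D" and prim: "\<And>U F. (U, F) \<in> D \<Longrightarrow> primitive_on (rotate_surface \<theta> X) U F \<and> inj_on F U"
      and disj: "pairwise (\<lambda>(U, _) (V, _). disjnt U V) D" by auto
    have oU: "openin (surf X) U" if "(U, F) \<in> D" for U F
      using prim[OF that] by (simp add: primitive_on_def rotate_surface_def)
    have open_cell: "open (cell_preimage (fst d) y)" if "d \<in> D" "y \<in> fibre centre" for d y
    proof -
      have "y \<in> fibre (centre + 0)" using that by simp
      then show ?thesis using lift_preimage_open[OF sect(1)[OF shift_ok_0] oU[of "fst d" "snd d"]] that
        unfolding cell_preimage_def by simp
    qed
    have "(\<Sum>(U, F)\<in>D. emeasure lborel (F ` U)) \<le> (\<Sum>(U, F)\<in>D. \<Sum>y\<in>fibre centre. emeasure lborel (cell_preimage U y))"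
    proof (rule sum_mono)
      fix d assume "d \<in> D"
      then show "(case d of (U, F) \<Rightarrow> emeasure lborel (F ` U)) \<le> (case d of (U, F) \<Rightarrow> \<Sum>y\<in>fibre centre. emeasure lborel (cell_preimage U y))"
        using emeasure_primitive_le[of \<theta> "fst d" "snd d"] prim[of "fst d" "snd d"] by (simp add: case_prod_beta)
    qed
    \<comment> \<open>With the sum over cells outermost, disjointness of the sets \<open>U\<close>
      bounds the share of each cell by the area 1 of the square.\<close>
    also have "\<dots> = (\<Sum>y\<in>fibre centre. \<Sum>d\<in>D. emeasure lborel (cell_preimage (fst d) y))"
      by (subst sum.swap) (simp add: case_prod_beta)
    also have "\<dots> \<le> (\<Sum>y\<in>fibre centre. 1)"
    proof (rule sum_mono)
      fix y assume y: "y \<in> fibre centre"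
      have "disjoint_family_on (\<lambda>d. cell_preimage (fst d) y) D"
        unfolding disjoint_family_on_def
      proof (intro ballI impI)
        fix d d' assume "d \<in> D" "d' \<in> D" "d \<noteq> d'"
        then have "disjnt (fst d) (fst d')" using disj unfolding pairwise_def by (simp add: case_prod_beta)
        then show "cell_preimage (fst d) y \<inter> cell_preimage (fst d') y = {}"
          unfolding disjnt_def cell_preimage_def by blast
      qed
      then have "(\<Sum>d\<in>D. emeasure lborel (cell_preimage (fst d) y)) = emeasure lborel (\<Union>d\<in>D. cell_preimage (fst d) y)"
        using open_cell[OF _ y] fin by (intro sum_emeasure) auto
      also have "\<dots> \<le> emeasure lborel unit_square"
        by (intro emeasure_mono) (auto simp: cell_preimage_def)
      finally show "(\<Sum>d\<in>D. emeasure lborel (cell_preimage (fst d) y)) \<le> 1" by (simp add: emeasure_unit_square)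
    qed
    also have "\<dots> = of_nat (card (fibre centre))" by simp
    finally show "(\<Sum>(U, F)\<in>D. emeasure lborel (F ` U)) \<le> of_nat (card (fibre centre))" .
  qed
qed

text \<open>Each cell is connected as an image of the square, open, and closed because its
  complement is the union of the other cells; so the cells are the components, and each meets the
  fibre of the centre once.\<close>

lemma num_squares_eq: "num_squares X \<rho> = card (fibre centre)"
proof -
  have sq: "{z. 0 < Re z \<and> Re z < 1 \<and> 0 < Im z \<and> Im z < 1} = unit_square"
    by (auto simp: in_box_complex_iff)
  let ?W = "{x \<in> topspace (surf X). \<rho> x \<in> torus_proj ` unit_square}"
  let ?T = "subtopology (surf X) ?W"
  let ?Q = "\<lambda>y. sect 0 y ` unit_square"
  have y0: "y \<in> fibre (centre + 0)" if "y \<in> fibre centre" for y using that by simp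
  have sub: "?Q y \<subseteq> ?W" if "y \<in> fibre centre" for y
    using lift_fibre[OF sect(1)[OF shift_ok_0 y0[OF that]]] by (auto simp: fibre_def)
  have topT: "topspace ?T = (\<Union>y\<in>fibre centre. ?Q y)"
  proof (intro equalityI subsetI)
    fix x assume "x \<in> topspace ?T"
    then obtain z where z: "z \<in> unit_square" "x \<in> fibre (z + 0)" by (auto simp: fibre_def)
    then obtain y where "y \<in> fibre (centre + 0)" "sect 0 y z = x" using sect_cover[OF shift_ok_0] by blast
    then show "x \<in> (\<Union>y\<in>fibre centre. ?Q y)" using z by auto
  qed (use sub in auto)
  have openQ: "openin ?T (?Q y)" if "y \<in> fibre centre" for y
  proof -
    have "openin (surf X) (?Q y)" using lift_image_open[OF shift_ok_0 sect(1)[OF shift_ok_0 y0[OF that]]] .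
    then show ?thesis using sub[OF that] unfolding openin_subtopology by (intro exI[of _ "?Q y"]) blast
  qed
  have closedQ: "closedin ?T (?Q y)" if y: "y \<in> fibre centre" for y
  proof -
    have "topspace ?T - ?Q y = (\<Union>y'\<in>fibre centre - {y}. ?Q y')"
    proof (intro equalityI subsetI)
      fix x assume "x \<in> topspace ?T - ?Q y"
      then show "x \<in> (\<Union>y'\<in>fibre centre - {y}. ?Q y')" unfolding topT by blast
    next
      fix x assume "x \<in> (\<Union>y'\<in>fibre centre - {y}. ?Q y')"
      then obtain y' where y': "y' \<in> fibre centre" "y' \<noteq> y" "x \<in> ?Q y'" by blast
      then have "x \<notin> ?Q y" using sect_0_eqD(1)[OF y y'(1)] by blast
      then show "x \<in> topspace ?T - ?Q y" unfolding topT using y' by blast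
    qed
    then have "openin ?T (topspace ?T - ?Q y)" using openQ by auto
    then show ?thesis using openin_subset[OF openQ[OF y]] by (simp add: closedin_def)
  qed
  have connQ: "connectedin ?T (?Q y)" if y: "y \<in> fibre centre" for y
  proof -
    have "connectedin (surf X) (?Q y)"
      using sect(1)[OF shift_ok_0 y0[OF y]] unfolding is_lift_def
      by (intro connectedin_continuous_map_image[of "top_of_set unit_square"])
        (auto simp: connectedin_subtopology convex_connected convex_box)
    then show ?thesis using sub[OF y] by (simp add: connectedin_subtopology)
  qed
  have comp: "connected_component_of_set ?T x = ?Q y" if y: "y \<in> fibre centre" and x: "x \<in> ?Q y" for x y
  proof
    show "?Q y \<subseteq> connected_component_of_set ?T x" using connQ[OF y] x by (rule connected_component_of_maximal)
    have "connectedin ?T (connected_component_of_set ?T x)" by (rule connectedin_connected_component_of)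
    then have "connected_component_of_set ?T x \<subseteq> ?Q y \<or> disjnt (connected_component_of_set ?T x) (?Q y)"
      using closedQ[OF y] openQ[OF y] by (rule connectedin_clopen_cases)
    moreover have "x \<in> connected_component_of_set ?T x" using connQ[OF y] x \<open>?Q y \<subseteq> connected_component_of_set ?T x\<close> by blast
    ultimately show "connected_component_of_set ?T x \<subseteq> ?Q y" using x by (auto simp: disjnt_def)
  qed
  have "connected_components_of ?T = ?Q ` fibre centre"
  proof (intro equalityI subsetI)
    fix C assume "C \<in> connected_components_of ?T"
    then obtain x where x: "x \<in> topspace ?T" "C = connected_component_of_set ?T x" by (auto simp: connected_components_of_def)
    then obtain y where "y \<in> fibre centre" "x \<in> ?Q y" unfolding topT by blast
    then show "C \<in> ?Q ` fibre centre" using comp x(2) by blast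
  next
    fix C assume "C \<in> ?Q ` fibre centre"
    then obtain y where y: "y \<in> fibre centre" "C = ?Q y" by blast
    have x: "sect 0 y centre \<in> ?Q y" using centre_in by blast
    then have "sect 0 y centre \<in> topspace ?T" unfolding topT using y by blast
    then show "C \<in> connected_components_of ?T" using comp[OF y(1) x] y(2) by (auto simp: connected_components_of_def)
  qed
  then show ?thesis unfolding num_squares_def sq using inj_on_cells by (simp add: card_image)
qed

lemma card_centre_pos: "card (fibre centre) > 0"
proof -
  have "torus_proj centre \<in> \<rho> ` topspace (surf X)" unfolding surj by blast
  then have "fibre centre \<noteq> {}" unfolding fibre_def by force
  then show ?thesis using finite_fibre by (simp add: card_gt_0_iff)
qed

end

section \<open>Areas of periods in the rotated plane\<close>

lemma eventually_far_iff:
  "eventually P (inf (filtercomap (\<lambda>v :: complex. \<bar>Im v\<bar>) at_top) (principal H)) \<longleftrightarrow>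
     (\<exists>R. \<forall>v\<in>H. R \<le> \<bar>Im v\<bar> \<longrightarrow> P v)"
proof -
  have "eventually P (inf (filtercomap (\<lambda>v :: complex. \<bar>Im v\<bar>) at_top) (principal H)) \<longleftrightarrow>
      (\<exists>Q. (\<exists>N. \<forall>n\<ge>N. Q n) \<and> (\<forall>v. Q \<bar>Im v\<bar> \<longrightarrow> v \<in> H \<longrightarrow> P v))"
    unfolding eventually_inf_principal eventually_filtercomap eventually_at_top_linorder ..
  also have "\<dots> \<longleftrightarrow> (\<exists>R. \<forall>v\<in>H. R \<le> \<bar>Im v\<bar> \<longrightarrow> P v)"
  proof
    assume "\<exists>R. \<forall>v\<in>H. R \<le> \<bar>Im v\<bar> \<longrightarrow> P v"
    then obtain R where "\<forall>v\<in>H. R \<le> \<bar>Im v\<bar> \<longrightarrow> P v" by blast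
    then show "\<exists>Q. (\<exists>N. \<forall>n\<ge>N. Q n) \<and> (\<forall>v. Q \<bar>Im v\<bar> \<longrightarrow> v \<in> H \<longrightarrow> P v)"
      by (intro exI[of _ "\<lambda>x. R \<le> x"]) auto
  qed blast
  finally show ?thesis .
qed

context irrational_cfrac
begin

definition rot :: complex where "rot = cis (arctan \<alpha>)"

text \<open>Equal to \<open>\<alpha> / (1 + \<alpha>\<^sup>2)\<close>; the coefficient of the error
  term in \<open>vec_area_rot\<close>.\<close>

definition skew :: real where "skew = (cos (arctan \<alpha>))\<^sup>2 * \<alpha>"

lemma cos_pos: "cos (arctan \<alpha>) > 0"
  by (simp add: cos_arctan add_pos_nonneg)

lemma rot_components:
  "Re (rot * v) = cos (arctan \<alpha>) * (Re v - \<alpha> * Im v)"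
  "Im (rot * v) = cos (arctan \<alpha>) * (\<alpha> * Re v + Im v)"
  by (simp_all add: rot_def cos_arctan sin_arctan add_divide_distrib diff_divide_distrib algebra_simps)

text \<open>With \<open>e = Re v - \<alpha> * Im v\<close> and \<open>c\<close> the cosine, the
  rotated coordinates are \<open>c * e\<close> and
  \<open>c * (\<alpha> * e + (1 + \<alpha>\<^sup>2) * Im v)\<close>, where
  \<open>c\<^sup>2 * (1 + \<alpha>\<^sup>2) = 1\<close>. So the area differs from
  \<open>\<bar>e\<bar> * \<bar>Im v\<bar>\<close> by at most
  \<open>\<bar>skew\<bar> * e\<^sup>2\<close>.\<close>

lemma vec_area_rot: "vec_area (rot * v) = \<bar>Re v - \<alpha> * Im v\<bar> * \<bar>Im v + skew * (Re v - \<alpha> * Im v)\<bar>"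
proof -
  let ?c = "cos (arctan \<alpha>)"
  have "?c\<^sup>2 * (1 + \<alpha>\<^sup>2) = 1" by (simp add: cos_arctan power_divide add_nonneg_eq_0_iff add_pos_nonneg less_imp_neq[THEN not_sym])
  then have "?c * (?c * (\<alpha> * Re v + Im v)) = Im v + skew * (Re v - \<alpha> * Im v)"
    unfolding skew_def by (simp add: power2_eq_square) (algebra)
  moreover have "vec_area (rot * v) = \<bar>Re v - \<alpha> * Im v\<bar> * \<bar>?c * (?c * (\<alpha> * Re v + Im v))\<bar>"
    unfolding vec_area_def rot_components by (simp add: abs_mult)
  ultimately show ?thesis by simp
qed

abbreviation conv_vec :: "nat \<Rightarrow> complex" where
  "conv_vec n \<equiv> Complex (of_int (cnum a (Suc n))) (of_int (cden a (Suc n)))"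

text \<open>\<open>H\<close> and \<open>\<mu>\<close> are left free because the lemma serves both
  the periods of \<open>X\<close>, with their minimal multiplicities, and those of the torus, with
  the constant 1. A far vector of area at most \<open>y\<close> has a small error \<open>e\<close>;
  divided by the gcd \<open>m\<close> of its coordinates it is a convergent vector by Legendre's
  theorem, of index at least \<open>n0\<close>, and \<open>\<mu> n \<le> m\<close> contradicts the
  bound assumed there.\<close>

lemma rot_area_lower:
  fixes \<mu> :: "nat \<Rightarrow> nat"
  assumes H: "H \<subseteq> gaussian_ints - {0}"
    and \<mu>: "\<And>v m n. v \<in> H \<Longrightarrow> m > 0 \<Longrightarrow> v = of_nat m * conv_vec n \<or> v = - (of_nat m * conv_vec n) \<Longrightarrow> \<mu> n \<le> m"
    and y: "y < y'" "y' \<le> 1 / 2"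
    and ev: "\<forall>\<^sub>F n in sequentially. y' \<le> (real (\<mu> n))\<^sup>2 / height n"
  shows "\<forall>\<^sub>F w in inf (filtercomap (\<lambda>v. \<bar>Im v\<bar>) at_top) (principal ((\<lambda>v. rot * v) ` H)). y < vec_area w"
proof -
  obtain n0 where n0: "\<And>n. n \<ge> n0 \<Longrightarrow> y' \<le> (real (\<mu> n))\<^sup>2 / height n" using ev by (auto simp: eventually_sequentially)
  \<comment> \<open>A vector with error below \<open>\<delta>\<close> is not on one of the finitely
    many convergents before \<open>n0\<close>; the entry 1 excludes nonzero real vectors, whose
    error is a positive integer.\<close>
  define \<delta> where "\<delta> = Min (insert 1 ((\<lambda>n. \<bar>theta (Suc n)\<bar>) ` {..<n0}))"
  have fin: "finite (insert 1 ((\<lambda>n. \<bar>theta (Suc n)\<bar>) ` {..<n0}))" by simp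
  have "\<delta> \<in> insert 1 ((\<lambda>n. \<bar>theta (Suc n)\<bar>) ` {..<n0})" unfolding \<delta>_def using fin by (intro Min_in) auto
  then have \<delta>0: "\<delta> > 0" using theta_nonzero by auto
  have le: "\<delta> \<le> x" if "x \<in> insert 1 ((\<lambda>n. \<bar>theta (Suc n)\<bar>) ` {..<n0})" for x unfolding \<delta>_def using fin that by (rule Min_le)
  \<comment> \<open>The first entry keeps the error below \<open>\<delta>\<close>; the other two
    make \<open>\<bar>skew\<bar> * e\<^sup>2\<close> smaller than the gap
    \<open>y' - y\<close>.\<close>
  define \<eta> where "\<eta> = min (\<delta> / 2) (min 1 ((y' - y) / (\<bar>skew\<bar> + 1)))"
  have \<eta>: "0 < \<eta>" "\<eta> < \<delta>" "\<eta> \<le> 1" "\<eta> \<le> (y' - y) / (\<bar>skew\<bar> + 1)"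
    using \<delta>0 y by (auto simp: \<eta>_def add_nonneg_pos)
  define c where "c = cos (arctan \<alpha>)"
  have c: "c > 0" using cos_pos by (simp add: c_def)
  \<comment> \<open>The area is \<open>c * \<bar>e\<bar> * \<bar>Im (rot * v)\<bar>\<close>, so
    beyond this radius an area of at most 1 forces
    \<open>\<bar>e\<bar> \<le> \<eta>\<close>.\<close>
  define R where "R = 1 / (c * \<eta>)"
  have "y < vec_area (rot * v)" if v: "v \<in> H" and R: "R \<le> \<bar>Im (rot * v)\<bar>" for v
  proof (rule ccontr)
    assume "\<not> y < vec_area (rot * v)"
    then have small: "vec_area (rot * v) \<le> y" by simp
    obtain x0 y0 where xy: "v = Complex (of_int x0) (of_int y0)" using v H by (auto simp: gaussian_ints_def)
    define e where "e = Re v - \<alpha> * Im v"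
    have area: "vec_area (rot * v) = c * \<bar>e\<bar> * \<bar>Im (rot * v)\<bar>"
      unfolding vec_area_def rot_components(1) e_def c_def using cos_pos by (simp add: abs_mult)
    have "c * \<bar>e\<bar> * R \<le> c * \<bar>e\<bar> * \<bar>Im (rot * v)\<bar>" using R c by (intro mult_left_mono) auto
    then have "c * \<bar>e\<bar> * R \<le> 1" using area small y by linarith
    moreover have "c * \<bar>e\<bar> * R = \<bar>e\<bar> / \<eta>" using c by (simp add: R_def)
    ultimately have e: "\<bar>e\<bar> \<le> \<eta>" using \<eta>(1) by (simp add: divide_simps)
    have y0: "y0 \<noteq> 0"
    proof
      assume "y0 = 0"
      then have "\<bar>real_of_int x0\<bar> \<le> \<eta>" using e by (simp add: e_def xy)
      then have "\<bar>real_of_int x0\<bar> < 1" using \<eta>(2) le[of 1] by simp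
      then have "x0 = 0" by linarith
      then show False using v H xy \<open>y0 = 0\<close> by (auto simp: complex_eq_iff)
    qed
    have "\<bar>e\<bar> * \<bar>Im v\<bar> \<le> \<bar>e\<bar> * (\<bar>Im v + skew * e\<bar> + \<bar>skew\<bar> * \<bar>e\<bar>)"
      by (intro mult_left_mono) (auto simp flip: abs_mult)
    also have "\<dots> = vec_area (rot * v) + \<bar>e\<bar> * \<bar>skew\<bar> * \<bar>e\<bar>"
      unfolding vec_area_rot e_def[symmetric] by (simp add: algebra_simps)
    also have "\<bar>e\<bar> * \<bar>skew\<bar> * \<bar>e\<bar> \<le> \<eta> * \<bar>skew\<bar> * 1" using e \<eta> by (intro mult_mono) auto
    also have "\<dots> < \<eta> * (\<bar>skew\<bar> + 1)" using \<eta>(1) by simp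
    also have "\<dots> \<le> y' - y" using \<eta>(4) by (simp add: pos_le_divide_eq add_nonneg_pos)
    finally have prod: "\<bar>e\<bar> * \<bar>Im v\<bar> < y'" using small by simp
    define m where "m = gcd x0 y0"
    have m: "m > 0" using y0 by (simp add: m_def)
    \<comment> \<open>The sign of \<open>y0\<close> is divided out because Legendre's theorem asks
      for a positive denominator.\<close>
    define p q where "p = sgn y0 * (x0 div m)" and "q = sgn y0 * (y0 div m)"
    have div: "m * (x0 div m) = x0" "m * (y0 div m) = y0" by (simp_all add: m_def)
    have q: "q > 0"
    proof -
      have "m * q = \<bar>y0\<bar>" using div by (simp add: q_def abs_sgn mult.left_commute mult.commute)
      then show ?thesis using m y0 by (metis abs_of_nonneg zero_less_abs_iff zero_less_mult_pos)
    qed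
    have cop: "coprime p q"
    proof -
      have "coprime (x0 div m) (y0 div m)" unfolding m_def using y0 by (intro div_gcd_coprime) auto
      then show ?thesis using y0 by (cases "y0 > 0") (auto simp: p_def q_def sgn_if)
    qed
    have s: "real_of_int (sgn y0) * real_of_int (sgn y0) = 1" using y0 by (auto simp: sgn_if)
    have x0': "real_of_int x0 = sgn y0 * (m * p)" and y0': "real_of_int y0 = sgn y0 * (m * q)"
      using div s unfolding p_def q_def by (metis mult.assoc mult.commute mult_1_right of_int_mult)+
    have e_eq: "\<bar>e\<bar> = m * \<bar>q * \<alpha> - p\<bar>"
    proof -
      have "e = - (sgn y0 * (m * (q * \<alpha> - p)))" unfolding e_def xy by (simp add: x0' y0' algebra_simps)
      then show ?thesis using m y0 by (simp add: abs_mult sgn_if)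
    qed
    have Im_eq: "\<bar>Im v\<bar> = m * q" using y0' m q y0 by (simp add: xy abs_mult sgn_if)
    have prod': "\<bar>e\<bar> * \<bar>Im v\<bar> = m\<^sup>2 * (q * \<bar>q * \<alpha> - p\<bar>)" unfolding e_eq Im_eq by (simp add: power2_eq_square)
    have m1: "1 \<le> (real_of_int m)\<^sup>2" using m by (simp add: one_le_power)
    have "q * \<bar>q * \<alpha> - p\<bar> \<le> m\<^sup>2 * (q * \<bar>q * \<alpha> - p\<bar>)" using m1 q mult_right_mono[OF m1, of "q * \<bar>q * \<alpha> - p\<bar>"] by simp
    then have "q * \<bar>q * \<alpha> - p\<bar> < 1 / 2" using prod prod' y by linarith
    then obtain n where n: "p = cnum a (Suc n)" "q = cden a (Suc n)" using legendre[OF cop q] by blast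
    have "v = of_nat (nat m) * conv_vec n \<or> v = - (of_nat (nat m) * conv_vec n)"
      using x0' y0' m y0 unfolding xy n[symmetric] by (auto simp: complex_eq_iff sgn_if split: if_splits)
    then have "\<mu> n \<le> nat m" using \<mu>[OF v, of "nat m" n] m by simp
    then have "(real (\<mu> n))\<^sup>2 \<le> (real_of_int m)\<^sup>2" using m by (intro power_mono) auto
    then have "(real (\<mu> n))\<^sup>2 * (1 / height n) \<le> (real_of_int m)\<^sup>2 * (1 / height n)"
      using height_pos[of n] by (intro mult_right_mono) auto
    moreover have "1 / height n = q * \<bar>q * \<alpha> - p\<bar>" unfolding height_eq n theta_def by simp
    ultimately have "(real (\<mu> n))\<^sup>2 * (1 / height n) < y'" using prod prod' by simp
    then have "(real (\<mu> n))\<^sup>2 / height n < y'" by simp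
    moreover have "n \<ge> n0"
    proof (rule ccontr)
      assume "\<not> n \<ge> n0"
      then have "\<delta> \<le> \<bar>theta (Suc n)\<bar>" using le by auto
      also have "\<dots> \<le> m * \<bar>q * \<alpha> - p\<bar>" unfolding theta_def n[symmetric] using m mult_right_mono[of 1 "real_of_int m" "\<bar>q * \<alpha> - p\<bar>"] by simp
      finally show False using e e_eq \<eta>(2) by simp
    qed
    ultimately show False using n0[of n] by simp
  qed
  then show ?thesis unfolding eventually_far_iff by (intro exI[of _ R]) auto
qed

text \<open>The multiples of the convergent vectors move far away, so their areas eventually exceed
  \<open>y\<close>. These areas equal \<open>(real (k n))\<^sup>2 / height n\<close> up to
  \<open>(real (k n))\<^sup>2 * \<bar>skew\<bar> * (theta (Suc n))\<^sup>2\<close>, and the uniform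
  bound \<open>K\<close> makes the error vanish.\<close>

lemma rot_area_upper:
  fixes k :: "nat \<Rightarrow> nat"
  assumes k: "\<And>n. 1 \<le> k n" "\<And>n. k n \<le> K"
    and v: "\<And>n. of_nat (k n) * conv_vec n \<in> H \<or> - (of_nat (k n) * conv_vec n) \<in> H"
    and ev: "\<forall>\<^sub>F w in inf (filtercomap (\<lambda>v. \<bar>Im v\<bar>) at_top) (principal ((\<lambda>v. rot * v) ` H)). y < vec_area w"
    and y: "y1 < y"
  shows "\<forall>\<^sub>F n in sequentially. y1 < (real (k n))\<^sup>2 / height n"
proof -
  define c where "c = cos (arctan \<alpha>)"
  have c: "c > 0" using cos_pos by (simp add: c_def)
  obtain R where R: "\<And>v. v \<in> H \<Longrightarrow> R \<le> \<bar>Im (rot * v)\<bar> \<Longrightarrow> y < vec_area (rot * v)"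
    using ev unfolding eventually_far_iff by auto
  have "(\<lambda>n. (real K)\<^sup>2 * \<bar>skew\<bar> * (theta (Suc n))\<^sup>2) \<longlonglongrightarrow> (real K)\<^sup>2 * \<bar>skew\<bar> * 0\<^sup>2"
    by (intro tendsto_intros theta_tendsto_0)
  then have ev1: "\<forall>\<^sub>F n in sequentially. (real K)\<^sup>2 * \<bar>skew\<bar> * (theta (Suc n))\<^sup>2 < y - y1"
    by (rule order_tendstoD) (use y in auto)
  have ev2: "\<forall>\<^sub>F n in sequentially. \<bar>theta (Suc n)\<bar> < 1"
    using order_tendstoD(2)[OF tendsto_rabs[OF theta_tendsto_0], of 1] by simp
  \<comment> \<open>As \<open>Q \<ge> n\<close> and
    \<open>\<bar>\<alpha> * P + Q\<bar> \<ge> Q - \<bar>\<alpha>\<bar>\<close>, the rotated vector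
    has imaginary part at least \<open>R\<close> in modulus once \<open>n \<ge> n1\<close>.\<close>
  obtain n1 :: nat where n1: "real n1 \<ge> R / c + \<bar>\<alpha>\<bar>" using real_arch_simple by blast
  have ev3: "\<forall>\<^sub>F n in sequentially. n \<ge> n1" by (rule eventually_ge_at_top)
  show ?thesis
    using ev1 ev2 ev3
  proof eventually_elim
    case (elim n)
    define P Q t where "P = real_of_int (cnum a (Suc n))" and "Q = real_of_int (cden a (Suc n))" and "t = theta (Suc n)"
    have P: "P = \<alpha> * Q - t" by (simp add: P_def Q_def t_def theta_def)
    have Q: "Q \<ge> real n" "Q \<ge> 1" using cden_ge[of n] cden_pos[of n] unfolding Q_def by linarith+
    obtain s :: real where s: "s = 1 \<or> s = -1" and sv: "of_real s * (of_nat (k n) * conv_vec n) \<in> H" (is "?v \<in> H")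
      using v[of n] by (metis mult_1 mult_minus1 of_real_1 of_real_minus)
    have comp: "Re ?v = s * k n * P" "Im ?v = s * k n * Q" by (simp_all add: P_def Q_def)
    have kn: "real (k n) \<ge> 1" "real (k n) \<le> K" using k[of n] by auto
    have e: "Re ?v - \<alpha> * Im ?v = - s * k n * t" unfolding comp P by (simp add: algebra_simps)
    have "Im (rot * ?v) = c * (s * k n * (\<alpha> * P + Q))"
      unfolding rot_components comp c_def by (simp add: algebra_simps)
    then have "\<bar>Im (rot * ?v)\<bar> = c * (k n * \<bar>\<alpha> * P + Q\<bar>)" using s c by (auto simp: abs_mult)
    moreover have "\<bar>\<alpha> * P + Q\<bar> \<ge> Q - \<bar>\<alpha>\<bar>"
    proof -
      have "\<alpha> * P + Q = \<alpha>\<^sup>2 * Q + Q - \<alpha> * t" by (simp add: P power2_eq_square algebra_simps)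
      moreover have "\<alpha>\<^sup>2 * Q \<ge> 0" using Q by simp
      moreover have "\<bar>\<alpha> * t\<bar> \<le> \<bar>\<alpha>\<bar> * 1" unfolding abs_mult using elim(2) by (intro mult_left_mono) (auto simp: t_def)
      ultimately show ?thesis by linarith
    qed
    moreover have "Q - \<bar>\<alpha>\<bar> \<ge> R / c" using n1 elim(3) Q(1) by linarith
    ultimately have far: "R \<le> \<bar>Im (rot * ?v)\<bar>"
    proof -
      assume 1: "\<bar>Im (rot * ?v)\<bar> = c * (k n * \<bar>\<alpha> * P + Q\<bar>)" and 2: "\<bar>\<alpha> * P + Q\<bar> \<ge> Q - \<bar>\<alpha>\<bar>" "Q - \<bar>\<alpha>\<bar> \<ge> R / c"
      have "R / c \<le> \<bar>\<alpha> * P + Q\<bar>" using 2 by linarith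
      also have "\<dots> \<le> k n * \<bar>\<alpha> * P + Q\<bar>" using mult_right_mono[OF kn(1), of "\<bar>\<alpha> * P + Q\<bar>"] by simp
      finally show ?thesis unfolding 1 using c by (simp add: pos_divide_le_eq mult.commute)
    qed
    have "y < vec_area (rot * ?v)" by (rule R[OF sv far])
    also have "\<dots> = \<bar>- s * k n * t\<bar> * \<bar>s * k n * Q + skew * (- s * k n * t)\<bar>" unfolding vec_area_rot e unfolding comp ..
    also have "\<dots> = (real (k n))\<^sup>2 * (\<bar>t\<bar> * \<bar>Q - skew * t\<bar>)"
    proof -
      have "s * k n * Q + skew * (- s * k n * t) = s * k n * (Q - skew * t)" by (simp add: algebra_simps)
      then show ?thesis using s by (auto simp: abs_mult power2_eq_square)
    qed
    also have "\<dots> \<le> (real (k n))\<^sup>2 * (\<bar>t\<bar> * (Q + \<bar>skew\<bar> * \<bar>t\<bar>))"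
      using Q by (intro mult_left_mono) (auto simp: abs_mult[symmetric])
    also have "\<dots> = (real (k n))\<^sup>2 / height n + (real (k n))\<^sup>2 * (\<bar>skew\<bar> * t\<^sup>2)"
    proof -
      have "1 / height n = \<bar>t\<bar> * Q" unfolding height_eq by (simp add: t_def Q_def)
      then have "(real (k n))\<^sup>2 / height n = (real (k n))\<^sup>2 * (\<bar>t\<bar> * Q)" by (metis mult.right_neutral times_divide_eq_right)
      then show ?thesis by (simp add: algebra_simps power2_eq_square abs_mult_self_eq)
    qed
    also have "(real (k n))\<^sup>2 * (\<bar>skew\<bar> * t\<^sup>2) \<le> (real K)\<^sup>2 * (\<bar>skew\<bar> * t\<^sup>2)"
      using kn by (intro mult_right_mono power_mono) auto
    finally show ?case using elim(1) by (simp add: t_def mult.assoc)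
  qed
qed

end

section \<open>Rotation of surfaces and multiplicities\<close>

lemma rotate_surface_simps [simp]:
  "surf (rotate_surface \<theta> X) = surf X" "charts (rotate_surface \<theta> X) = charts X"
  "form (rotate_surface \<theta> X) = (\<lambda>c z. cis \<theta> * form X c z)" "marked (rotate_surface \<theta> X) = marked X"
  by (simp_all add: rotate_surface_def)

lemma singularities_rotate [simp]: "singularities (rotate_surface \<theta> X) = singularities X"
  by (simp add: singularities_def zeros_def)

lemma primitive_on_rotate:
  assumes "primitive_on X W F"
  shows "primitive_on (rotate_surface \<theta> X) W (\<lambda>x. cis \<theta> * F x)"
proof -
  have "((\<lambda>x. cis \<theta> * F x) \<circ> inv_into U \<phi> has_field_derivative cis \<theta> * form X (U, \<phi>) (\<phi> x)) (at (\<phi> x))"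
    if "(U, \<phi>) \<in> charts X" "x \<in> U \<inter> W" for U \<phi> x
  proof -
    have "(F \<circ> inv_into U \<phi> has_field_derivative form X (U, \<phi>) (\<phi> x)) (at (\<phi> x))"
      using assms that unfolding primitive_on_def by blast
    then have "((\<lambda>w. cis \<theta> * (F \<circ> inv_into U \<phi>) w) has_field_derivative cis \<theta> * form X (U, \<phi>) (\<phi> x)) (at (\<phi> x))"
      by (rule DERIV_cmult)
    then show ?thesis by (simp add: comp_def)
  qed
  then show ?thesis using assms unfolding primitive_on_def by auto
qed

lemma saddle_connection_rotate:
  assumes "saddle_connection X \<gamma> v"
  shows "saddle_connection (rotate_surface \<theta> X) \<gamma> (cis \<theta> * v)"
proof -
  have "integral_along (rotate_surface \<theta> X) \<gamma> (\<lambda>t. of_real t * (cis \<theta> * v))"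
    unfolding integral_along_def
  proof (intro conjI ballI)
    fix t :: real assume "t \<in> {0..1}"
    then obtain W F e where W: "primitive_on X W F" "e > 0"
      "\<And>s. s \<in> {0..1} \<Longrightarrow> \<bar>s - t\<bar> < e \<Longrightarrow> \<gamma> s \<in> W \<and> F (\<gamma> s) - F (\<gamma> t) = of_real s * v - of_real t * v"
      using assms unfolding saddle_connection_def integral_along_def by metis
    have "\<gamma> s \<in> W \<and> cis \<theta> * F (\<gamma> s) - cis \<theta> * F (\<gamma> t) = of_real s * (cis \<theta> * v) - of_real t * (cis \<theta> * v)"
      if "s \<in> {0..1}" "\<bar>s - t\<bar> < e" for s
    proof -
      have "cis \<theta> * F (\<gamma> s) - cis \<theta> * F (\<gamma> t) = cis \<theta> * (F (\<gamma> s) - F (\<gamma> t))" by (simp add: algebra_simps)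
      then show ?thesis using W(3)[OF that] by (simp add: algebra_simps)
    qed
    then show "\<exists>W F e. primitive_on (rotate_surface \<theta> X) W F \<and> 0 < e \<and> (\<forall>s\<in>{0..1}. \<bar>s - t\<bar> < e \<longrightarrow>
        \<gamma> s \<in> W \<and> F (\<gamma> s) - F (\<gamma> t) = of_real s * (cis \<theta> * v) - of_real t * (cis \<theta> * v))"
      using primitive_on_rotate[OF W(1)] W(2) by blast
  qed simp
  then show ?thesis using assms by (simp add: saddle_connection_def)
qed

lemma rotate_surface_inverse: "rotate_surface (- \<theta>) (rotate_surface \<theta> X) = X"
proof -
  have "cis (- \<theta>) * cis \<theta> = 1" by (simp add: cis_mult)
  then have "(\<lambda>c z. cis (- \<theta>) * (cis \<theta> * form X c z)) = form X" by (simp only: mult.assoc[symmetric] mult_1_left)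
  then show ?thesis by (simp add: rotate_surface_def)
qed

lemma Hol_rotate: "Hol (rotate_surface \<theta> X) = (\<lambda>v. cis \<theta> * v) ` Hol X"
proof (intro equalityI subsetI)
  fix w assume "w \<in> Hol (rotate_surface \<theta> X)"
  then obtain \<gamma> where "saddle_connection (rotate_surface \<theta> X) \<gamma> w" by (auto simp: Hol_def)
  then have "saddle_connection X \<gamma> (cis (- \<theta>) * w)"
    using saddle_connection_rotate[of "rotate_surface \<theta> X" \<gamma> w "- \<theta>"] by (simp add: rotate_surface_inverse)
  moreover have "w = cis \<theta> * (cis (- \<theta>) * w)" by (simp add: mult.assoc[symmetric] cis_mult)
  ultimately show "w \<in> (\<lambda>v. cis \<theta> * v) ` Hol X" unfolding Hol_def by blast
qed (auto simp: Hol_def intro: saddle_connection_rotate)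

text \<open>Any such \<open>m\<close> is the gcd of the two coordinates, which gives the uniqueness
  demanded by \<open>THE\<close>.\<close>

lemma saddle_mult_eq:
  assumes "coprime p q" "m > 0" "v = of_nat m * Complex (of_int p) (of_int q)"
  shows "saddle_mult v = m"
  unfolding saddle_mult_def
proof (rule the_equality)
  show "m > 0 \<and> (\<exists>p q :: int. coprime p q \<and> v = of_nat m * Complex (of_int p) (of_int q))" using assms by blast
  fix m' assume "m' > 0 \<and> (\<exists>p q :: int. coprime p q \<and> v = of_nat m' * Complex (of_int p) (of_int q))"
  then obtain p' q' :: int where m': "m' > 0" "coprime p' q'" "v = of_nat m' * Complex (of_int p') (of_int q')" by blast
  have "real_of_int (int m * p) = real_of_int (int m' * p')" "real_of_int (int m * q) = real_of_int (int m' * q')"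
    using assms(3) m'(3) by (simp_all add: complex_eq_iff)
  then have "int m * p = int m' * p'" "int m * q = int m' * q'" by (simp_all only: of_int_eq_iff)
  then have "gcd (int m * p) (int m * q) = gcd (int m' * p') (int m' * q')" by simp
  then show "m' = m" using assms(1) m'(2) by (simp add: gcd_mult_left coprime_iff_gcd_eq_1)
qed

lemma saddle_mult_minus_eq:
  assumes "coprime p q" "m > 0" "v = - (of_nat m * Complex (of_int p) (of_int q))"
  shows "saddle_mult v = m"
  using assms by (intro saddle_mult_eq[of "- p" "- q"]) (auto simp: complex_eq_iff)

text \<open>Bezout's identity writes \<open>t\<close> as an integer combination of the coordinates
  \<open>t * p\<close> and \<open>t * q\<close>.\<close>

lemma scaled_coprime_gaussian:
  fixes p q :: int
  assumes "coprime p q" "of_real t * Complex (of_int p) (of_int q) \<in> gaussian_ints"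
  shows "t \<in> \<int>"
proof -
  obtain x y where xy: "x * p + y * q = 1"
    using assms(1) bezout_int[of p q] by (auto simp: coprime_iff_gcd_eq_1)
  have "t * p \<in> \<int>" "t * q \<in> \<int>" using assms(2) by (auto simp: gaussian_ints_iff)
  then have "of_int x * (t * p) + of_int y * (t * q) \<in> \<int>" by auto
  moreover have "of_int x * (t * p) + of_int y * (t * q) = t * real_of_int (x * p + y * q)" by (simp add: algebra_simps)
  ultimately show ?thesis using xy by simp
qed

lemma (in flat_cover) seg_dir_coprime:
  assumes "coprime p q"
  shows "seg_dir (Complex (of_int p) (of_int q))"
  unfolding seg_dir_def
proof (intro conjI ballI notI)
  show "Complex (of_int p) (of_int q) \<in> gaussian_ints" by (auto simp: gaussian_ints_def)
  fix t :: real assume "t \<in> {0<..<1}" "of_real t * Complex (of_int p) (of_int q) \<in> gaussian_ints"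
  then show False using scaled_coprime_gaussian[OF assms] no_int_between by auto
qed

text \<open>Modulo the lattice, half of \<open>(p, q)\<close> depends only on the parities of
  \<open>p\<close> and \<open>q\<close>. At most four fibres occur, so the length of chains of lifts
  is bounded for all directions at once.\<close>

lemma (in flat_cover) card_fibre_half_bounded:
  obtains K where "\<And>p q :: int. card (fibre (of_real (1 / 2) * Complex (of_int p) (of_int q))) \<le> K"
proof -
  let ?h = "\<lambda>p q :: int. of_real (1 / 2) * Complex (of_int p) (of_int q)"
  define B where "B = (\<lambda>(p, q). card (fibre (?h p q))) ` ({0, 1} \<times> {0, 1})"
  have "card (fibre (?h p q)) \<in> B" for p q
  proof -
    have "?h p q - ?h (p mod 2) (q mod 2) = Complex (of_int (p div 2)) (of_int (q div 2))"
    proof -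
      have "real_of_int p = 2 * of_int (p div 2) + of_int (p mod 2)" "real_of_int q = 2 * of_int (q div 2) + of_int (q mod 2)"
        by (metis mult_div_mod_eq of_int_add of_int_mult of_int_numeral)+
      then show ?thesis by (simp add: complex_eq_iff field_simps)
    qed
    then have "torus_proj (?h p q) = torus_proj (?h (p mod 2) (q mod 2))"
      unfolding torus_proj_eq_iff by (auto simp: gaussian_ints_def)
    then have "fibre (?h p q) = fibre (?h (p mod 2) (q mod 2))" by (simp add: fibre_def)
    moreover have "p mod 2 \<in> {0, 1}" "q mod 2 \<in> {0, 1}" by auto
    ultimately show ?thesis unfolding B_def by (intro image_eqI[of _ _ "(p mod 2, q mod 2)"]) auto
  qed
  moreover have "finite B" by (simp add: B_def)
  ultimately have "card (fibre (?h p q)) \<le> Max B" for p q by simp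
  then show ?thesis using that by blast
qed

section \<open>The torus and the origami as flat covers\<close>

lemma flat_cover_torus: "flat_cover standard_torus (\<lambda>x. x)"
proof
  show "Hausdorff_space torus_top" "compact_space torus_top" "connected_space torus_top"
    by (rule Hausdorff_torus compact_torus connected_torus)+
  show "\<Union> (fst ` charts standard_torus) = topspace torus_top"
  proof
    show "\<Union> (fst ` charts standard_torus) \<subseteq> topspace torus_top" by (auto simp: charts_torus topspace_torus)
    show "topspace torus_top \<subseteq> \<Union> (fst ` charts standard_torus)"
    proof
      fix x assume "x \<in> topspace torus_top"
      then obtain z where "x = torus_proj z" by (auto simp: topspace_torus)
      moreover have "(torus_proj ` ball z (1 / 2), inv_into (ball z (1 / 2)) torus_proj) \<in> charts standard_torus"
        using inj_on_torus_proj_ball unfolding charts_torus by blast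
      ultimately show "x \<in> \<Union> (fst ` charts standard_torus)" by force
    qed
  qed
  show "translation_cover standard_torus standard_torus {torus_proj 0} (\<lambda>x. x)" by (rule translation_cover_torus_id)
next
  fix U \<phi> assume "(U, \<phi>) \<in> charts standard_torus"
  then obtain W where W: "open W" "inj_on torus_proj W" "U = torus_proj ` W" "\<phi> = inv_into W torus_proj"
    by (auto simp: charts_torus)
  have "\<phi> ` U = W" using W by (simp add: inv_into_image_cancel)
  then show "openin torus_top U \<and> open (\<phi> ` U) \<and> homeomorphic_map (subtopology torus_top U) (top_of_set (\<phi> ` U)) \<phi>"
    using W open_torus_proj homeomorphic_map_inv_torus_proj by simp
qed (simp add: standard_torus_def)

lemma surface_area_torus: "surface_area (rotate_surface \<theta> standard_torus) = 1"
proof -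
  interpret T: flat_cover standard_torus "\<lambda>x. x" by (rule flat_cover_torus)
  have "T.fibre T.centre = {torus_proj T.centre}" by (auto simp: T.fibre_def topspace_torus)
  then show ?thesis by (simp add: T.surface_area_rotate)
qed

lemma origami_flat_cover:
  assumes "origami X \<rho>"
  shows "flat_cover X \<rho>"
proof
  have X: "riemann_surface (surf X) (charts X)" "compact_space (surf X)"
    "translation_cover X standard_torus {torus_proj 0} \<rho>" "\<rho> ` singularities X \<subseteq> {torus_proj 0}"
    using assms by (auto simp: origami_def translation_surface_def)
  then show "Hausdorff_space (surf X)" "compact_space (surf X)" "connected_space (surf X)"
    "\<Union> (fst ` charts X) = topspace (surf X)" "translation_cover X standard_torus {torus_proj 0} \<rho>"
    by (auto simp: riemann_surface_def)
  show "openin (surf X) U \<and> open (\<phi> ` U) \<and> homeomorphic_map (subtopology (surf X) U) (top_of_set (\<phi> ` U)) \<phi>"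
    if "(U, \<phi>) \<in> charts X" for U \<phi> using X(1) that unfolding riemann_surface_def by blast
  show "form X (U, \<phi>) (\<phi> x) \<noteq> 0" if "(U, \<phi>) \<in> charts X" "x \<in> U" "\<rho> x \<noteq> torus_proj 0" for U \<phi> x
  proof
    assume "form X (U, \<phi>) (\<phi> x) = 0"
    then have "x \<in> singularities X" using that by (auto simp: singularities_def zeros_def)
    then show False using X(4) that(3) by blast
  qed
qed

section \<open>Multiplicities and the Lagrange value of a reduced origami\<close>

locale reduced_origami_cfrac = irrational_cfrac \<alpha> a
  for X :: "'a surface" and \<rho> :: "'a \<Rightarrow> complex set" and \<alpha> :: real and a :: "nat \<Rightarrow> int" +
  assumes origami: "origami X \<rho>" and reduced: "reduced_surface X"
begin

sublocale flat_cover X \<rho> by (rule origami_flat_cover[OF origami])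

abbreviation mult :: "nat \<Rightarrow> nat" where "mult n \<equiv> min_mult X (cfrac_conv a n)"

lemma Hol_subset: "Hol X \<subseteq> gaussian_ints - {0}"
proof
  fix v assume v: "v \<in> Hol X"
  then have "v \<in> group_closure (Hol X)" by (intro group_closure.base) simp
  moreover have "v \<noteq> 0" using v by (auto simp: Hol_def saddle_connection_def)
  ultimately show "v \<in> gaussian_ints - {0}" using reduced by (simp add: reduced_surface_def)
qed

lemma singularities_fibre: "singularities X \<subseteq> fibre 0"
proof
  fix x assume x: "x \<in> singularities X"
  have "x \<in> topspace (surf X)"
    using x origami charts_cover by (force simp: singularities_def zeros_def origami_def translation_surface_def)
  then show "x \<in> fibre 0" using x origami by (auto simp: origami_def fibre_def)
qed

text \<open>Without singularities there would be no periods, and the group they generate would be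
  trivial instead of the Gaussian integers.\<close>

lemma singularity_exists: obtains x where "x \<in> singularities X"
proof -
  have "Hol X \<noteq> {}"
  proof
    assume "Hol X = {}"
    then have "group_closure (Hol X) \<subseteq> {0}" by (auto elim!: group_closure.induct)
    moreover have "1 \<in> gaussian_ints" by (auto simp: gaussian_ints_iff)
    ultimately show False using reduced by (auto simp: reduced_surface_def)
  qed
  then show ?thesis using that by (auto simp: Hol_def saddle_connection_def)
qed

lemma min_mult_unfold:
  "mult n = (LEAST m. \<exists>\<gamma> v. saddle_connection X \<gamma> v \<and> parallel v (conv_vec n) \<and> saddle_mult v = m)"
  by (simp add: min_mult_def quotient_of_cfrac_conv)

lemma mult_le:
  assumes "v \<in> Hol X" "m > 0" "v = of_nat m * conv_vec n \<or> v = - (of_nat m * conv_vec n)"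
  shows "mult n \<le> m"
proof -
  obtain \<gamma> where \<gamma>: "saddle_connection X \<gamma> v" using assms(1) by (auto simp: Hol_def)
  have "saddle_mult v = m"
    using assms coprime_cnum_cden[of a "Suc n"] saddle_mult_eq saddle_mult_minus_eq by blast
  moreover have "parallel v (conv_vec n)"
    unfolding parallel_def
  proof (rule disjE[OF assms(3)])
    assume "v = of_nat m * conv_vec n"
    then show "\<exists>t. t \<noteq> 0 \<and> v = of_real t * conv_vec n" using assms(2) by (intro exI[of _ "real m"]) auto
  next
    assume "v = - (of_nat m * conv_vec n)"
    then show "\<exists>t. t \<noteq> 0 \<and> v = of_real t * conv_vec n" using assms(2) by (intro exI[of _ "- real m"]) auto
  qed
  ultimately show ?thesis unfolding min_mult_unfold using \<gamma> by (intro Least_le) blast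
qed

lemma mult_bounded: obtains K where "\<And>n. mult n \<le> K"
proof -
  obtain K where K: "\<And>p q :: int. card (fibre (of_real (1 / 2) * Complex (of_int p) (of_int q))) \<le> K"
    using card_fibre_half_bounded by blast
  obtain x where x: "x \<in> singularities X" by (rule singularity_exists)
  have "mult n \<le> K" for n
  proof -
    obtain k \<gamma> where k: "1 \<le> k" "k \<le> card (fibre (of_real (1 / 2) * conv_vec n))" "saddle_connection X \<gamma> (of_nat k * conv_vec n)"
      using saddle_connection_exists[OF seg_dir_coprime[OF coprime_cnum_cden] x _ singularities_fibre] singularities_fibre x by blast
    then have "of_nat k * conv_vec n \<in> Hol X" by (auto simp: Hol_def)
    then have "mult n \<le> k" using mult_le k(1) by simp
    also have "k \<le> K" using k(2) K[of "cnum a (Suc n)" "cden a (Suc n)"] by (rule order_trans)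
    finally show ?thesis .
  qed
  then show ?thesis using that by blast
qed

text \<open>\<open>LEAST\<close> is attained because a saddle connection exists in this direction.
  Its period is a lattice vector parallel to a primitive one, hence an integer multiple of it; the
  multiple may be negative, which accounts for the two cases.\<close>

lemma mult_attained: "1 \<le> mult n" "of_nat (mult n) * conv_vec n \<in> Hol X \<or> - (of_nat (mult n) * conv_vec n) \<in> Hol X"
proof -
  let ?P = "\<lambda>m. \<exists>\<gamma> v. saddle_connection X \<gamma> v \<and> parallel v (conv_vec n) \<and> saddle_mult v = m"
  obtain x where x: "x \<in> singularities X" by (rule singularity_exists)
  obtain k \<gamma> where k: "1 \<le> k" "saddle_connection X \<gamma> (of_nat k * conv_vec n)"
    using saddle_connection_exists[OF seg_dir_coprime[OF coprime_cnum_cden] x _ singularities_fibre] singularities_fibre x by blast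
  have "parallel (of_nat k * conv_vec n) (conv_vec n)"
    unfolding parallel_def using k(1) by (intro exI[of _ "real k"]) auto
  then have "\<exists>m. ?P m" using k by blast
  then have "?P (mult n)" unfolding min_mult_unfold by (rule LeastI_ex)
  then obtain \<gamma>' v where v: "saddle_connection X \<gamma>' v" "parallel v (conv_vec n)" "saddle_mult v = mult n" by blast
  then have vH: "v \<in> Hol X" by (auto simp: Hol_def)
  obtain t where t: "t \<noteq> 0" "v = of_real t * conv_vec n" using v(2) by (auto simp: parallel_def)
  have "t \<in> \<int>" using scaled_coprime_gaussian[OF coprime_cnum_cden] vH Hol_subset t(2) by blast
  then obtain j where j: "t = of_int j" by (auto elim: Ints_cases)
  have j0: "nat \<bar>j\<bar> > 0" using t j by simp
  have vj: "v = of_nat (nat \<bar>j\<bar>) * conv_vec n \<or> v = - (of_nat (nat \<bar>j\<bar>) * conv_vec n)"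
    unfolding t(2) j by (cases "j \<ge> 0") (auto simp: complex_eq_iff)
  have "mult n = nat \<bar>j\<bar>"
    using vj j0 v(3) coprime_cnum_cden[of a "Suc n"] saddle_mult_eq saddle_mult_minus_eq by metis
  then show "1 \<le> mult n" "of_nat (mult n) * conv_vec n \<in> Hol X \<or> - (of_nat (mult n) * conv_vec n) \<in> Hol X"
    using j0 vj vH by auto
qed

text \<open>\<open>Max\<close> is meaningful on finite sets, and the uniform bound makes the range
  finite.\<close>

lemma mult_le_max_mult: "mult n \<le> max_mult X a"
proof -
  obtain K where "\<And>n. mult n \<le> K" using mult_bounded by blast
  then have "range mult \<subseteq> {..K}" by auto
  then have "finite (range mult)" using finite_subset by blast
  then show ?thesis unfolding max_mult_def by (intro Max_ge) auto
qed

text \<open>Here the hypothesis on the torus enters: it puts the limit inferior below the bound \<open>1 / 2\<close> of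
  Legendre's theorem.\<close>

lemma half_bound:
  assumes large: "lagrange standard_torus \<alpha> > ereal (2 * (real (max_mult X a))\<^sup>2)"
    and ev: "\<forall>\<^sub>F n in sequentially. y \<le> (real (mult n))\<^sup>2 / height n"
  shows "y < 1 / 2"
proof (rule ccontr)
  assume y: "\<not> y < 1 / 2"
  define M where "M = real (max_mult X a)"
  have multM: "1 \<le> real (mult n)" "real (mult n) \<le> M" for n using mult_attained(1)[of n] mult_le_max_mult[of n] by (auto simp: M_def)
  then have M: "M \<ge> 1" using order_trans by blast
  \<comment> \<open>The reciprocal of the threshold in the hypothesis. Dividing
    \<open>(real (mult n))\<^sup>2 / height n \<ge> 1 / 2\<close> by \<open>M\<^sup>2\<close> gives
    \<open>1 / height n \<ge> B\<close>, the input of \<open>rot_area_lower\<close> for multiplicity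
    1.\<close>
  define B where "B = 1 / (2 * M\<^sup>2)"
  have M2: "M\<^sup>2 \<ge> 1" using M by (simp add: one_le_power)
  have B: "0 < B" "B \<le> 1 / 2" using M2 by (auto simp: B_def divide_simps)
  have evB: "\<forall>\<^sub>F n in sequentially. B \<le> (real 1)\<^sup>2 / height n"
    using ev
  proof eventually_elim
    case (elim n)
    have "1 / 2 \<le> (real (mult n))\<^sup>2 / height n" using elim y by linarith
    also have "\<dots> \<le> M\<^sup>2 / height n" using multM height_pos[of n] by (intro divide_right_mono power_mono) (auto simp: less_imp_le)
    finally have "height n \<le> 2 * M\<^sup>2" using height_pos[of n] by (simp add: field_simps)
    then show ?case using height_pos[of n] by (simp add: B_def frac_le)
  qed
  let ?T = "rotate_surface (arctan \<alpha>) standard_torus"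
  let ?F = "inf (filtercomap (\<lambda>v. \<bar>Im v\<bar>) at_top) (principal (Hol ?T))"
  have far: "\<forall>\<^sub>F w in ?F. z < vec_area w" if "z < B" for z
    using rot_area_lower[OF Hol_torus_subset _ that B(2) evB] by (simp add: Hol_rotate rot_def)
  have "ereal B \<le> area_liminf ?T"
    unfolding area_liminf_def surface_area_torus
  proof (subst le_Liminf_iff, intro allI impI)
    fix z assume "z < ereal B"
    then obtain r where r: "z < ereal r" "r < B" using ereal_dense2[of z "ereal B"] by auto
    show "\<forall>\<^sub>F w in ?F. z < ereal (vec_area w / enn2real 1)"
      using far[OF r(2)] by eventually_elim (use r(1) in \<open>auto intro: less_trans\<close>)
  qed
  then have "inverse (area_liminf ?T) \<le> inverse (ereal B)" using B by (intro ereal_inverse_antimono) auto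
  then have "lagrange standard_torus \<alpha> \<le> ereal (2 * M\<^sup>2)"
    using B M2 by (simp add: lagrange_def divide_ereal_def B_def)
  then show False using large by (simp add: M_def)
qed

text \<open>All periods together have the same limit inferior of normalised areas as the shortest
  periods on convergents: \<open>rot_area_lower\<close> gives one inequality and
  \<open>rot_area_upper\<close> the other. Taking reciprocals turns it into the limit
  superior.\<close>

lemma lagrange_eq:
  assumes large: "lagrange standard_torus \<alpha> > ereal (2 * (real (max_mult X a))\<^sup>2)"
  shows "lagrange X \<alpha> = ereal (real (num_squares X \<rho>)) * limsup (\<lambda>n. ereal (height n / (real (mult n))\<^sup>2))"
proof -
  define N where "N = real (num_squares X \<rho>)"
  have N: "N > 0" using card_centre_pos by (simp add: N_def num_squares_eq)
  let ?T = "rotate_surface (arctan \<alpha>) X"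
  let ?F = "inf (filtercomap (\<lambda>v. \<bar>Im v\<bar>) at_top) (principal (Hol ?T))"
  let ?h = "\<lambda>n. ereal (N * (height n / (real (mult n))\<^sup>2))"
  let ?g = "\<lambda>n. ereal ((real (mult n))\<^sup>2 / height n / N)"
  obtain K where K: "\<And>n. mult n \<le> K" using mult_bounded by blast
  have HolT: "Hol ?T = (\<lambda>v. rot * v) ` Hol X" by (simp add: Hol_rotate rot_def)
  have area: "enn2real (surface_area ?T) = N"
    by (simp add: surface_area_rotate N_def num_squares_eq ennreal_of_nat_eq_real_of_nat)
  have lower: "liminf ?g \<le> area_liminf ?T"
    unfolding area_liminf_def area
  proof (subst le_Liminf_iff, intro allI impI)
    fix z assume "z < liminf ?g"
    then obtain y where y: "z < ereal y" "ereal y < liminf ?g" using ereal_dense2 by blast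
    then obtain y' where y': "y < y'" "ereal y' < liminf ?g" using ereal_dense2[of "ereal y" "liminf ?g"] by auto
    have "\<forall>\<^sub>F n in sequentially. ereal y' < ?g n" using less_LiminfD[OF y'(2)] .
    then have ev: "\<forall>\<^sub>F n in sequentially. y' * N \<le> (real (mult n))\<^sup>2 / height n"
      by eventually_elim (use N in \<open>simp add: pos_less_divide_eq less_imp_le del: divide_divide_eq_left\<close>)
    \<comment> \<open>The gap between \<open>y\<close> and \<open>y'\<close> is what
      \<open>rot_area_lower\<close> spends on the error term; its condition
      \<open>y' * N \<le> 1 / 2\<close> comes from \<open>half_bound\<close>.\<close>
    have "y * N < y' * N" using y'(1) N by simp
    then have "\<forall>\<^sub>F w in ?F. y * N < vec_area w"
      unfolding HolT using rot_area_lower[OF Hol_subset _ _ _ ev] mult_le half_bound[OF large ev] by (simp add: less_imp_le)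
    then show "\<forall>\<^sub>F w in ?F. z < ereal (vec_area w / N)"
    proof eventually_elim
      case (elim w)
      then have "ereal y < ereal (vec_area w / N)" using N by (simp add: pos_less_divide_eq)
      then show ?case using y(1) by (rule less_trans[rotated])
    qed
  qed
  have upper: "area_liminf ?T \<le> liminf ?g"
  proof (subst le_Liminf_iff, intro allI impI)
    fix z assume "z < area_liminf ?T"
    then obtain y1 where y1: "z < ereal y1" "ereal y1 < area_liminf ?T" using ereal_dense2 by blast
    then obtain y where y: "y1 < y" "ereal y < area_liminf ?T" using ereal_dense2[of "ereal y1" "area_liminf ?T"] by auto
    have "\<forall>\<^sub>F w in ?F. ereal y < ereal (vec_area w / N)"
      using less_LiminfD[OF y(2)[unfolded area_liminf_def area]] .
    then have "\<forall>\<^sub>F w in ?F. y * N < vec_area w" by eventually_elim (use N in \<open>simp add: pos_less_divide_eq\<close>)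
    moreover have "y1 * N < y * N" using y(1) N by simp
    ultimately have "\<forall>\<^sub>F n in sequentially. y1 * N < (real (mult n))\<^sup>2 / height n"
      unfolding HolT by (intro rot_area_upper[OF mult_attained(1) K mult_attained(2)])
    then show "\<forall>\<^sub>F n in sequentially. z < ?g n"
    proof eventually_elim
      case (elim n)
      then have "ereal y1 < ?g n" using N by (simp add: pos_less_divide_eq del: divide_divide_eq_left)
      then show ?case using y1(1) by (rule less_trans[rotated])
    qed
  qed
  have g_inv: "?g n = inverse (?h n)" for n
    using N height_pos[of n] mult_attained(1)[of n] by (simp add: field_simps)
  \<comment> \<open>Inversion exchanges the two limits for nonnegative extended reals; as
    \<open>1 / 0 = \<infinity>\<close>, the limits 0 and \<open>\<infinity>\<close> need no separate
    treatment.\<close>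
  have "liminf ?g = inverse (limsup ?h)"
    unfolding g_inv using N height_pos by (intro Liminf_inverse_ereal) (auto simp: less_imp_le)
  moreover have "limsup ?h \<ge> 0"
    using N height_pos by (intro le_Limsup) (auto simp: less_imp_le)
  ultimately have "lagrange X \<alpha> = limsup ?h"
    using lower upper by (simp add: lagrange_def divide_ereal_def)
  also have "\<dots> = limsup (\<lambda>n. ereal N * ereal (height n / (real (mult n))\<^sup>2))" by simp
  also have "\<dots> = ereal N * limsup (\<lambda>n. ereal (height n / (real (mult n))\<^sup>2))"
    using N by (intro Limsup_ereal_mult_left) auto
  finally show ?thesis by (simp add: N_def)
qed

end

theorem theorem5p12:
  fixes X :: "'a surface" and \<rho> :: "'a \<Rightarrow> complex set"
    and \<alpha> :: real and a :: "nat \<Rightarrow> int"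
  assumes "origami X \<rho>" and "reduced_surface X"
    and "\<alpha> \<notin> \<rat>" and "cfrac_expansion \<alpha> a"
    and "lagrange standard_torus \<alpha> > ereal (2 * (real (max_mult X a))\<^sup>2)"
  shows "lagrange X \<alpha> = ereal (real (num_squares X \<rho>)) *
    limsup (\<lambda>n. ereal (
      (cfrac (map (\<lambda>k. real_of_int (a k)) (rev [1..<n + 1])) + real_of_int (a (n + 1))
         + cfrac_inf (\<lambda>k. a (n + 2 + k)))
      / (real (min_mult X (cfrac_conv a n)))\<^sup>2))"
proof -
  interpret reduced_origami_cfrac X \<rho> \<alpha> a
    using assms by unfold_locales
  show ?thesis using lagrange_eq[OF assms(5)] unfolding height_def .
qed

end
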